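(* Let $s>3/2$. For any $u_o\in H^s(S^1)$ there exist $T>0$ and a unique solution $(\eta,\dot\eta)\in C^1((-T,T),\mathcal{D}^s(S^1)\times H^s(S^1))$ of the initial value problem $$\ddot\eta = f(\eta,\dot\eta),\qquad \eta(0,x)=x,\quad \dot\eta(0,x)=u_o(x),$$ where $$f(\eta,w) = -\Big\{A^{-1}\partial_x\Big(2\mu(w\circ\eta^{-1})\,w\circ\eta^{-1}+\tfrac12\big((w\circ\eta^{-1})_x\big)^2\Big)\Big\}\circ\eta,$$ and the solution depends differentiably on the initial data $u_o$.
   Context: $S^1=\mathbb{R}/\mathbb{Z}$, $\mu(u)=\int_{S^1}u\,dx$, $A=\mu-\partial_x^2$ (i.e. $Av=\mu(v)-v_{xx}$), an isomorphism $H^s\to H^{s-2}$. $\mathcal{D}^s(S^1)$ denotes the Hilbert manifold (topological group) of orientation-preserving diffeomorphisms of $S^1$ of Sobolev class $H^s$. *)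

theory Defs
  imports "HOL-Analysis.Analysis"
begin

text \<open>Functions on S^1 = R/Z are represented as 1-periodic functions real => real;
diffeomorphisms of S^1 are represented by their lifts eta : real => real with
eta - id periodic.\<close>

definition periodic1 :: "(real \<Rightarrow> real) \<Rightarrow> bool" where
  "periodic1 u \<longleftrightarrow> (\<forall>x. u (x + 1) = u x)"

definition fcoeff :: "(real \<Rightarrow> real) \<Rightarrow> int \<Rightarrow> complex" where
  "fcoeff u k = integral {0..1} (\<lambda>x. complex_of_real (u x) * cis (- 2 * pi * real_of_int k * x))"

text \<open>Sobolev space H^s(S^1) (s > 1/2, continuous representatives).\<close>
definition Hs :: "real \<Rightarrow> (real \<Rightarrow> real) \<Rightarrow> bool" where
  "Hs s u \<longleftrightarrow> continuous_on UNIV u \<and> periodic1 u \<and>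
     (\<lambda>k::int. (1 + (real_of_int k)\<^sup>2) powr s * (cmod (fcoeff u k))\<^sup>2) summable_on UNIV"

definition Hs_norm :: "real \<Rightarrow> (real \<Rightarrow> real) \<Rightarrow> real" where
  "Hs_norm s u = sqrt (\<Sum>\<^sub>\<infinity>k::int. (1 + (real_of_int k)\<^sup>2) powr s * (cmod (fcoeff u k))\<^sup>2)"

definition Ds :: "real \<Rightarrow> (real \<Rightarrow> real) \<Rightarrow> bool" where
  "Ds s \<eta> \<longleftrightarrow> bij \<eta> \<and> strict_mono \<eta> \<and> Hs s (\<lambda>x. \<eta> x - x) \<and> Hs s (\<lambda>x. inv \<eta> x - x)"

definition mu :: "(real \<Rightarrow> real) \<Rightarrow> real" where
  "mu u = integral {0..1} u"

definition smooth_periodic :: "(real \<Rightarrow> real) \<Rightarrow> bool" where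
  "smooth_periodic \<phi> \<longleftrightarrow> periodic1 \<phi> \<and> (\<forall>n x. ((deriv ^^ n) \<phi>) differentiable (at x))"

text \<open>A^{-1} d/dx h : the unique v in H^s with A v = h_x in the sense of distributions,
 where A v = mu(v) - v_xx.\<close>
definition Ainv_dx :: "real \<Rightarrow> (real \<Rightarrow> real) \<Rightarrow> (real \<Rightarrow> real)" where
  "Ainv_dx s h = (THE v. Hs s v \<and> (\<forall>\<phi>. smooth_periodic \<phi> \<longrightarrow>
       mu v * mu \<phi> - integral {0..1} (\<lambda>x. v x * deriv (deriv \<phi>) x)
       = - integral {0..1} (\<lambda>x. h x * deriv \<phi> x)))"

definition Fmu :: "real \<Rightarrow> (real \<Rightarrow> real) \<Rightarrow> (real \<Rightarrow> real) \<Rightarrow> (real \<Rightarrow> real)" where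
  "Fmu s \<eta> w = (let v = w \<circ> inv \<eta> in
     (\<lambda>x. - Ainv_dx s (\<lambda>y. 2 * mu v * v y + (deriv v y)\<^sup>2 / 2) (\<eta> x)))"

definition has_Hs_deriv :: "real \<Rightarrow> (real \<Rightarrow> real \<Rightarrow> real) \<Rightarrow> (real \<Rightarrow> real) \<Rightarrow> real \<Rightarrow> bool" where
  "has_Hs_deriv s \<gamma> d t \<longleftrightarrow>
     ((\<lambda>h. Hs_norm s (\<lambda>x. (\<gamma> (t + h) x - \<gamma> t x) / h - d x)) \<longlongrightarrow> 0) (at 0)"

definition Hs_continuous_at :: "real \<Rightarrow> (real \<Rightarrow> real \<Rightarrow> real) \<Rightarrow> real \<Rightarrow> bool" where
  "Hs_continuous_at s \<gamma> t \<longleftrightarrow> ((\<lambda>\<tau>. Hs_norm s (\<lambda>x. \<gamma> \<tau> x - \<gamma> t x)) \<longlongrightarrow> 0) (at t)"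

definition is_sol :: "real \<Rightarrow> real \<Rightarrow> (real \<Rightarrow> real) \<Rightarrow> (real \<Rightarrow> real \<Rightarrow> real) \<Rightarrow> (real \<Rightarrow> real \<Rightarrow> real) \<Rightarrow> bool" where
  "is_sol s T u \<eta> w \<longleftrightarrow>
     (\<forall>t\<in>{-T<..<T}. Ds s (\<eta> t) \<and> Hs s (w t) \<and>
        has_Hs_deriv s \<eta> (w t) t \<and>
        has_Hs_deriv s w (Fmu s (\<eta> t) (w t)) t \<and>
        Hs_continuous_at s w t \<and>
        Hs_continuous_at s (\<lambda>\<tau>. Fmu s (\<eta> \<tau>) (w \<tau>)) t) \<and>
     \<eta> 0 = (\<lambda>x. x) \<and> w 0 = u"

definition Hs_frechet :: "real \<Rightarrow> ((real \<Rightarrow> real) \<Rightarrow> (real \<Rightarrow> real) \<times> (real \<Rightarrow> real)) \<Rightarrow> (real \<Rightarrow> real) \<Rightarrow> bool" where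
  "Hs_frechet s \<Psi> u \<longleftrightarrow> (\<exists>L :: (real \<Rightarrow> real) \<Rightarrow> (real \<Rightarrow> real) \<times> (real \<Rightarrow> real).
     (\<forall>h g a. Hs s h \<longrightarrow> Hs s g \<longrightarrow>
        L (\<lambda>x. h x + g x) = (\<lambda>x. fst (L h) x + fst (L g) x, \<lambda>x. snd (L h) x + snd (L g) x) \<and>
        L (\<lambda>x. a * h x) = (\<lambda>x. a * fst (L h) x, \<lambda>x. a * snd (L h) x)) \<and>
     (\<exists>C. \<forall>h. Hs s h \<longrightarrow> Hs s (fst (L h)) \<and> Hs s (snd (L h)) \<and>
        Hs_norm s (fst (L h)) + Hs_norm s (snd (L h)) \<le> C * Hs_norm s h) \<and>
     (\<forall>\<epsilon>>0. \<exists>\<delta>>0. \<forall>h. Hs s h \<and> Hs_norm s h < \<delta> \<longrightarrow>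
        Hs_norm s (\<lambda>x. fst (\<Psi> (\<lambda>y. u y + h y)) x - fst (\<Psi> u) x - fst (L h) x)
      + Hs_norm s (\<lambda>x. snd (\<Psi> (\<lambda>y. u y + h y)) x - snd (\<Psi> u) x - snd (L h) x)
        \<le> \<epsilon> * Hs_norm s h))"

end

theory Submission
  imports Defs
begin

text \<open>
  Writing \<open>\<eta> = id + z\<close> and \<open>w = v \<circ> \<eta>\<close>, the right-hand side of the equation becomes an expression in
  \<open>z\<close>, \<open>z'\<close>, \<open>w\<close>, \<open>w'\<close> and \<open>1 / \<eta>'\<close> that contains no composition: since \<open>A\<^sup>-\<^sup>1 \<partial>\<^sub>x\<close> integrates once,
  \<open>f(\<eta>, w)\<close> is the function \<open>f\<close> with \<open>f' = k - (\<integral>k) \<eta>'\<close> and \<open>\<integral> f \<eta>' = 0\<close>, where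
  \<open>k = 2 (\<integral> w \<eta>') w \<eta>' + w'\<^sup>2 / (2 \<eta>')\<close>. Because \<open>H\<^sup>s\<^sup>-\<^sup>1\<close> is a Banach algebra and \<open>1 / \<eta>'\<close> is a Neumann
  series near the identity, this is a vector field with Lipschitz derivative near \<open>(id, u\<^sub>o)\<close> in
  \<open>H\<^sup>s \<times> H\<^sup>s\<close>, and the Picard iteration yields a unique flow that is differentiable in the initial
  datum. That the Eulerian objects \<open>f \<circ> \<eta>\<^sup>-\<^sup>1\<close> and \<open>\<eta>\<^sup>-\<^sup>1 - id\<close> lie in \<open>H\<^sup>s\<close> follows by interpolating the
  composition operator between \<open>L\<^sup>2\<close> and \<open>H\<^sup>1\<close> and then climbing up one derivative at a time.
\<close>

subsection \<open>Fourier series on the circle\<close>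

text \<open>Seen as a map of \<open>eta\<close>, composition with the inverse of \<open>eta\<close>
  is continuous on H^s but not Lipschitz, so the Eulerian form of f cannot be iterated directly. The
  formula for f' comes from integrating A V = h' once: testing with constants gives mean V = 0, and
  the rest says -V' = h - c with c the mean of h. For f = -V o eta this reads f' = (h o eta) eta' -
  c eta', and a change of variables turns c into the mean of k and mean V = 0 into the condition on
  f eta'. Two features of the statement shape the rest. And s is a real number, so climbing by whole
  derivatives needs starting values in a full unit interval of indices, which is what interpolation
  supplies.\<close>

definition ek :: "int \<Rightarrow> real \<Rightarrow> complex" where
  "ek k x = cis (2 * pi * real_of_int k * x)"

text \<open>Complex arguments are allowed so that a Fourier series has coefficients before it is
  known to be real valued.\<close>

definition cfc :: "(real \<Rightarrow> complex) \<Rightarrow> int \<Rightarrow> complex" where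
  "cfc f k = integral {0..1} (\<lambda>x. f x * ek (- k) x)"

lemma fcoeff_eq_cfc: "fcoeff u k = cfc (\<lambda>x. complex_of_real (u x)) k"
  by (simp add: fcoeff_def cfc_def ek_def)

lemma ek_add: "ek (j + k) x = ek j x * ek k x"
  by (simp add: ek_def cis_mult algebra_simps)

lemma ek_0 [simp]: "ek 0 x = 1"
  by (simp add: ek_def)

lemma norm_ek [simp]: "norm (ek k x) = 1"
  by (simp add: ek_def)

lemma cnj_ek: "cnj (ek k x) = ek (- k) x"
  by (simp add: ek_def cis_cnj)

lemma ek_periodic [simp]: "ek k (x + 1) = ek k x"
proof -
  have "ek k (x + 1) = ek k x * cis (2 * pi * real_of_int k)"
    by (simp add: ek_def cis_mult algebra_simps)
  also have "cis (2 * pi * real_of_int k) = 1"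
    by (intro cis_multiple_2pi) auto
  finally show ?thesis by simp
qed

lemma ek_has_vector_derivative:
  "(ek k has_vector_derivative (2 * pi * \<i> * of_int k) * ek k x) (at x within S)"
proof -
  have "((\<lambda>z. exp (\<i> * (2 * of_real pi * of_int k * z))) has_field_derivative
      (2 * pi * \<i> * of_int k) * exp (\<i> * (2 * of_real pi * of_int k * of_real x))) (at (of_real x))"
    by (auto intro!: derivative_eq_intros)
  from has_vector_derivative_real_field[OF this] show ?thesis
    by (simp add: ek_def[abs_def] cis_conv_exp)
qed

lemma continuous_on_ek [continuous_intros]: "continuous_on S (ek k)"
  unfolding ek_def[abs_def] by (intro continuous_intros)

lemma integral_ek: "integral {0..1} (ek k) = (if k = 0 then 1 else 0)"
proof (cases "k = 0")
  case True
  then have "ek k = (\<lambda>x. 1)" by auto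
  then show ?thesis using True by simp
next
  case False
  have "((\<lambda>x. (2 * pi * \<i> * of_int k) * ek k x) has_integral (ek k 1 - ek k 0)) {0..1}"
    by (intro fundamental_theorem_of_calculus ek_has_vector_derivative) auto
  moreover have "ek k 1 = ek k 0"
    using ek_periodic[of k 0] by simp
  ultimately have "((\<lambda>x. (2 * pi * \<i> * of_int k) * ek k x) has_integral 0) {0..1}"
    by simp
  then have "((\<lambda>x. inverse (2 * pi * \<i> * of_int k) * ((2 * pi * \<i> * of_int k) * ek k x)) has_integral
      inverse (2 * pi * \<i> * of_int k) * 0) {0..1}"
    by (rule has_integral_mult_right)
  moreover have "(\<lambda>x. inverse (2 * pi * \<i> * of_int k) * ((2 * pi * \<i> * of_int k) * ek k x)) = ek k"
    using False by (auto simp: field_simps)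
  ultimately have "(ek k has_integral 0) {0..1}" by simp
  then show ?thesis using False by (simp add: integral_unique)
qed

text \<open>The series converges uniformly along the filter of finite index sets by the Weierstrass
  test, so it may be integrated term by term. The extra factor \<open>f\<close> serves two purposes:
  a character yields the coefficients of a series, and a function times a character yields the
  convolution formula for products.\<close>

lemma has_sum_integral_series:
  fixes c :: "int \<Rightarrow> complex" and f :: "real \<Rightarrow> complex"
  assumes c: "(\<lambda>k. norm (c k)) summable_on UNIV" and f: "continuous_on {0..1} f"
  shows "((\<lambda>k. c k * integral {0..1} (\<lambda>x. f x * ek k x)) has_sum
          integral {0..1} (\<lambda>x. f x * (\<Sum>\<^sub>\<infinity>k. c k * ek k x))) UNIV"
proof -
  obtain B where B: "\<And>x. x \<in> {0..1} \<Longrightarrow> norm (f x) \<le> B"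
    using compact_imp_bounded[OF compact_continuous_image[OF f compact_Icc]]
    unfolding bounded_iff by blast
  have ul: "uniform_limit {0..1} (\<lambda>X x. \<Sum>k\<in>X. c k * (f x * ek k x))
      (\<lambda>x. \<Sum>\<^sub>\<infinity>k. c k * (f x * ek k x)) (finite_subsets_at_top UNIV)"
  proof (rule Weierstrass_m_test_general)
    show "norm (c k * (f x * ek k x)) \<le> norm (c k) * B" if "x \<in> {0..1}" for k x
      using B[OF that] by (simp add: norm_mult mult_left_mono)
    show "(\<lambda>k. norm (c k) * B) summable_on UNIV"
      using c by (rule summable_on_cmult_left)
  qed
  obtain I J where I: "\<And>X. ((\<lambda>x. \<Sum>k\<in>X. c k * (f x * ek k x)) has_integral I X) {0..1}"
    and J: "((\<lambda>x. \<Sum>\<^sub>\<infinity>k. c k * (f x * ek k x)) has_integral J) {0..1}"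
    and lim: "(I \<longlongrightarrow> J) (finite_subsets_at_top UNIV)"
    by (rule uniform_limit_integral[OF ul]) (auto intro!: continuous_intros f)
  have fi: "(\<lambda>x. f x * ek k x) integrable_on {0..1}" for k
    by (intro integrable_continuous_real continuous_intros f)
  have I': "I X = (\<Sum>k\<in>X. c k * integral {0..1} (\<lambda>x. f x * ek k x))" for X
  proof (cases "finite X")
    case True
    have "integral {0..1} (\<lambda>x. \<Sum>k\<in>X. c k * (f x * ek k x)) = (\<Sum>k\<in>X. integral {0..1} (\<lambda>x. c k * (f x * ek k x)))"
      by (rule integral_sum[OF True]) (intro integrable_continuous_real continuous_intros f)
    then show ?thesis
      using integral_unique[OF I, of X] by simp
  next
    \<comment> \<open>A sum over an infinite set is 0 by convention, on both sides; the case arises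
      because \<open>I\<close> is a function on all index sets.\<close>
    case False
    then show ?thesis using integral_unique[OF I, of X] by simp
  qed
  have s: "(\<lambda>k. c k * ek k x) summable_on UNIV" for x
    by (rule abs_summable_summable) (use c in \<open>simp add: norm_mult\<close>)
  have "(\<Sum>\<^sub>\<infinity>k. c k * (f x * ek k x)) = f x * (\<Sum>\<^sub>\<infinity>k. c k * ek k x)" for x
  proof -
    have "(\<lambda>k. c k * (f x * ek k x)) = (\<lambda>k. f x * (c k * ek k x))" by (auto simp: algebra_simps)
    then show ?thesis using infsum_cmult_right[OF s] by simp
  qed
  then have "J = integral {0..1} (\<lambda>x. f x * (\<Sum>\<^sub>\<infinity>k. c k * ek k x))"
    using integral_unique[OF J] by simp
  moreover have "I = sum (\<lambda>k. c k * integral {0..1} (\<lambda>x. f x * ek k x))" using I' by auto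
  ultimately show ?thesis
    using lim unfolding has_sum_def by simp
qed

lemma continuous_on_fourier_series:
  fixes c :: "int \<Rightarrow> complex"
  assumes c: "(\<lambda>k. norm (c k)) summable_on UNIV"
  shows "continuous_on S (\<lambda>x. \<Sum>\<^sub>\<infinity>k. c k * ek k x)"
proof -
  have "uniform_limit S (\<lambda>X x. \<Sum>k\<in>X. c k * ek k x)
      (\<lambda>x. \<Sum>\<^sub>\<infinity>k. c k * ek k x) (finite_subsets_at_top UNIV)"
    by (rule Weierstrass_m_test_general[OF _ c]) (simp add: norm_mult)
  then show ?thesis
    by (rule uniform_limit_theorem[rotated]) (auto intro!: always_eventually continuous_intros)
qed

lemma cfc_fourier_series:
  fixes c :: "int \<Rightarrow> complex"
  assumes c: "(\<lambda>k. norm (c k)) summable_on UNIV"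
  shows "cfc (\<lambda>x. \<Sum>\<^sub>\<infinity>k. c k * ek k x) j = c j"
proof -
  have "((\<lambda>k. c k * integral {0..1} (\<lambda>x. ek (- j) x * ek k x)) has_sum
          integral {0..1} (\<lambda>x. ek (- j) x * (\<Sum>\<^sub>\<infinity>k. c k * ek k x))) UNIV"
    by (intro has_sum_integral_series c continuous_intros)
  moreover have "(\<lambda>k. c k * integral {0..1} (\<lambda>x. ek (- j) x * ek k x)) = (\<lambda>k. if k = j then c j else 0)"
    by (auto simp flip: ek_add simp: integral_ek)
  ultimately have "((\<lambda>k. if k = j then c j else 0) has_sum cfc (\<lambda>x. \<Sum>\<^sub>\<infinity>k. c k * ek k x) j) UNIV"
    by (simp add: cfc_def mult.commute)
  moreover have "((\<lambda>k. if k = j then c j else 0) has_sum c j) UNIV"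
    by (rule has_sum_finite_neutralI[of "{j}"]) auto
  ultimately show ?thesis by (rule has_sum_unique)
qed

text \<open>Quantifying over all \<open>v\<close> makes the property stable under products, so that it passes from the
  coordinate functions to all polynomials on the unit circle.\<close>

lemma cfc_zero_times_polynomial:
  fixes p :: "complex \<Rightarrow> real"
  assumes "real_polynomial_function p"
  shows "continuous_on UNIV (\<lambda>x. p (ek 1 x)) \<and>
    (\<forall>v. continuous_on UNIV v \<longrightarrow> (\<forall>k. cfc v k = 0) \<longrightarrow>
      (\<forall>k. cfc (\<lambda>x. v x * complex_of_real (p (ek 1 x))) k = 0))"
  using assms
proof (induction rule: real_polynomial_function.induct)
  case (linear f)
  interpret f: bounded_linear f by fact
  \<comment> \<open>A real-linear functional on the complex plane has the form a z + b cnj z with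
    these coefficients. On the circle cnj z is the character of index -1, so multiplication by
    \<open>f\<close> merely shifts indices by one in either direction.\<close>
  define a b :: complex where "a = (f 1 - \<i> * f \<i>) / 2" and "b = (f 1 + \<i> * f \<i>) / 2"
  have f_eq: "complex_of_real (f z) = a * z + b * cnj z" for z
  proof -
    have "f z = f (Re z *\<^sub>R 1 + Im z *\<^sub>R \<i>)"
      by (rule arg_cong[where f = f]) (simp add: complex_eq_iff)
    also have "\<dots> = Re z * f 1 + Im z * f \<i>"
      by (simp add: f.add f.scaleR)
    finally show ?thesis
      by (simp add: complex_eq_iff a_def b_def field_simps)
  qed
  have cont: "continuous_on UNIV (\<lambda>x. f (ek 1 x))"
    by (intro f.continuous_on continuous_intros)
  moreover have "cfc (\<lambda>x. v x * complex_of_real (f (ek 1 x))) k = 0"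
    if v: "continuous_on UNIV v" "\<forall>k. cfc v k = 0" for v k
  proof -
    note vc = continuous_on_subset[OF v(1) subset_UNIV]
    have "(\<lambda>x. v x * complex_of_real (f (ek 1 x)) * ek (- k) x) =
        (\<lambda>x. a * (v x * ek (- (k - 1)) x) + b * (v x * ek (- (k + 1)) x))"
    proof
      fix x
      have "ek (- (k - 1)) x = ek 1 x * ek (- k) x" "ek (- (k + 1)) x = ek (- 1) x * ek (- k) x"
        by (simp_all flip: ek_add add: algebra_simps)
      then show "v x * complex_of_real (f (ek 1 x)) * ek (- k) x =
          a * (v x * ek (- (k - 1)) x) + b * (v x * ek (- (k + 1)) x)"
        by (simp only: f_eq cnj_ek) (simp add: ring_distribs mult_ac)
    qed
    then have "cfc (\<lambda>x. v x * complex_of_real (f (ek 1 x))) k =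
       integral {0..1} (\<lambda>x. a * (v x * ek (- (k - 1)) x)) +
       integral {0..1} (\<lambda>x. b * (v x * ek (- (k + 1)) x))"
      unfolding cfc_def
      by (simp only:) (intro integral_add integrable_continuous_real continuous_intros vc)
    also have "\<dots> = a * cfc v (k - 1) + b * cfc v (k + 1)"
      by (simp only: cfc_def integral_mult_right)
    finally show ?thesis using v(2) by simp
  qed
  ultimately show ?case by blast
next
  case (const c)
  have "(\<lambda>x. v x * complex_of_real c * ek (- k) x) = (\<lambda>x. complex_of_real c * (v x * ek (- k) x))" for v k
    by (auto simp: algebra_simps)
  then show ?case
    by (simp add: cfc_def)
next
  case (add f g)
  have c: "continuous_on UNIV (\<lambda>x. f (ek 1 x))" "continuous_on UNIV (\<lambda>x. g (ek 1 x))"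
    using add.IH by auto
  note c' = c[THEN continuous_on_subset[OF _ subset_UNIV]]
  have "cfc (\<lambda>x. v x * complex_of_real (f (ek 1 x) + g (ek 1 x))) k = 0"
    if v: "continuous_on UNIV v" "\<forall>k. cfc v k = 0" for v k
  proof -
    note vc = continuous_on_subset[OF v(1) subset_UNIV]
    have "cfc (\<lambda>x. v x * complex_of_real (f (ek 1 x) + g (ek 1 x))) k =
       integral {0..1} (\<lambda>x. v x * complex_of_real (f (ek 1 x)) * ek (- k) x + v x * complex_of_real (g (ek 1 x)) * ek (- k) x)"
      unfolding cfc_def by (simp add: algebra_simps)
    also have "\<dots> = cfc (\<lambda>x. v x * complex_of_real (f (ek 1 x))) k + cfc (\<lambda>x. v x * complex_of_real (g (ek 1 x))) k"
      unfolding cfc_def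
      by (intro integral_add integrable_continuous_real continuous_intros vc c')
    finally show ?thesis using v add.IH by simp
  qed
  moreover have "continuous_on UNIV (\<lambda>x. f (ek 1 x) + g (ek 1 x))"
    by (intro continuous_intros c)
  ultimately show ?case by blast
next
  case (mult f g)
  have c: "continuous_on UNIV (\<lambda>x. f (ek 1 x))" "continuous_on UNIV (\<lambda>x. g (ek 1 x))"
    using mult.IH by auto
  have "cfc (\<lambda>x. v x * complex_of_real (f (ek 1 x) * g (ek 1 x))) k = 0"
    if v: "continuous_on UNIV v" "\<forall>k. cfc v k = 0" for v k
  proof -
    have "continuous_on UNIV (\<lambda>x. v x * complex_of_real (f (ek 1 x)))"
      by (intro continuous_intros v c)
    then have "cfc (\<lambda>x. (v x * complex_of_real (f (ek 1 x))) * complex_of_real (g (ek 1 x))) k = 0"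
      using mult.IH v by blast
    then show ?thesis by (simp add: mult.assoc)
  qed
  moreover have "continuous_on UNIV (\<lambda>x. f (ek 1 x) * g (ek 1 x))"
    by (intro continuous_intros c)
  ultimately show ?case by blast
qed

section \<open>Trigonometric approximation and uniqueness of Fourier coefficients\<close>

lemma periodic1_add_of_nat: "periodic1 u \<Longrightarrow> u (x + of_nat n) = u x"
proof (induction n)
  case (Suc n)
  then show ?case
    unfolding periodic1_def by (metis add.assoc add.commute of_nat_Suc)
qed simp

lemma periodic1_add_of_int: "periodic1 u \<Longrightarrow> u (x + of_int n) = u x"
proof (cases n rule: int_cases2)
  case (nonpos m)
  assume "periodic1 u"
  from periodic1_add_of_nat[OF this, of "x + of_int n" m] show ?thesis
    using nonpos by simp
qed (simp add: periodic1_add_of_nat)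

lemma periodic1_frac: "periodic1 u \<Longrightarrow> u (frac x) = u x"
  using periodic1_add_of_int[of u "frac x" "\<lfloor>x\<rfloor>"] by (simp add: frac_def)

lemma ek1_inj: "ek 1 x = ek 1 y \<Longrightarrow> \<exists>n. x = y + of_int n"
proof -
  assume "ek 1 x = ek 1 y"
  then have "exp (\<i> * of_real (2 * pi * x)) = exp (\<i> * of_real (2 * pi * y))"
    by (simp add: ek_def cis_conv_exp)
  then obtain n where "\<i> * of_real (2 * pi * x) = \<i> * of_real (2 * pi * y) + (of_int (2 * n) * pi) * \<i>"
    unfolding exp_eq by blast
  then have "2 * pi * x = 2 * pi * y + 2 * n * pi"
    by (simp add: complex_eq_iff)
  then have "pi * (2 * x) = pi * (2 * (y + n))"
    by (simp add: algebra_simps)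
  then have "x = y + n" by simp
  then show ?thesis by blast
qed

text \<open>A periodic function descends to a function \<open>U\<close> on the unit circle, where
  Stone-Weierstrass applies. Continuity of \<open>U\<close> is obtained without local branches of
  the logarithm: its graph is the continuous image of [0,1], hence compact, and a closed graph with
  compact range forces continuity.\<close>

lemma periodic_trig_approx:
  assumes u: "continuous_on UNIV u" "periodic1 u" and "e > 0"
  obtains p :: "complex \<Rightarrow> real" where "real_polynomial_function p" "\<And>x. \<bar>u x - p (ek 1 x)\<bar> < e"
proof -
  let ?S = "ek 1 ` {0..1}"
  have u01: "continuous_on {0..1} u" using u(1) continuous_on_subset by blast
  define U where "U z = u (SOME x. ek 1 x = z)" for z
  have U: "U (ek 1 x) = u x" for x
  proof -
    have "ek 1 (SOME y. ek 1 y = ek 1 x) = ek 1 x" by (rule someI) (rule refl)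
    then obtain n where "(SOME y. ek 1 y = ek 1 x) = x + of_int n" using ek1_inj by blast
    then show ?thesis using periodic1_add_of_int[OF u(2)] by (simp add: U_def)
  qed
  have "continuous_on ?S U"
  proof (rule continuous_from_closed_graph)
    show "compact (u ` {0..1})" by (intro compact_continuous_image u01 compact_Icc)
    show "U \<in> ?S \<rightarrow> u ` {0..1}" using U by auto
    have "(\<lambda>z. (z, U z)) ` ?S = (\<lambda>x. (ek 1 x, u x)) ` {0..1}"
      using U by (force simp: image_image)
    moreover have "compact ((\<lambda>x. (ek 1 x, u x)) ` {0..1})"
      by (intro compact_continuous_image continuous_intros u01 compact_Icc)
    ultimately show "closed ((\<lambda>z. (z, U z)) ` ?S)"
      by (simp add: compact_imp_closed)
  qed
  moreover have "compact ?S" by (intro compact_continuous_image continuous_intros compact_Icc)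
  ultimately obtain p where p: "real_polynomial_function p" "\<And>z. z \<in> ?S \<Longrightarrow> \<bar>U z - p z\<bar> < e"
    using Stone_Weierstrass_real_polynomial_function[OF _ _ \<open>e > 0\<close>] by metis
  show ?thesis
  proof
    fix x
    have "ek 1 x = ek 1 (frac x)"
      using periodic1_frac[of "Re \<circ> ek 1"] periodic1_frac[of "Im \<circ> ek 1"]
      by (simp add: periodic1_def complex_eq_iff)
    moreover have "frac x \<in> {0..1}" by (simp add: frac_lt_1 less_imp_le)
    ultimately have "ek 1 x \<in> ?S" by auto
    then show "\<bar>u x - p (ek 1 x)\<bar> < e" using p(2)[of "ek 1 x"] U by simp
  qed (rule p)
qed

text \<open>If all coefficients vanish, \<open>u\<close> is orthogonal to every trigonometric
  polynomial p, so the integral of u^2 equals that of u (u - p) and is as small as desired.\<close>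

lemma fcoeff_zero_imp_zero:
  assumes u: "continuous_on UNIV u" "periodic1 u" and 0: "\<And>k. fcoeff u k = 0"
  shows "u x = 0"
proof -
  note uc = continuous_on_subset[OF u(1) subset_UNIV]
  have "integral {0..1} (\<lambda>x. (u x)\<^sup>2) \<le> e" if "e > 0" for e
  proof -
    let ?M = "integral {0..1} (\<lambda>x. \<bar>u x\<bar>)"
    have M: "?M \<ge> 0" by (intro integral_nonneg integrable_continuous_real continuous_intros uc) auto
    \<comment> \<open>Chosen so that \<open>d\<close> times the L^1 norm is at most
      \<open>e\<close>; the added 1 keeps the denominator positive.\<close>
    define d where "d = e / (?M + 1)"
    have d: "d > 0" using \<open>e > 0\<close> M by (simp add: d_def)
    obtain p where p: "real_polynomial_function p" "\<And>x. \<bar>u x - p (ek 1 x)\<bar> < d"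
      using periodic_trig_approx[OF u d] by metis
    have pc: "continuous_on S (\<lambda>x. p (ek 1 x))" for S
      using cfc_zero_times_polynomial[OF p(1)] continuous_on_subset by blast
    \<comment> \<open>The coefficient of index 0 of the product is the integral of u p.\<close>
    have "cfc (\<lambda>x. of_real (u x) * complex_of_real (p (ek 1 x))) 0 = 0"
    proof -
      have "continuous_on UNIV (\<lambda>x. complex_of_real (u x))" by (intro continuous_intros u)
      moreover have "\<forall>k. cfc (\<lambda>x. complex_of_real (u x)) k = 0" using 0 by (simp flip: fcoeff_eq_cfc)
      ultimately show ?thesis using cfc_zero_times_polynomial[OF p(1)] by blast
    qed
    then have *: "integral {0..1} (\<lambda>x. complex_of_real (u x * p (ek 1 x))) = 0"
      by (simp add: cfc_def)
    have "((\<lambda>x. u x * p (ek 1 x)) has_integral integral {0..1} (\<lambda>x. u x * p (ek 1 x))) {0..1}"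
      by (intro integrable_integral integrable_continuous_real continuous_intros uc pc)
    then have "((\<lambda>x. complex_of_real (u x * p (ek 1 x))) has_integral
        complex_of_real (integral {0..1} (\<lambda>x. u x * p (ek 1 x)))) {0..1}"
      by (rule has_integral_of_real)
    from integral_unique[OF this] * have up: "integral {0..1} (\<lambda>x. u x * p (ek 1 x)) = 0"
      by simp
    have "integral {0..1} (\<lambda>x. (u x)\<^sup>2) = integral {0..1} (\<lambda>x. u x * (u x - p (ek 1 x)) + u x * p (ek 1 x))"
      by (simp add: power2_eq_square algebra_simps)
    also have "\<dots> = integral {0..1} (\<lambda>x. u x * (u x - p (ek 1 x))) + integral {0..1} (\<lambda>x. u x * p (ek 1 x))"
      by (intro integral_add integrable_continuous_real continuous_intros uc pc)
    also have "\<dots> = integral {0..1} (\<lambda>x. u x * (u x - p (ek 1 x)))"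
      using up by simp
    also have "\<dots> \<le> integral {0..1} (\<lambda>x. \<bar>u x\<bar> * d)"
    proof (rule integral_le)
      fix x :: real
      have "u x * (u x - p (ek 1 x)) \<le> \<bar>u x\<bar> * \<bar>u x - p (ek 1 x)\<bar>"
        by (metis abs_ge_self abs_mult)
      also have "\<dots> \<le> \<bar>u x\<bar> * d" using p(2)[of x] by (intro mult_left_mono) auto
      finally show "u x * (u x - p (ek 1 x)) \<le> \<bar>u x\<bar> * d" .
    qed (intro integrable_continuous_real continuous_intros uc pc)+
    also have "\<dots> = ?M * d" by simp
    also have "\<dots> \<le> e" using M \<open>e > 0\<close> by (simp add: d_def field_simps)
    finally show ?thesis .
  qed
  then have "integral {0..1} (\<lambda>x. (u x)\<^sup>2) \<le> 0"
    using field_le_epsilon[of "integral {0..1} (\<lambda>x. (u x)\<^sup>2)" 0] by simp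
  moreover have "integral {0..1} (\<lambda>x. (u x)\<^sup>2) \<ge> 0"
    by (intro integral_nonneg integrable_continuous_real continuous_intros uc) auto
  ultimately have "integral {0..1} (\<lambda>x. (u x)\<^sup>2) = 0" by simp
  moreover have "(\<lambda>x. (u x)\<^sup>2) integrable_on {0..1}"
    by (intro integrable_continuous_real continuous_intros uc)
  ultimately have "((\<lambda>x. (u x)\<^sup>2) has_integral 0) (cbox 0 1)"
    using integrable_integral[of "\<lambda>x. (u x)\<^sup>2" "{0..1}"] by simp
  moreover have "continuous_on (cbox 0 1) (\<lambda>x. (u x)\<^sup>2)" by (intro continuous_intros uc)
  moreover have "box 0 (1::real) \<noteq> {}" "frac x \<in> cbox 0 1"
    by (simp_all add: frac_lt_1 less_imp_le)
  ultimately have "(u (frac x))\<^sup>2 = 0"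
    using has_integral_0_cbox_imp_0[of 0 1 "\<lambda>x. (u x)\<^sup>2" "frac x"] by simp
  then show ?thesis using periodic1_frac[OF u(2)] by simp
qed

subsection \<open>Nonnegative infinite sums\<close>

lemma nonneg_sums_bounded:
  fixes f :: "'a \<Rightarrow> real"
  assumes "\<And>x. f x \<ge> 0" and B: "\<And>F. finite F \<Longrightarrow> sum f F \<le> B"
  shows "f summable_on UNIV" "infsum f UNIV \<le> B"
proof -
  show s: "f summable_on UNIV"
    by (rule nonneg_bdd_above_summable_on) (use assms in \<open>auto intro!: bdd_aboveI[of _ B]\<close>)
  show "infsum f UNIV \<le> B"
    by (rule infsum_le_finite_sums[OF s]) (use B in auto)
qed

lemma sum_le_infsum:
  fixes f :: "'a \<Rightarrow> real"
  assumes "f summable_on UNIV" "finite F" "\<And>x. f x \<ge> 0"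
  shows "sum f F \<le> infsum f UNIV"
  by (rule finite_sum_le_infsum) (use assms in auto)

lemma infsum_Cauchy_Schwarz:
  fixes f g :: "'a \<Rightarrow> real"
  assumes f: "(\<lambda>x. (f x)\<^sup>2) summable_on UNIV" "\<And>x. f x \<ge> 0"
    and g: "(\<lambda>x. (g x)\<^sup>2) summable_on UNIV" "\<And>x. g x \<ge> 0"
  shows "(\<lambda>x. f x * g x) summable_on UNIV"
    "(\<Sum>\<^sub>\<infinity>x. f x * g x) \<le> sqrt (\<Sum>\<^sub>\<infinity>x. (f x)\<^sup>2) * sqrt (\<Sum>\<^sub>\<infinity>x. (g x)\<^sup>2)"
proof -
  have le: "(\<Sum>x\<in>F. f x * g x) \<le> sqrt (\<Sum>\<^sub>\<infinity>x. (f x)\<^sup>2) * sqrt (\<Sum>\<^sub>\<infinity>x. (g x)\<^sup>2)" if "finite F" for F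
  proof -
    have "(\<Sum>x\<in>F. f x * g x) = (\<Sum>x\<in>F. \<bar>f x\<bar> * \<bar>g x\<bar>)" using f g by simp
    also have "\<dots> \<le> L2_set f F * L2_set g F" by (rule L2_set_mult_ineq)
    also have "\<dots> \<le> sqrt (\<Sum>\<^sub>\<infinity>x. (f x)\<^sup>2) * sqrt (\<Sum>\<^sub>\<infinity>x. (g x)\<^sup>2)"
      unfolding L2_set_def
      by (intro mult_mono real_sqrt_le_mono sum_le_infsum f g that) (auto intro!: sum_nonneg infsum_nonneg)
    finally show ?thesis .
  qed
  show "(\<lambda>x. f x * g x) summable_on UNIV"
    by (rule nonneg_sums_bounded(1)) (use le f g in auto)
  show "(\<Sum>\<^sub>\<infinity>x. f x * g x) \<le> sqrt (\<Sum>\<^sub>\<infinity>x. (f x)\<^sup>2) * sqrt (\<Sum>\<^sub>\<infinity>x. (g x)\<^sup>2)"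
    by (rule nonneg_sums_bounded(2)) (use le f g in auto)
qed

lemma has_sum_finite_sum:
  fixes f :: "'a \<Rightarrow> 'b \<Rightarrow> real"
  assumes "finite K" "\<And>k. k \<in> K \<Longrightarrow> (f k has_sum S k) A"
  shows "((\<lambda>j. \<Sum>k\<in>K. f k j) has_sum (\<Sum>k\<in>K. S k)) A"
  using assms
proof (induction K)
  case (insert k K)
  then have "((\<lambda>j. f k j + (\<Sum>k\<in>K. f k j)) has_sum (S k + (\<Sum>k\<in>K. S k))) A"
    by (intro has_sum_add) auto
  then show ?case using insert.hyps by simp
qed simp

lemma summable_on_shift_reflect:
  fixes g :: "int \<Rightarrow> real"
  shows "(\<lambda>j. g (k - j)) summable_on UNIV \<longleftrightarrow> g summable_on UNIV"
    "(\<Sum>\<^sub>\<infinity>j. g (k - j)) = (\<Sum>\<^sub>\<infinity>j. g j)"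
proof -
  have "bij (\<lambda>j. k - j)" by (rule bij_betw_byWitness[where f' = "\<lambda>j. k - j"]) auto
  then show "(\<lambda>j. g (k - j)) summable_on UNIV \<longleftrightarrow> g summable_on UNIV"
    "(\<Sum>\<^sub>\<infinity>j. g (k - j)) = (\<Sum>\<^sub>\<infinity>j. g j)"
    using summable_on_reindex_bij_betw[of "\<lambda>j. k - j" UNIV UNIV g]
      infsum_reindex_bij_betw[of "\<lambda>j. k - j" UNIV UNIV g] by simp_all
qed

text \<open>Young's inequality for l^2 * l^1. Cauchy-Schwarz is applied to (A sqrt B) times sqrt B,
  and the sum over \<open>k\<close> is then taken first, where each shifted copy of \<open>B\<close>
  contributes at most its l^1 norm. Finite \<open>K\<close> suffices, since H^s membership is tested
  on finite partial sums.\<close>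

lemma convolution_l2_l1:
  fixes A B :: "int \<Rightarrow> real"
  assumes A: "(\<lambda>j. (A j)\<^sup>2) summable_on UNIV" "\<And>j. A j \<ge> 0"
    and B: "B summable_on UNIV" "\<And>j. B j \<ge> 0"
  shows "(\<lambda>j. A j * B (k - j)) summable_on UNIV"
    "finite K \<Longrightarrow> (\<Sum>k\<in>K. (\<Sum>\<^sub>\<infinity>j. A j * B (k - j))\<^sup>2) \<le> (\<Sum>\<^sub>\<infinity>j. B j)\<^sup>2 * (\<Sum>\<^sub>\<infinity>j. (A j)\<^sup>2)"
proof -
  let ?b = "\<Sum>\<^sub>\<infinity>j. B j"
  have b0: "?b \<ge> 0" using B by (intro infsum_nonneg) auto
  have Bk: "(\<lambda>j. B (k - j)) summable_on UNIV" "(\<Sum>\<^sub>\<infinity>j. B (k - j)) = ?b" for k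
    using B summable_on_shift_reflect[of B k] by auto
  have B_le: "B j \<le> ?b" for j
    using sum_le_infsum[OF B(1), of "{j}"] B(2) by simp
  have AB: "(\<lambda>j. (A j)\<^sup>2 * B (k - j)) summable_on UNIV" for k
  proof (rule summable_on_comparison_test)
    show "(\<lambda>j. (A j)\<^sup>2 * ?b) summable_on UNIV" by (rule summable_on_cmult_left[OF A(1)])
  qed (use B B_le in \<open>auto intro: mult_left_mono\<close>)
  have sq: "(sqrt (B i))\<^sup>2 = B i" "(A j * sqrt (B i))\<^sup>2 = (A j)\<^sup>2 * B i" "A j * sqrt (B i) * sqrt (B i) = A j * B i" for i j
    using B(2)[of i] by (simp_all add: power_mult_distrib mult.assoc)
  have CS: "(\<lambda>j. A j * B (k - j)) summable_on UNIV"
      "(\<Sum>\<^sub>\<infinity>j. A j * B (k - j)) \<le> sqrt (\<Sum>\<^sub>\<infinity>j. (A j)\<^sup>2 * B (k - j)) * sqrt ?b" for k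
    using infsum_Cauchy_Schwarz[of "\<lambda>j. A j * sqrt (B (k - j))" "\<lambda>j. sqrt (B (k - j))"] AB[of k] Bk[of k] A(2) B(2)
    unfolding sq by auto
  show "(\<lambda>j. A j * B (k - j)) summable_on UNIV" by (rule CS)
  assume K: "finite K"
  have "(\<Sum>k\<in>K. (\<Sum>\<^sub>\<infinity>j. A j * B (k - j))\<^sup>2) \<le> (\<Sum>k\<in>K. (\<Sum>\<^sub>\<infinity>j. (A j)\<^sup>2 * B (k - j)) * ?b)"
  proof (rule sum_mono)
    fix k
    have "(\<Sum>\<^sub>\<infinity>j. A j * B (k - j))\<^sup>2 \<le> (sqrt (\<Sum>\<^sub>\<infinity>j. (A j)\<^sup>2 * B (k - j)) * sqrt ?b)\<^sup>2"
      using A B by (intro power_mono CS infsum_nonneg) auto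
    also have "\<dots> = (\<Sum>\<^sub>\<infinity>j. (A j)\<^sup>2 * B (k - j)) * ?b"
      using b0 B by (simp add: power_mult_distrib infsum_nonneg)
    finally show "(\<Sum>\<^sub>\<infinity>j. A j * B (k - j))\<^sup>2 \<le> (\<Sum>\<^sub>\<infinity>j. (A j)\<^sup>2 * B (k - j)) * ?b" .
  qed
  also have "\<dots> = (\<Sum>k\<in>K. (\<Sum>\<^sub>\<infinity>j. (A j)\<^sup>2 * B (k - j))) * ?b" by (simp add: sum_distrib_right)
  also have "\<dots> \<le> ((\<Sum>\<^sub>\<infinity>j. (A j)\<^sup>2) * ?b) * ?b"
  proof (rule mult_right_mono[OF _ b0])
    have "((\<lambda>j. \<Sum>k\<in>K. (A j)\<^sup>2 * B (k - j)) has_sum (\<Sum>k\<in>K. (\<Sum>\<^sub>\<infinity>j. (A j)\<^sup>2 * B (k - j)))) UNIV"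
      by (intro has_sum_finite_sum K has_sum_infsum AB)
    moreover have "((\<lambda>j. (A j)\<^sup>2 * ?b) has_sum ((\<Sum>\<^sub>\<infinity>j. (A j)\<^sup>2) * ?b)) UNIV"
      by (intro has_sum_cmult_left has_sum_infsum A)
    moreover have "(\<Sum>k\<in>K. (A j)\<^sup>2 * B (k - j)) \<le> (A j)\<^sup>2 * ?b" for j
    proof -
      have "(\<Sum>k\<in>K. B (k - j)) = (\<Sum>i\<in>(\<lambda>k. k - j) ` K. B i)"
        by (simp add: sum.reindex inj_on_def)
      also have "\<dots> \<le> ?b" using K B by (intro sum_le_infsum) auto
      finally show ?thesis by (simp add: mult_left_mono flip: sum_distrib_left)
    qed
    ultimately show "(\<Sum>k\<in>K. (\<Sum>\<^sub>\<infinity>j. (A j)\<^sup>2 * B (k - j))) \<le> (\<Sum>\<^sub>\<infinity>j. (A j)\<^sup>2) * ?b"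
      by (rule has_sum_mono)
  qed
  finally show "(\<Sum>k\<in>K. (\<Sum>\<^sub>\<infinity>j. A j * B (k - j))\<^sup>2) \<le> ?b\<^sup>2 * (\<Sum>\<^sub>\<infinity>j. (A j)\<^sup>2)"
    by (simp add: power2_eq_square mult_ac)
qed

subsection \<open>Fourier coefficients of continuous periodic functions\<close>

definition cper :: "(real \<Rightarrow> real) \<Rightarrow> bool" where
  "cper u \<longleftrightarrow> continuous_on UNIV u \<and> periodic1 u"

lemma cper_cont: "cper u \<Longrightarrow> continuous_on S u"
  unfolding cper_def using continuous_on_subset by blast

lemma cper_periodic: "cper u \<Longrightarrow> u (x + 1) = u x"
  by (simp add: cper_def periodic1_def)

lemma cper_const: "cper (\<lambda>x. c)" by (simp add: cper_def periodic1_def)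
lemma cper_add: "cper u \<Longrightarrow> cper v \<Longrightarrow> cper (\<lambda>x. u x + v x)"
  by (auto simp: cper_def periodic1_def intro: continuous_intros)
lemma cper_diff: "cper u \<Longrightarrow> cper v \<Longrightarrow> cper (\<lambda>x. u x - v x)"
  by (auto simp: cper_def periodic1_def intro: continuous_intros)
lemma cper_mult: "cper u \<Longrightarrow> cper v \<Longrightarrow> cper (\<lambda>x. u x * v x)"
  by (auto simp: cper_def periodic1_def intro: continuous_intros)

lemma cper_integrable: "cper u \<Longrightarrow> u integrable_on {a..b}"
  by (intro integrable_continuous_real cper_cont)

lemma fcoeff_integrable: "cper u \<Longrightarrow> (\<lambda>x. complex_of_real (u x) * ek k x) integrable_on {a..b}"
  by (intro integrable_continuous_real continuous_intros cper_cont)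

lemma fcoeff_add: "cper u \<Longrightarrow> cper v \<Longrightarrow> fcoeff (\<lambda>x. u x + v x) k = fcoeff u k + fcoeff v k"
  unfolding fcoeff_eq_cfc cfc_def
  by (subst integral_add[symmetric]) (auto intro!: fcoeff_integrable simp: algebra_simps)

lemma fcoeff_diff: "cper u \<Longrightarrow> cper v \<Longrightarrow> fcoeff (\<lambda>x. u x - v x) k = fcoeff u k - fcoeff v k"
  unfolding fcoeff_eq_cfc cfc_def
  by (subst integral_diff[symmetric]) (auto intro!: fcoeff_integrable simp: algebra_simps)

lemma fcoeff_cmult: "fcoeff (\<lambda>x. a * u x) k = of_real a * fcoeff u k"
  unfolding fcoeff_eq_cfc cfc_def by (simp add: mult.assoc)

lemma fcoeff_minus_index: "fcoeff u (- k) = cnj (fcoeff u k)"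
  unfolding fcoeff_eq_cfc cfc_def integral_cnj by (simp add: cnj_ek)

lemma integral_of_real:
  assumes "u integrable_on {a..b}"
  shows "integral {a..b} (\<lambda>x. complex_of_real (u x)) = complex_of_real (integral {a..b} u)"
  by (rule integral_unique[OF has_integral_of_real[OF integrable_integral[OF assms]]])

lemma fcoeff_0_index: "cper u \<Longrightarrow> fcoeff u 0 = of_real (integral {0..1} u)"
  by (simp add: fcoeff_eq_cfc cfc_def integral_of_real cper_integrable)

lemma cper_eqI: "cper u \<Longrightarrow> cper v \<Longrightarrow> (\<And>k. fcoeff u k = fcoeff v k) \<Longrightarrow> u = v"
proof
  fix x assume uv: "cper u" "cper v" "\<And>k. fcoeff u k = fcoeff v k"
  have "(\<lambda>x. u x - v x) x = 0"
    using cper_diff[OF uv(1,2)] uv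
    by (intro fcoeff_zero_imp_zero) (auto simp: cper_def fcoeff_diff)
  then show "u x = v x" by simp
qed

section \<open>Functions rebuilt from their coefficients, products, Parseval and Bessel\<close>

definition fseries :: "(int \<Rightarrow> complex) \<Rightarrow> real \<Rightarrow> real" where
  "fseries c x = Re (\<Sum>\<^sub>\<infinity>k. c k * ek k x)"

text \<open>Reindexing by k -> -k shows that the sum of a Hermitian series equals its own conjugate,
  so the real part taken in \<open>fseries\<close> loses nothing.\<close>

lemma of_real_fseries:
  assumes c: "(\<lambda>k. norm (c k)) summable_on UNIV" and herm: "\<And>k. c (- k) = cnj (c k)"
  shows "complex_of_real (fseries c x) = (\<Sum>\<^sub>\<infinity>k. c k * ek k x)"
proof -
  have "cnj (\<Sum>\<^sub>\<infinity>k. c k * ek k x) = (\<Sum>\<^sub>\<infinity>k. cnj (c k * ek k x))"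
    by (rule infsum_cnj[symmetric])
  also have "\<dots> = (\<Sum>\<^sub>\<infinity>k. c k * ek k x)"
    by (rule infsum_reindex_bij_witness[where i = uminus and j = uminus]) (auto simp: herm cnj_ek)
  finally have "Im (\<Sum>\<^sub>\<infinity>k. c k * ek k x) = 0" by (simp add: complex_eq_iff)
  then show ?thesis by (simp add: fseries_def complex_eq_iff)
qed

lemma cper_fseries:
  assumes c: "(\<lambda>k. norm (c k)) summable_on UNIV"
  shows "cper (fseries c)"
  unfolding cper_def periodic1_def
  using continuous_on_fourier_series[OF c] by (auto simp: fseries_def[abs_def] intro!: continuous_intros)

lemma fcoeff_fseries:
  assumes c: "(\<lambda>k. norm (c k)) summable_on UNIV" and herm: "\<And>k. c (- k) = cnj (c k)"
  shows "fcoeff (fseries c) k = c k"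
  unfolding fcoeff_eq_cfc of_real_fseries[OF assms] by (rule cfc_fourier_series[OF c])

lemma fourier_inversion:
  assumes u: "cper u" and c: "(\<lambda>k. norm (fcoeff u k)) summable_on UNIV"
  shows "fseries (fcoeff u) = u" "complex_of_real (u x) = (\<Sum>\<^sub>\<infinity>k. fcoeff u k * ek k x)"
proof -
  show *: "fseries (fcoeff u) = u"
    by (rule cper_eqI[OF cper_fseries[OF c] u]) (rule fcoeff_fseries[OF c fcoeff_minus_index])
  show "complex_of_real (u x) = (\<Sum>\<^sub>\<infinity>k. fcoeff u k * ek k x)"
    using of_real_fseries[OF c fcoeff_minus_index, of x] * by simp
qed

text \<open>Expand \<open>u\<close> inside the integral and integrate term by term against
  \<open>v\<close> times a character; each term is a coefficient of \<open>v\<close> at a shifted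
  index.\<close>

lemma fcoeff_mult_has_sum:
  assumes u: "cper u" and c: "(\<lambda>k. norm (fcoeff u k)) summable_on UNIV" and v: "cper v"
  shows "((\<lambda>j. fcoeff u j * fcoeff v (k - j)) has_sum fcoeff (\<lambda>x. u x * v x) k) UNIV"
proof -
  have "((\<lambda>j. fcoeff u j * integral {0..1} (\<lambda>x. (of_real (v x) * ek (- k) x) * ek j x)) has_sum
      integral {0..1} (\<lambda>x. (of_real (v x) * ek (- k) x) * (\<Sum>\<^sub>\<infinity>j. fcoeff u j * ek j x))) UNIV"
    by (rule has_sum_integral_series[OF c]) (intro continuous_intros cper_cont[OF v])
  moreover have "(\<lambda>x. (of_real (v x) * ek (- k) x) * ek j x) = (\<lambda>x. of_real (v x) * ek (- (k - j)) x)" for j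
    using ek_add[of "- k" j] by (auto simp: mult.assoc)
  ultimately show ?thesis
    unfolding fcoeff_eq_cfc[of v] fcoeff_eq_cfc[of "\<lambda>x. u x * v x"] cfc_def
    by (simp add: fourier_inversion(2)[OF u c, symmetric] mult_ac)
qed

text \<open>This is the product formula for u u at index 0, where the Hermitian symmetry turns the
  factors into squared moduli.\<close>

lemma parseval:
  assumes u: "cper u" and c: "(\<lambda>k. norm (fcoeff u k)) summable_on UNIV"
  shows "((\<lambda>k. (cmod (fcoeff u k))\<^sup>2) has_sum integral {0..1} (\<lambda>x. (u x)\<^sup>2)) UNIV"
proof -
  have "fcoeff (\<lambda>x. u x * u x) 0 = of_real (integral {0..1} (\<lambda>x. (u x)\<^sup>2))"
    by (simp add: fcoeff_0_index cper_mult u power2_eq_square)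
  moreover have "fcoeff u j * fcoeff u (0 - j) = of_real ((cmod (fcoeff u j))\<^sup>2)" for j
    by (simp only: diff_0 fcoeff_minus_index complex_norm_square)
  ultimately have "((\<lambda>k. complex_of_real ((cmod (fcoeff u k))\<^sup>2)) has_sum complex_of_real (integral {0..1} (\<lambda>x. (u x)\<^sup>2))) UNIV"
    using fcoeff_mult_has_sum[OF u c u, of 0] by simp
  from has_sum_Re[OF this] show ?thesis by simp
qed

text \<open>The partial sum \<open>p\<close> is the orthogonal projection of \<open>u\<close>, so
  the integral of |u - p|^2 is the difference of the two sides. It serves for compositions, whose
  coefficients are not yet known to be absolutely summable.\<close>

lemma bessel:
  assumes u: "cper u" and F: "finite F"
  shows "(\<Sum>k\<in>F. (cmod (fcoeff u k))\<^sup>2) \<le> integral {0..1} (\<lambda>x. (u x)\<^sup>2)"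
proof -
  define c where "c k = fcoeff u k" for k
  define p where "p x = (\<Sum>k\<in>F. c k * ek k x)" for x
  note uc = cper_cont[OF u]
  have pc: "continuous_on S p" for S unfolding p_def[abs_def] by (intro continuous_intros)
  have int: "continuous_on {0..1} f \<Longrightarrow> f integrable_on {0..1}" for f :: "real \<Rightarrow> complex"
    by (rule integrable_continuous_real)
  have pj: "integral {0..1} (\<lambda>x. p x * ek (- j) x) = (if j \<in> F then c j else 0)" for j
  proof -
    have "(\<lambda>x. p x * ek (- j) x) = (\<lambda>x. \<Sum>k\<in>F. c k * ek (k - j) x)"
      using ek_add[of _ "- j"] by (auto simp: p_def sum_distrib_right mult.assoc)
    then have "integral {0..1} (\<lambda>x. p x * ek (- j) x) = (\<Sum>k\<in>F. integral {0..1} (\<lambda>x. c k * ek (k - j) x))"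
      by (simp only:) (rule integral_sum[OF F], intro int continuous_intros)
    also have "\<dots> = (\<Sum>k\<in>F. if k = j then c j else 0)"
      by (intro sum.cong) (auto simp: integral_ek)
    also have "\<dots> = (if j \<in> F then c j else 0)" using F by (simp add: sum.delta)
    finally show ?thesis .
  qed
  let ?d = "\<lambda>x. of_real (u x) - p x"
  have dj: "integral {0..1} (\<lambda>x. ?d x * ek (- j) x) = 0" if "j \<in> F" for j
  proof -
    have "integral {0..1} (\<lambda>x. ?d x * ek (- j) x) = integral {0..1} (\<lambda>x. of_real (u x) * ek (- j) x) - integral {0..1} (\<lambda>x. p x * ek (- j) x)"
      unfolding left_diff_distrib by (intro integral_diff int continuous_intros uc pc)
    then show ?thesis using pj[of j] that by (simp add: c_def fcoeff_eq_cfc cfc_def)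
  qed
  have dp: "integral {0..1} (\<lambda>x. ?d x * cnj (p x)) = 0"
  proof -
    have "(\<lambda>x. ?d x * cnj (p x)) = (\<lambda>x. \<Sum>k\<in>F. cnj (c k) * (?d x * ek (- k) x))"
    proof
      fix x
      have "cnj (p x) = (\<Sum>k\<in>F. cnj (c k) * ek (- k) x)" by (simp add: p_def cnj_ek)
      then show "?d x * cnj (p x) = (\<Sum>k\<in>F. cnj (c k) * (?d x * ek (- k) x))"
        by (simp only: sum_distrib_left) (simp add: mult_ac)
    qed
    then have "integral {0..1} (\<lambda>x. ?d x * cnj (p x)) = (\<Sum>k\<in>F. integral {0..1} (\<lambda>x. cnj (c k) * (?d x * ek (- k) x)))"
      by (simp only:) (rule integral_sum[OF F], intro int continuous_intros uc pc)
    also have "\<dots> = 0" using dj by (intro sum.neutral) simp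
    finally show ?thesis .
  qed
  have pu: "integral {0..1} (\<lambda>x. p x * of_real (u x)) = of_real (\<Sum>k\<in>F. (cmod (c k))\<^sup>2)"
  proof -
    have "(\<lambda>x. p x * of_real (u x)) = (\<lambda>x. \<Sum>k\<in>F. c k * (of_real (u x) * ek (- (- k)) x))"
      unfolding p_def sum_distrib_right by (simp add: mult_ac)
    then have "integral {0..1} (\<lambda>x. p x * of_real (u x)) = (\<Sum>k\<in>F. integral {0..1} (\<lambda>x. c k * (of_real (u x) * ek (- (- k)) x)))"
      by (simp only:) (rule integral_sum[OF F], intro int continuous_intros uc pc)
    also have "\<dots> = (\<Sum>k\<in>F. c k * fcoeff u (- k))"
      by (simp add: fcoeff_eq_cfc cfc_def)
    also have "\<dots> = of_real (\<Sum>k\<in>F. (cmod (c k))\<^sup>2)"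
      by (simp only: c_def fcoeff_minus_index complex_norm_square of_real_sum)
    finally show ?thesis .
  qed
  have "complex_of_real (integral {0..1} (\<lambda>x. (cmod (?d x))\<^sup>2)) = integral {0..1} (\<lambda>x. complex_of_real ((cmod (?d x))\<^sup>2))"
    by (intro integral_of_real[symmetric] integrable_continuous_real continuous_intros uc pc)
  also have "(\<lambda>x. complex_of_real ((cmod (?d x))\<^sup>2)) = (\<lambda>x. (of_real ((u x)\<^sup>2) - p x * of_real (u x)) - ?d x * cnj (p x))"
    by (rule ext, simp only: complex_norm_square) (simp add: power2_eq_square algebra_simps)
  also have "integral {0..1} \<dots> = (integral {0..1} (\<lambda>x. of_real ((u x)\<^sup>2)) - integral {0..1} (\<lambda>x. p x * of_real (u x))) - integral {0..1} (\<lambda>x. ?d x * cnj (p x))"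
    by (subst integral_diff, (intro int continuous_intros uc pc)+)+ simp
  also have "\<dots> = complex_of_real (integral {0..1} (\<lambda>x. (u x)\<^sup>2) - (\<Sum>k\<in>F. (cmod (c k))\<^sup>2))"
    unfolding dp pu
    by (subst integral_of_real) (auto intro!: integrable_continuous_real continuous_intros uc)
  finally have "integral {0..1} (\<lambda>x. (cmod (?d x))\<^sup>2) = integral {0..1} (\<lambda>x. (u x)\<^sup>2) - (\<Sum>k\<in>F. (cmod (c k))\<^sup>2)"
    using of_real_eq_iff by blast
  moreover have "integral {0..1} (\<lambda>x. (cmod (?d x))\<^sup>2) \<ge> 0"
    by (intro integral_nonneg integrable_continuous_real continuous_intros uc pc) auto
  ultimately show ?thesis by (simp add: c_def)
qed

subsection \<open>Sobolev spaces on the circle\<close>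

definition lam :: "int \<Rightarrow> real" where "lam k = 1 + (real_of_int k)\<^sup>2"

lemma lam_ge_1: "lam k \<ge> 1" by (simp add: lam_def)
lemma lam_pos [simp]: "lam k > 0" using lam_ge_1[of k] by linarith
lemma lam_nonneg [simp]: "lam k \<ge> 0" using lam_pos[of k] by linarith
lemma lam_nonzero [simp]: "lam k \<noteq> 0" using lam_pos[of k] by linarith
lemma lam_minus [simp]: "lam (- k) = lam k" by (simp add: lam_def)

lemma powr_half_square: "x \<ge> 0 \<Longrightarrow> (x powr (s / 2))\<^sup>2 = x powr (s::real)"
  by (simp add: power2_eq_square flip: powr_add)

abbreviation wsq :: "real \<Rightarrow> (real \<Rightarrow> real) \<Rightarrow> int \<Rightarrow> real" where
  "wsq s u k \<equiv> lam k powr s * (cmod (fcoeff u k))\<^sup>2"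

lemma Hs_iff: "Hs s u \<longleftrightarrow> cper u \<and> wsq s u summable_on UNIV"
  by (auto simp: Hs_def cper_def lam_def)

lemma Hs_norm_eq: "Hs_norm s u = sqrt (\<Sum>\<^sub>\<infinity>k. wsq s u k)"
  by (simp add: Hs_norm_def lam_def)

lemma Hs_cper: "Hs s u \<Longrightarrow> cper u" by (simp add: Hs_iff)

lemma Hs_norm_nonneg [simp]: "Hs_norm s u \<ge> 0"
  by (simp add: Hs_norm_eq infsum_nonneg)

lemma Hs_norm_square: "(Hs_norm s u)\<^sup>2 = (\<Sum>\<^sub>\<infinity>k. wsq s u k)"
  by (simp add: Hs_norm_eq infsum_nonneg)

lemma HsI:
  assumes "cper u" and "M \<ge> 0"
    and "\<And>F. finite F \<Longrightarrow> (\<Sum>k\<in>F. wsq s u k) \<le> M\<^sup>2"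
  shows "Hs s u" "Hs_norm s u \<le> M"
proof -
  note * = nonneg_sums_bounded[of "\<lambda>k. wsq s u k" "M\<^sup>2"]
  show "Hs s u" using * assms by (simp add: Hs_iff)
  have "(Hs_norm s u)\<^sup>2 \<le> M\<^sup>2" using *(2) assms(3) by (simp add: Hs_norm_square)
  then show "Hs_norm s u \<le> M" using assms(2) by (rule power2_le_imp_le)
qed

lemma Hs_sum_le:
  assumes "Hs s u" "finite F"
  shows "(\<Sum>k\<in>F. wsq s u k) \<le> (Hs_norm s u)\<^sup>2"
  unfolding Hs_norm_square by (rule sum_le_infsum) (use assms in \<open>auto simp: Hs_iff\<close>)

lemma Hs_mono:
  assumes "Hs s u" "r \<le> s"
  shows "Hs r u" "Hs_norm r u \<le> Hs_norm s u"
proof -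
  have "(\<Sum>k\<in>F. wsq r u k) \<le> (Hs_norm s u)\<^sup>2" if "finite F" for F
  proof -
    have "(\<Sum>k\<in>F. wsq r u k) \<le> (\<Sum>k\<in>F. wsq s u k)"
      by (intro sum_mono mult_right_mono powr_mono assms lam_ge_1) auto
    also have "\<dots> \<le> (Hs_norm s u)\<^sup>2" by (rule Hs_sum_le[OF assms(1) that])
    finally show ?thesis .
  qed
  from HsI[OF Hs_cper[OF assms(1)] Hs_norm_nonneg this] show "Hs r u" "Hs_norm r u \<le> Hs_norm s u" by auto
qed

text \<open>Since \<open>lam k\<close> dominates k^2, the positive and the negative integers can
  each be compared with the series of n powr (-2 s), which converges exactly for s > 1/2.\<close>

lemma summable_lam:
  assumes "s > 1/2"
  shows "(\<lambda>k. lam k powr (- s)) summable_on UNIV"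
proof -
  have "summable (\<lambda>n. real n powr (- 2 * s))" using assms by (simp add: summable_real_powr_iff)
  then have "summable (\<lambda>n. real (Suc n) powr (- 2 * s))" 
    by (subst summable_Suc_iff[of "\<lambda>n. real n powr (- 2 * s)"])
  then have "summable (\<lambda>n. norm (real (Suc n) powr (- 2 * s)))" by simp
  then have nat: "(\<lambda>n. real (Suc n) powr (- 2 * s)) summable_on UNIV"
    by (rule norm_summable_imp_summable_on)
  have le: "lam k powr (- s) \<le> real (Suc n) powr (- 2 * s)" if "\<bar>k\<bar> = int (Suc n)" for k n
  proof -
    have "real (Suc n) = \<bar>real_of_int k\<bar>" using that by linarith
    then have "(real (Suc n))\<^sup>2 \<le> lam k" by (simp add: lam_def)
    then have "lam k powr (- s) \<le> ((real (Suc n))\<^sup>2) powr (- s)"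
      using assms by (intro powr_mono2') auto
    also have "(real (Suc n))\<^sup>2 = real (Suc n) powr 2" by simp
    finally show ?thesis by (simp only: powr_powr) simp
  qed
  have injp: "inj (\<lambda>n. int (Suc n))" by (rule injI) simp
  have pos: "(\<lambda>k. lam k powr (- s)) summable_on range (\<lambda>n. int (Suc n))"
    unfolding summable_on_reindex[OF injp] o_def
    by (rule summable_on_comparison_test[OF nat]) (rule le, simp_all)
  have inj: "inj (\<lambda>n. - int (Suc n))" by (rule injI) simp
  have neg: "(\<lambda>k. lam k powr (- s)) summable_on range (\<lambda>n. - int (Suc n))"
    unfolding summable_on_reindex[OF inj] o_def
    by (rule summable_on_comparison_test[OF nat]) (rule le, simp_all)
  have "UNIV = {0} \<union> (range (\<lambda>n. int (Suc n)) \<union> range (\<lambda>n. - int (Suc n)))"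
  proof (intro equalityI subsetI UnCI)
    fix k :: int assume "k \<notin> range (\<lambda>n. int (Suc n)) \<union> range (\<lambda>n. - int (Suc n))"
    then show "k \<in> {0}"
      by (cases k rule: int_cases3) (auto simp: image_iff dest: gr0_implies_Suc)
  qed auto
  moreover have "(\<lambda>k. lam k powr (- s)) summable_on ({0} \<union> (range (\<lambda>n. int (Suc n)) \<union> range (\<lambda>n. - int (Suc n))))"
    by (intro summable_on_union pos neg) auto
  ultimately show ?thesis by simp
qed

text \<open>The constant of the embedding of H^s into absolutely convergent Fourier series, and
  hence into the sup norm. Meaningful for s > 1/2 only: otherwise the sum diverges and
  \<open>infsum\<close> takes its default value 0.\<close>

definition sobolev_const :: "real \<Rightarrow> real" where
  "sobolev_const s = sqrt (\<Sum>\<^sub>\<infinity>k. lam k powr (- s))"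

lemma sobolev_const_nonneg: "sobolev_const s \<ge> 0"
  by (simp add: sobolev_const_def infsum_nonneg)

text \<open>Cauchy-Schwarz after writing each coefficient as \<open>lam k powr (- s / 2)\<close>
  times its weighted version.\<close>

lemma weighted_abs_summable:
  fixes c :: "int \<Rightarrow> complex"
  assumes "s > 1/2" "(\<lambda>k. lam k powr s * (cmod (c k))\<^sup>2) summable_on UNIV"
  shows "(\<lambda>k. norm (c k)) summable_on UNIV"
    "(\<Sum>\<^sub>\<infinity>k. norm (c k)) \<le> sobolev_const s * sqrt (\<Sum>\<^sub>\<infinity>k. lam k powr s * (cmod (c k))\<^sup>2)"
proof -
  let ?f = "\<lambda>k. lam k powr (- s / 2)" and ?g = "\<lambda>k. lam k powr (s / 2) * norm (c k)"
  have f2: "(?f k)\<^sup>2 = lam k powr (- s)" and g2: "(?g k)\<^sup>2 = lam k powr s * (cmod (c k))\<^sup>2" for k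
    using powr_half_square[of "lam k" "- s"] powr_half_square[of "lam k" s] less_imp_le[OF lam_pos[of k]]
    by (auto simp: power_mult_distrib)
  have fg: "?f k * ?g k = norm (c k)" for k
    using lam_pos[of k] by (simp add: mult.assoc[symmetric] flip: powr_add)
  have s: "(\<lambda>k. (?f k)\<^sup>2) summable_on UNIV" "(\<lambda>k. (?g k)\<^sup>2) summable_on UNIV"
    unfolding f2 g2 using summable_lam[OF assms(1)] assms(2) by auto
  have nn: "?f k \<ge> 0" "?g k \<ge> 0" for k by auto
  show "(\<lambda>k. norm (c k)) summable_on UNIV"
    "(\<Sum>\<^sub>\<infinity>k. norm (c k)) \<le> sobolev_const s * sqrt (\<Sum>\<^sub>\<infinity>k. lam k powr s * (cmod (c k))\<^sup>2)"
    using infsum_Cauchy_Schwarz[OF s(1) nn(1) s(2) nn(2)]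
    unfolding fg f2 g2 by (auto simp: sobolev_const_def)
qed

lemma Hs_abs_summable:
  assumes "s > 1/2" "Hs s u"
  shows "(\<lambda>k. norm (fcoeff u k)) summable_on UNIV"
    "(\<Sum>\<^sub>\<infinity>k. norm (fcoeff u k)) \<le> sobolev_const s * Hs_norm s u"
  using weighted_abs_summable[of s "fcoeff u"] assms by (auto simp: Hs_iff Hs_norm_eq)

text \<open>The Riesz-Fischer direction: weighted square summable Hermitian sequences are realised
  by functions. Derivatives, primitives and the pieces in the interpolation argument are all built
  this way.\<close>

lemma Hs_fseries:
  assumes "s > 1/2" "(\<lambda>k. lam k powr s * (cmod (c k))\<^sup>2) summable_on UNIV" "\<And>k. c (- k) = cnj (c k)"
  shows "Hs s (fseries c)" "fcoeff (fseries c) k = c k"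
proof -
  note c = weighted_abs_summable(1)[OF assms(1,2)]
  have f: "fcoeff (fseries c) k = c k" for k by (rule fcoeff_fseries[OF c assms(3)])
  then show "fcoeff (fseries c) k = c k" .
  show "Hs s (fseries c)" using cper_fseries[OF c] assms(2) f by (simp add: Hs_iff)
qed

lemma Hs_sup_bound:
  assumes "s > 1/2" "Hs s u"
  shows "\<bar>u x\<bar> \<le> sobolev_const s * Hs_norm s u"
proof -
  note su = Hs_abs_summable[OF assms]
  have "\<bar>u x\<bar> = norm (complex_of_real (u x))" by simp
  also have "\<dots> = norm (\<Sum>\<^sub>\<infinity>k. fcoeff u k * ek k x)"
    using fourier_inversion(2)[OF Hs_cper[OF assms(2)] su(1), of x] by simp
  also have "\<dots> \<le> (\<Sum>\<^sub>\<infinity>k. norm (fcoeff u k * ek k x))"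
    by (rule norm_infsum_bound) (use su(1) in \<open>simp add: norm_mult\<close>)
  also have "\<dots> \<le> sobolev_const s * Hs_norm s u" using su(2) by (simp add: norm_mult)
  finally show ?thesis .
qed

lemma Hs_cmult:
  assumes "Hs s u"
  shows "Hs s (\<lambda>x. a * u x)"
proof -
  have "(\<lambda>k. a\<^sup>2 * wsq s u k) summable_on UNIV"
    by (rule summable_on_cmult_right) (use assms in \<open>simp add: Hs_iff\<close>)
  moreover have "cper (\<lambda>x. a * u x)" by (intro cper_mult cper_const Hs_cper[OF assms])
  ultimately show ?thesis
    by (simp add: Hs_iff fcoeff_cmult norm_mult power_mult_distrib mult_ac)
qed

lemma Hs_add:
  assumes "Hs s u" "Hs s v"
  shows "Hs s (\<lambda>x. u x + v x)"
proof -
  have c: "cper u" "cper v" using assms by (auto simp: Hs_iff)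
  have "(\<lambda>k. 2 * wsq s u k + 2 * wsq s v k) summable_on UNIV"
    by (intro summable_on_add summable_on_cmult_right) (use assms in \<open>auto simp: Hs_iff\<close>)
  then have "(\<lambda>k. lam k powr s * (cmod (fcoeff u k + fcoeff v k))\<^sup>2) summable_on UNIV"
  proof (rule summable_on_comparison_test)
    fix k
    have "(cmod (fcoeff u k + fcoeff v k))\<^sup>2 \<le> (cmod (fcoeff u k) + cmod (fcoeff v k))\<^sup>2"
      by (intro power_mono norm_triangle_ineq) auto
    also have "\<dots> \<le> 2 * (cmod (fcoeff u k))\<^sup>2 + 2 * (cmod (fcoeff v k))\<^sup>2"
      using sum_squares_bound[of "cmod (fcoeff u k)" "cmod (fcoeff v k)"] by (simp add: power2_sum)
    finally show "lam k powr s * (cmod (fcoeff u k + fcoeff v k))\<^sup>2 \<le>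
        2 * wsq s u k + 2 * wsq s v k"
      using mult_left_mono[of _ _ "lam k powr s"] by (fastforce simp: algebra_simps)
  qed auto
  then show ?thesis using c by (simp add: Hs_iff cper_add fcoeff_add)
qed

lemma Hs_diff: "Hs s u \<Longrightarrow> Hs s v \<Longrightarrow> Hs s (\<lambda>x. u x - v x)"
  using Hs_add[OF _ Hs_cmult[of s v "-1"]] by simp

lemma fcoeff_const: "fcoeff (\<lambda>x. c) k = (if k = 0 then of_real c else 0)"
  by (simp add: fcoeff_eq_cfc cfc_def integral_ek)

lemma Hs_const: "Hs s (\<lambda>x. c)"
proof -
  have "(\<lambda>k. wsq s (\<lambda>x. c) k) summable_on UNIV"
    by (rule finite_nonzero_values_imp_summable_on, rule finite_subset[of _ "{0}"])
       (auto simp: fcoeff_const split: if_splits)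
  then show ?thesis by (simp add: Hs_iff cper_const)
qed

text \<open>The triangle inequality for frequencies gives
  \<open>lam k \<le> 4 max (lam j) (lam (k - j))\<close>, so the weight can always be put on one of the two factors
  of the convolution; the other factor is then in \<open>\<ell>\<^sup>1\<close>.\<close>

lemma lam_powr_le:
  assumes "t \<ge> 0"
  shows "lam k powr t \<le> 4 powr t * (lam j powr t + lam (k - j) powr t)"
proof -
  have "(real_of_int k)\<^sup>2 \<le> 2 * (real_of_int j)\<^sup>2 + 2 * (real_of_int (k - j))\<^sup>2"
    using sum_squares_bound[of "real_of_int j" "real_of_int (k - j)"] power2_sum[of "real_of_int j" "real_of_int (k - j)"]
    by simp
  then have "lam k \<le> 4 * max (lam j) (lam (k - j))" by (auto simp: lam_def max_def)
  then have "lam k powr t \<le> (4 * max (lam j) (lam (k - j))) powr t"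
    using assms by (intro powr_mono2) auto
  also have "\<dots> = 4 powr t * (max (lam j) (lam (k - j))) powr t"
    using lam_pos[of j] by (intro powr_mult)
  also have "\<dots> \<le> 4 powr t * (lam j powr t + lam (k - j) powr t)"
    by (intro mult_left_mono) (auto simp: max_def)
  finally show ?thesis .
qed

text \<open>The power of 4 is the one in \<open>lam_powr_le\<close> at t = s/2. The factor 2 is the
  square root of 4, which collects the two convolutions and the 2 in (X + Y)^2 <= 2 X^2 + 2
  Y^2.\<close>

definition algebra_const :: "real \<Rightarrow> real" where
  "algebra_const s = 2 * 4 powr (s / 2) * sobolev_const s"

lemma algebra_const_nonneg: "algebra_const s \<ge> 0"
  by (simp add: algebra_const_def sobolev_const_nonneg)

text \<open>With the weight on one factor, each half of the convolution is of type l^2 * l^1 and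
  \<open>convolution_l2_l1\<close> applies. The bound s > 1/2 is what makes the unweighted
  coefficients of the other factor l^1.\<close>

theorem Hs_mult:
  assumes s: "s > 1/2" and u: "Hs s u" and v: "Hs s v"
  shows "Hs s (\<lambda>x. u x * v x)"
    "Hs_norm s (\<lambda>x. u x * v x) \<le> algebra_const s * Hs_norm s u * Hs_norm s v"
proof -
  define a b where "a k = cmod (fcoeff u k)" and "b k = cmod (fcoeff v k)" for k
  define A B where "A k = lam k powr (s / 2) * a k" and "B k = lam k powr (s / 2) * b k" for k
  define S where "S = sobolev_const s"
  note uc = Hs_cper[OF u] and vc = Hs_cper[OF v]
  have a: "a summable_on UNIV" "infsum a UNIV \<le> S * Hs_norm s u" and b: "b summable_on UNIV" "infsum b UNIV \<le> S * Hs_norm s v"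
    using Hs_abs_summable[OF s u] Hs_abs_summable[OF s v] by (simp_all add: a_def[abs_def] b_def[abs_def] S_def)
  have AB2: "(A k)\<^sup>2 = wsq s u k" "(B k)\<^sup>2 = wsq s v k" for k
    using powr_half_square[OF less_imp_le[OF lam_pos[of k]], of s]
    by (simp_all add: A_def B_def a_def b_def power_mult_distrib)
  have A: "(\<lambda>k. (A k)\<^sup>2) summable_on UNIV" "(\<Sum>\<^sub>\<infinity>k. (A k)\<^sup>2) = (Hs_norm s u)\<^sup>2"
    and B: "(\<lambda>k. (B k)\<^sup>2) summable_on UNIV" "(\<Sum>\<^sub>\<infinity>k. (B k)\<^sup>2) = (Hs_norm s v)\<^sup>2"
    unfolding AB2 Hs_norm_square using u v by (auto simp: Hs_iff)
  have nn: "a k \<ge> 0" "b k \<ge> 0" "A k \<ge> 0" "B k \<ge> 0" for k by (auto simp: a_def b_def A_def B_def)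
  note c1 = convolution_l2_l1[OF A(1) nn(3) b(1) nn(2)] and c2 = convolution_l2_l1[OF B(1) nn(4) a(1) nn(1)]
  define X Y where "X k = (\<Sum>\<^sub>\<infinity>j. A j * b (k - j))" and "Y k = (\<Sum>\<^sub>\<infinity>j. B j * a (k - j))" for k
  define M where "M = 4 powr (s / 2)"
  have M: "M \<ge> 0" by (simp add: M_def)
  have pt: "lam k powr (s / 2) * cmod (fcoeff (\<lambda>x. u x * v x) k) \<le> M * (X k + Y k)" for k
  proof -
    have hs: "((\<lambda>j. fcoeff u j * fcoeff v (k - j)) has_sum fcoeff (\<lambda>x. u x * v x) k) UNIV"
      by (rule fcoeff_mult_has_sum[OF uc Hs_abs_summable(1)[OF s u] vc])
    have X: "((\<lambda>j. A j * b (k - j)) has_sum X k) UNIV"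
      unfolding X_def by (rule has_sum_infsum[OF c1(1)])
    have "((\<lambda>j. B j * a (k - j)) has_sum Y k) UNIV"
      unfolding Y_def by (rule has_sum_infsum[OF c2(1)])
    \<comment> \<open>The substitution j -> k - j moves the weighted factor to the second position,
      so that both halves are indexed alike.\<close>
    then have Y: "((\<lambda>j. a j * B (k - j)) has_sum Y k) UNIV"
      by (subst has_sum_reindex_bij_witness[where i = "\<lambda>j. k - j" and j = "\<lambda>j. k - j" and T = UNIV and h = "\<lambda>j. B j * a (k - j)"]) auto
    have R: "((\<lambda>j. M * (A j * b (k - j) + a j * B (k - j))) has_sum (M * (X k + Y k))) UNIV"
      by (intro has_sum_cmult_right has_sum_add X Y)
    have "norm (lam k powr (s / 2) * fcoeff (\<lambda>x. u x * v x) k) \<le> M * (X k + Y k)"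
    proof (rule norm_infsum_le[OF _ R])
      show "((\<lambda>j. of_real (lam k powr (s / 2)) * (fcoeff u j * fcoeff v (k - j))) has_sum
          of_real (lam k powr (s / 2)) * fcoeff (\<lambda>x. u x * v x) k) UNIV"
        by (rule has_sum_cmult_right[OF hs])
      fix j
      have "lam k powr (s / 2) * (a j * b (k - j)) \<le> (M * (lam j powr (s / 2) + lam (k - j) powr (s / 2))) * (a j * b (k - j))"
        unfolding M_def using s nn by (intro mult_right_mono lam_powr_le) auto
      then show "norm (of_real (lam k powr (s / 2)) * (fcoeff u j * fcoeff v (k - j))) \<le> M * (A j * b (k - j) + a j * B (k - j))"
        by (simp add: norm_mult a_def b_def A_def B_def algebra_simps)
    qed
    then show ?thesis by (simp add: norm_mult)
  qed
  have "(\<Sum>k\<in>F. wsq s (\<lambda>x. u x * v x) k) \<le> (algebra_const s * Hs_norm s u * Hs_norm s v)\<^sup>2" if F: "finite F" for F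
  proof -
    have XY: "X k \<ge> 0" "Y k \<ge> 0" for k unfolding X_def Y_def using nn by (auto intro!: infsum_nonneg)
    have "(\<Sum>k\<in>F. wsq s (\<lambda>x. u x * v x) k) \<le> (\<Sum>k\<in>F. M\<^sup>2 * (2 * (X k)\<^sup>2 + 2 * (Y k)\<^sup>2))"
    proof (rule sum_mono)
      fix k
      have "wsq s (\<lambda>x. u x * v x) k = (lam k powr (s / 2) * cmod (fcoeff (\<lambda>x. u x * v x) k))\<^sup>2"
        using powr_half_square[OF less_imp_le[OF lam_pos[of k]], of s] by (simp add: power_mult_distrib)
      also have "\<dots> \<le> (M * (X k + Y k))\<^sup>2" by (intro power_mono pt) auto
      also have "\<dots> = M\<^sup>2 * (X k + Y k)\<^sup>2" by (simp add: power_mult_distrib)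
      also have "\<dots> \<le> M\<^sup>2 * (2 * (X k)\<^sup>2 + 2 * (Y k)\<^sup>2)"
        using sum_squares_bound[of "X k" "Y k"] by (intro mult_left_mono) (auto simp: power2_sum)
      finally show "wsq s (\<lambda>x. u x * v x) k \<le> M\<^sup>2 * (2 * (X k)\<^sup>2 + 2 * (Y k)\<^sup>2)" .
    qed
    also have "\<dots> = M\<^sup>2 * (2 * (\<Sum>k\<in>F. (X k)\<^sup>2) + 2 * (\<Sum>k\<in>F. (Y k)\<^sup>2))"
      by (simp add: sum.distrib flip: sum_distrib_left)
    also have "\<dots> \<le> M\<^sup>2 * (2 * ((S * Hs_norm s v)\<^sup>2 * (Hs_norm s u)\<^sup>2) + 2 * ((S * Hs_norm s u)\<^sup>2 * (Hs_norm s v)\<^sup>2))"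
    proof (intro mult_left_mono add_mono)
      have "(\<Sum>k\<in>F. (X k)\<^sup>2) \<le> (infsum b UNIV)\<^sup>2 * (Hs_norm s u)\<^sup>2" using c1(2)[OF F] by (simp add: X_def A)
      also have "\<dots> \<le> (S * Hs_norm s v)\<^sup>2 * (Hs_norm s u)\<^sup>2"
        using b nn by (intro mult_right_mono power_mono) (auto intro: infsum_nonneg)
      finally show "(\<Sum>k\<in>F. (X k)\<^sup>2) \<le> (S * Hs_norm s v)\<^sup>2 * (Hs_norm s u)\<^sup>2" .
      have "(\<Sum>k\<in>F. (Y k)\<^sup>2) \<le> (infsum a UNIV)\<^sup>2 * (Hs_norm s v)\<^sup>2" using c2(2)[OF F] by (simp add: Y_def B)
      also have "\<dots> \<le> (S * Hs_norm s u)\<^sup>2 * (Hs_norm s v)\<^sup>2"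
        using a nn by (intro mult_right_mono power_mono) (auto intro: infsum_nonneg)
      finally show "(\<Sum>k\<in>F. (Y k)\<^sup>2) \<le> (S * Hs_norm s u)\<^sup>2 * (Hs_norm s v)\<^sup>2" .
    qed auto
    also have "\<dots> = (algebra_const s * Hs_norm s u * Hs_norm s v)\<^sup>2"
      by (simp add: algebra_const_def S_def M_def power_mult_distrib)
    finally show ?thesis .
  qed
  from HsI[OF cper_mult[OF uc vc] _ this]
  show "Hs s (\<lambda>x. u x * v x)" "Hs_norm s (\<lambda>x. u x * v x) \<le> algebra_const s * Hs_norm s u * Hs_norm s v"
    by (auto simp: algebra_const_nonneg)
qed

subsection \<open>Derivatives and antiderivatives\<close>

text \<open>G(x + 1) - G(x) has derivative 0 by periodicity of \<open>g\<close>, so its value, read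
  off at 0, is the integral over one period. In particular \<open>G\<close> is periodic when
  \<open>g\<close> has mean zero.\<close>

lemma periodic_antiderivative:
  assumes g: "cper g"
  obtains G where "\<And>x. (G has_real_derivative g x) (at x)" "\<And>x. G (x + 1) = G x + integral {0..1} g"
proof -
  have "\<exists>G. \<forall>x::real. -\<infinity> < ereal x \<longrightarrow> ereal x < \<infinity> \<longrightarrow> (G has_vector_derivative g x) (at x)"
  proof (rule einterval_antiderivative)
    fix x :: real
    show "isCont g x" using cper_cont[OF g, of UNIV] by (simp add: continuous_on_eq_continuous_at)
  qed simp
  then obtain G where G: "\<And>x. (G has_real_derivative g x) (at x)"
    by (auto simp: has_real_derivative_iff_has_vector_derivative)
  have "((\<lambda>x. G (x + 1) - G x) has_real_derivative 0) (at x)" for x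
  proof -
    have "((\<lambda>x. G (x + 1)) has_real_derivative g (x + 1)) (at x)"
      using DERIV_shift[of G "g (x + 1)" x 1] G by simp
    then have "((\<lambda>x. G (x + 1) - G x) has_real_derivative g (x + 1) - g x) (at x)"
      by (intro DERIV_diff G)
    then show ?thesis by (simp add: cper_periodic[OF g])
  qed
  then have "G (x + 1) - G x = G (0 + 1) - G 0" for x
    using DERIV_isconst_all[of "\<lambda>x. G (x + 1) - G x"] by blast
  moreover have "(g has_integral (G 1 - G 0)) {0..1}"
    by (rule fundamental_theorem_of_calculus)
       (use G in \<open>auto simp: has_real_derivative_iff_has_vector_derivative intro: has_vector_derivative_at_within\<close>)
  then have "integral {0..1} g = G 1 - G 0" by (rule integral_unique)
  ultimately have "G (x + 1) = G x + integral {0..1} g" for x by (metis add.commute add_0 diff_add_cancel)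
  with G that show thesis by blast
qed

lemma integral_deriv_periodic:
  assumes "\<And>x. (G has_real_derivative g x) (at x)" "periodic1 G"
  shows "integral {0..1} g = 0"
proof -
  have "(g has_integral (G 1 - G 0)) {0..1}"
    by (rule fundamental_theorem_of_calculus)
       (use assms in \<open>auto simp: has_real_derivative_iff_has_vector_derivative intro: has_vector_derivative_at_within\<close>)
  moreover have "G 1 = G 0" using assms(2) by (metis add_0 periodic1_def)
  ultimately show ?thesis by (simp add: integral_unique)
qed

lemma cper_differentiable:
  assumes "\<And>x. (u has_real_derivative u' x) (at x)" "periodic1 u"
  shows "cper u"
  using assms DERIV_isCont continuous_at_imp_continuous_on unfolding cper_def by blast

lemma fcoeff_deriv:
  assumes u: "cper u" "cper u'" and d: "\<And>x. (u has_real_derivative u' x) (at x)"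
  shows "fcoeff u' k = (2 * pi * \<i> * of_int k) * fcoeff u k"
proof -
  let ?w = "2 * pi * \<i> * of_int k"
  have der: "((\<lambda>x. complex_of_real (u x) * ek (- k) x) has_vector_derivative
     (of_real (u x) * ((2 * pi * \<i> * of_int (- k)) * ek (- k) x) + of_real (u' x) * ek (- k) x)) (at x within {0..1})" for x
    by (intro has_vector_derivative_mult ek_has_vector_derivative
        bounded_linear.has_vector_derivative[OF bounded_linear_of_real])
       (use d in \<open>auto simp: has_real_derivative_iff_has_vector_derivative intro: has_vector_derivative_at_within\<close>)
  have "((\<lambda>x. of_real (u x) * ((2 * pi * \<i> * of_int (- k)) * ek (- k) x) + of_real (u' x) * ek (- k) x)
      has_integral (of_real (u 1) * ek (- k) 1 - of_real (u 0) * ek (- k) 0)) {0..1}"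
    by (rule fundamental_theorem_of_calculus[OF _ der]) simp
  moreover have "u 1 = u 0" "ek (- k) 1 = ek (- k) 0"
    using cper_periodic[OF u(1), of 0] ek_periodic[of "- k" 0] by auto
  ultimately have "integral {0..1} (\<lambda>x. of_real (u x) * ((2 * pi * \<i> * of_int (- k)) * ek (- k) x) + of_real (u' x) * ek (- k) x) = 0"
    by (simp add: integral_unique)
  moreover have "(\<lambda>x. of_real (u x) * ((2 * pi * \<i> * of_int (- k)) * ek (- k) x) + of_real (u' x) * ek (- k) x) =
      (\<lambda>x. of_real (u' x) * ek (- k) x - ?w * (of_real (u x) * ek (- k) x))"
    by (auto simp: algebra_simps)
  ultimately have "integral {0..1} (\<lambda>x. of_real (u' x) * ek (- k) x) - integral {0..1} (\<lambda>x. ?w * (of_real (u x) * ek (- k) x)) = 0"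
    by (subst integral_diff[symmetric]) (auto intro!: fcoeff_integrable u integrable_on_mult_right)
  then show ?thesis by (simp add: fcoeff_eq_cfc cfc_def)
qed

text \<open>The series is not differentiated term by term. The formally differentiated coefficients
  define a continuous function \<open>g\<close>, because s - 1 > 1/2; its primitive has the
  coefficients of \<open>u\<close> except possibly the mean, and uniqueness of coefficients
  identifies \<open>u\<close> with that primitive up to a constant.\<close>

theorem Hs_deriv:
  assumes s: "s > 3/2" and u: "Hs s u"
  shows "(u has_real_derivative deriv u x) (at x)" "Hs (s - 1) (deriv u)"
    "Hs_norm (s - 1) (deriv u) \<le> 2 * pi * Hs_norm s u"
    "fcoeff (deriv u) k = (2 * pi * \<i> * of_int k) * fcoeff u k"
proof -
  define c where "c k = (2 * pi * \<i> * of_int k) * fcoeff u k" for k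
  have le: "lam k powr (s - 1) * (cmod (c k))\<^sup>2 \<le> (2 * pi)\<^sup>2 * wsq s u k" for k
  proof -
    have "(cmod (c k))\<^sup>2 = (2 * pi)\<^sup>2 * ((real_of_int k)\<^sup>2 * (cmod (fcoeff u k))\<^sup>2)"
      by (simp add: c_def norm_mult power_mult_distrib)
    also have "\<dots> \<le> (2 * pi)\<^sup>2 * (lam k * (cmod (fcoeff u k))\<^sup>2)"
      by (intro mult_left_mono mult_right_mono) (auto simp: lam_def)
    finally have "lam k powr (s - 1) * (cmod (c k))\<^sup>2 \<le> lam k powr (s - 1) * ((2 * pi)\<^sup>2 * (lam k * (cmod (fcoeff u k))\<^sup>2))"
      by (intro mult_left_mono) auto
    also have "\<dots> = (2 * pi)\<^sup>2 * ((lam k powr (s - 1) * lam k powr 1) * (cmod (fcoeff u k))\<^sup>2)"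
      by (simp add: mult_ac)
    also have "lam k powr (s - 1) * lam k powr 1 = lam k powr s"
      using powr_add[of "lam k" "s - 1" 1] by simp
    finally show ?thesis .
  qed
  have sm: "(\<lambda>k. lam k powr (s - 1) * (cmod (c k))\<^sup>2) summable_on UNIV"
    by (rule summable_on_comparison_test[OF summable_on_cmult_right[of _ _ "(2 * pi)\<^sup>2"]])
       (use u le in \<open>auto simp: Hs_iff\<close>)
  have herm: "c (- k) = cnj (c k)" for k by (simp add: c_def fcoeff_minus_index)
  define g where "g = fseries c"
  have s1: "s - 1 > 1/2" using s by simp
  have g: "Hs (s - 1) g" "fcoeff g k = c k" for k
    using Hs_fseries[OF s1 sm herm] by (auto simp: g_def)
  note gc = Hs_cper[OF g(1)] and uc = Hs_cper[OF u]
  have "integral {0..1} g = 0"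
    using fcoeff_0_index[OF gc] g(2)[of 0] by (simp add: c_def)
  then obtain G where G: "\<And>x. (G has_real_derivative g x) (at x)" "periodic1 G"
    using periodic_antiderivative[OF gc] unfolding periodic1_def by (metis add.right_neutral)
  have Gc: "cper G" by (rule cper_differentiable[OF G])
  \<comment> \<open>The coefficient of index 0 is invisible to differentiation and has to be matched
    by hand.\<close>
  define d where "d = integral {0..1} u - integral {0..1} G"
  have "u = (\<lambda>x. G x + d)"
  proof (rule cper_eqI[OF uc cper_add[OF Gc cper_const]])
    fix k
    have *: "c k = (2 * pi * \<i> * of_int k) * fcoeff G k"
      using fcoeff_deriv[OF Gc gc G(1), of k] g(2) by simp
    show "fcoeff u k = fcoeff (\<lambda>x. G x + d) k"
    proof (cases "k = 0")
      case True
      then show ?thesis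
        by (simp add: fcoeff_add Gc cper_const fcoeff_const fcoeff_0_index uc d_def)
    next
      case False
      then show ?thesis using *
        by (simp add: c_def fcoeff_add Gc cper_const fcoeff_const)
    qed
  qed
  then have der: "(u has_real_derivative g x) (at x)" for x
    using G(1) by (auto intro!: derivative_eq_intros)
  then have du: "deriv u = g" by (auto intro: DERIV_imp_deriv)
  show "(u has_real_derivative deriv u x) (at x)" using der du by simp
  show "Hs (s - 1) (deriv u)" using g du by simp
  show "fcoeff (deriv u) k = (2 * pi * \<i> * of_int k) * fcoeff u k" using g(2) du by (simp add: c_def)
  show "Hs_norm (s - 1) (deriv u) \<le> 2 * pi * Hs_norm s u"
    unfolding du
  proof (rule HsI(2)[OF gc])
    fix F :: "int set" assume F: "finite F"
    have "(\<Sum>k\<in>F. wsq (s - 1) g k) \<le> (\<Sum>k\<in>F. (2 * pi)\<^sup>2 * wsq s u k)"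
      unfolding g(2) by (intro sum_mono le)
    also have "\<dots> \<le> (2 * pi)\<^sup>2 * (Hs_norm s u)\<^sup>2"
      unfolding sum_distrib_left[symmetric] by (intro mult_left_mono Hs_sum_le[OF u F]) auto
    finally show "(\<Sum>k\<in>F. wsq (s - 1) g k) \<le> (2 * pi * Hs_norm s u)\<^sup>2"
      by (simp add: power_mult_distrib)
  qed auto
qed

text \<open>Away from index 0 the weight is absorbed by the square of the derivative's multiplier,
  so recovering a function from its derivative costs no constant.\<close>

lemma lam_le_frequency:
  assumes "k \<noteq> 0"
  shows "lam k \<le> (2 * pi)\<^sup>2 * (real_of_int k)\<^sup>2"
proof -
  have "1 \<le> (real_of_int k)\<^sup>2"
  proof -
    have "1 \<le> \<bar>real_of_int k\<bar>" using assms by linarith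
    then show ?thesis by (metis abs_ge_zero one_le_power power2_abs)
  qed
  moreover have "2 \<le> (2 * pi)\<^sup>2"
  proof -
    have "2 * 1 \<le> (2 * pi) * (2 * pi)" using pi_ge_two by (intro mult_mono) auto
    then show ?thesis by (simp add: power2_eq_square)
  qed
  moreover have "2 * (real_of_int k)\<^sup>2 \<le> (2 * pi)\<^sup>2 * (real_of_int k)\<^sup>2"
    using \<open>2 \<le> (2 * pi)\<^sup>2\<close> by (intro mult_right_mono) auto
  ultimately show "lam k \<le> (2 * pi)\<^sup>2 * (real_of_int k)\<^sup>2"
    unfolding lam_def by linarith
qed

text \<open>Only the mean is lost under differentiation, hence the extra term. The bound on
  \<open>u'\<close> is phrased with finite sums so that it can come either from an H^(s-1) norm or
  directly from Bessel's inequality.\<close>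

theorem Hs_of_deriv:
  assumes u: "cper u" and d: "\<And>x. (u has_real_derivative u' x) (at x)" and u': "cper u'"
    and B: "\<And>F. finite F \<Longrightarrow> (\<Sum>k\<in>F. wsq (s - 1) u' k) \<le> B\<^sup>2"
  shows "Hs s u" "(Hs_norm s u)\<^sup>2 \<le> (integral {0..1} u)\<^sup>2 + B\<^sup>2"
proof -
  let ?m = "integral {0..1} u"
  have le: "wsq s u k \<le> (if k = 0 then ?m\<^sup>2 else 0) + wsq (s - 1) u' k" for k
  proof (cases "k = 0")
    case True
    then show ?thesis by (simp add: fcoeff_0_index u lam_def)
  next
    case False
    have "lam k \<le> (2 * pi)\<^sup>2 * (real_of_int k)\<^sup>2" by (rule lam_le_frequency[OF False])
    then have "lam k * (cmod (fcoeff u k))\<^sup>2 \<le> (2 * pi)\<^sup>2 * (real_of_int k)\<^sup>2 * (cmod (fcoeff u k))\<^sup>2"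
      by (intro mult_right_mono) auto
    also have "\<dots> = (cmod (fcoeff u' k))\<^sup>2"
      by (simp add: fcoeff_deriv[OF u u' d] norm_mult power_mult_distrib)
    finally have "lam k powr (s - 1) * (lam k * (cmod (fcoeff u k))\<^sup>2) \<le> wsq (s - 1) u' k"
      by (intro mult_left_mono) auto
    moreover have "lam k powr (s - 1) * lam k = lam k powr s"
      using powr_add[of "lam k" "s - 1" 1] by simp
    ultimately show ?thesis using False by (simp add: mult.assoc[symmetric])
  qed
  have "(\<Sum>k\<in>F. wsq s u k) \<le> (sqrt (?m\<^sup>2 + B\<^sup>2))\<^sup>2" if F: "finite F" for F
  proof -
    have "(\<Sum>k\<in>F. wsq s u k) \<le> (\<Sum>k\<in>F. (if k = 0 then ?m\<^sup>2 else 0) + wsq (s - 1) u' k)"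
      by (intro sum_mono le)
    also have "\<dots> = (\<Sum>k\<in>F. if k = 0 then ?m\<^sup>2 else 0) + (\<Sum>k\<in>F. wsq (s - 1) u' k)"
      by (rule sum.distrib)
    also have "\<dots> \<le> ?m\<^sup>2 + B\<^sup>2"
      using F B[OF F] by (intro add_mono) (auto simp: sum.delta)
    finally show ?thesis by simp
  qed
  from HsI[OF u _ this] have "Hs s u" "Hs_norm s u \<le> sqrt (?m\<^sup>2 + B\<^sup>2)" by auto
  then show "Hs s u" by simp
  show "(Hs_norm s u)\<^sup>2 \<le> ?m\<^sup>2 + B\<^sup>2"
    using power_mono[OF \<open>Hs_norm s u \<le> sqrt (?m\<^sup>2 + B\<^sup>2)\<close>, of 2] by simp
qed

subsection \<open>Interpolation between Sobolev spaces\<close>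

text \<open>A discretisation at r = 2^j of the integral of r^\<theta> \<kappa> / (r + \<kappa>) dr /
  r over the half line, which is a constant multiple of \<kappa>^\<theta>.\<close>

definition dyadic_sum :: "real \<Rightarrow> nat \<Rightarrow> real \<Rightarrow> real" where
  "dyadic_sum \<theta> J \<kappa> = (\<Sum>j<J. (2 ^ j) powr \<theta> * (\<kappa> / (2 ^ j + \<kappa>)))"

lemma geometric_sum_le:
  fixes \<rho> :: real
  assumes "0 \<le> \<rho>" "\<rho> < 1"
  shows "(\<Sum>i<n. \<rho> ^ i) \<le> 1 / (1 - \<rho>)"
proof -
  have "(\<Sum>i<n. \<rho> ^ i) \<le> suminf (\<lambda>i. \<rho> ^ i)"
    by (rule sum_le_suminf) (use assms in \<open>auto intro: summable_geometric\<close>)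
  then show ?thesis using assms by (simp add: suminf_geometric)
qed

lemma dyadic_interval:
  fixes \<kappa> :: real
  assumes "\<kappa> \<ge> 1"
  obtains n :: nat where "2 ^ n \<le> \<kappa>" "\<kappa> < 2 ^ Suc n"
proof -
  obtain m where m: "\<kappa> < 2 ^ m" using real_arch_pow[of 2 \<kappa>] by auto
  define k where "k = (LEAST m. \<kappa> < 2 ^ m)"
  have k: "\<kappa> < 2 ^ k" unfolding k_def by (rule LeastI[of "\<lambda>m. \<kappa> < 2 ^ m", OF m])
  have "k \<noteq> 0" using k assms by (cases k) auto
  then obtain n where n: "k = Suc n" using not0_implies_Suc by blast
  have "\<not> \<kappa> < 2 ^ n" using not_less_Least[of n "\<lambda>m. \<kappa> < 2 ^ m"] n by (simp add: k_def)
  with k n that show thesis by (simp add: not_less)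
qed

text \<open>Split at the \<open>n\<close> with 2^n <= \<kappa> < 2^(n+1). Below it the fraction is
  at most 1 and the terms decay geometrically downwards with ratio 2^(-\<theta>); above it the
  fraction is at most \<kappa> / 2^j and they decay upwards with ratio 2^(\<theta>-1). Neither bound
  depends on \<open>J\<close>.\<close>

lemma dyadic_sum_upper:
  assumes \<theta>: "0 < \<theta>" "\<theta> < 1" and \<kappa>: "\<kappa> \<ge> 1"
  shows "dyadic_sum \<theta> J \<kappa> \<le> (1 / (1 - 2 powr (- \<theta>)) + 1 / (1 - 2 powr (\<theta> - 1))) * \<kappa> powr \<theta>"
proof -
  obtain n where n: "2 ^ n \<le> \<kappa>" "\<kappa> < 2 ^ Suc n" using dyadic_interval[OF \<kappa>] .
  define \<rho> \<sigma> where "\<rho> = 2 powr (- \<theta>)" and "\<sigma> = 2 powr (\<theta> - 1)"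
  have \<rho>: "0 \<le> \<rho>" "\<rho> < 1" and \<sigma>: "0 \<le> \<sigma>" "\<sigma> < 1"
    using \<theta> by (auto simp: \<rho>_def \<sigma>_def powr_less_one)
  let ?t = "\<lambda>j. (2 ^ j) powr \<theta> * (\<kappa> / (2 ^ j + \<kappa>))"
  have pw: "(2 ^ j :: real) powr x = 2 powr (real j * x)" for j x
    by (simp add: powr_powr flip: powr_realpow)
  have low: "?t j \<le> \<kappa> powr \<theta> * \<rho> ^ (n - j)" if "j \<le> n" for j
  proof -
    have "?t j \<le> (2 ^ j) powr \<theta> * 1"
      using \<kappa> by (intro mult_left_mono) (auto simp: divide_simps add_nonneg_pos)
    also have "\<dots> = (2 ^ n) powr \<theta> * \<rho> ^ (n - j)"
      using that by (simp add: \<rho>_def pw powr_realpow[symmetric] powr_powr of_nat_diff algebra_simps flip: powr_add)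
    also have "\<dots> \<le> \<kappa> powr \<theta> * \<rho> ^ (n - j)"
      using n \<theta> \<rho> by (intro mult_right_mono powr_mono2) auto
    finally show ?thesis .
  qed
  have high: "?t (Suc n + i) \<le> \<kappa> powr \<theta> * \<sigma> ^ i" for i
  proof -
    have "?t (Suc n + i) \<le> (2 ^ (Suc n + i)) powr \<theta> * (\<kappa> / 2 ^ (Suc n + i))"
      using \<kappa> by (intro mult_left_mono divide_left_mono) (auto intro!: mult_pos_pos add_pos_pos)
    also have "\<dots> = \<kappa> * (2 ^ (Suc n + i)) powr (\<theta> - 1)"
      by (simp add: powr_diff)
    also have "(2 ^ (Suc n + i) :: real) powr (\<theta> - 1) = (2 ^ Suc n) powr (\<theta> - 1) * \<sigma> ^ i"
      by (simp add: power_add powr_mult \<sigma>_def pw powr_realpow[symmetric] powr_powr mult.commute)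
    also have "\<kappa> * ((2 ^ Suc n) powr (\<theta> - 1) * \<sigma> ^ i) \<le> \<kappa> * (\<kappa> powr (\<theta> - 1) * \<sigma> ^ i)"
      using n \<theta> \<kappa> \<sigma> by (intro mult_left_mono mult_right_mono powr_mono2') auto
    also have "\<dots> = \<kappa> powr \<theta> * \<sigma> ^ i"
      using \<kappa> powr_add[of \<kappa> 1 "\<theta> - 1"] by (simp add: mult.assoc[symmetric])
    finally show ?thesis .
  qed
  have nn: "?t j \<ge> 0" for j using \<kappa> by auto
  have "dyadic_sum \<theta> J \<kappa> \<le> (\<Sum>j<Suc n + J. ?t j)"
    unfolding dyadic_sum_def by (rule sum_mono2) (use nn in auto)
  also have "\<dots> = (\<Sum>j<Suc n. ?t j) + (\<Sum>i<J. ?t (Suc n + i))"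
    by (induction J) (auto simp: add.assoc)
  also have "\<dots> \<le> (\<Sum>j<Suc n. \<kappa> powr \<theta> * \<rho> ^ (n - j)) + (\<Sum>i<J. \<kappa> powr \<theta> * \<sigma> ^ i)"
    by (intro add_mono sum_mono low high) auto
  also have "(\<Sum>j<Suc n. \<kappa> powr \<theta> * \<rho> ^ (n - j)) = (\<Sum>j<Suc n. \<kappa> powr \<theta> * \<rho> ^ j)"
    using sum.nat_diff_reindex[of "\<lambda>i. \<kappa> powr \<theta> * \<rho> ^ i" "Suc n"] by simp
  also have "\<dots> + (\<Sum>i<J. \<kappa> powr \<theta> * \<sigma> ^ i) = \<kappa> powr \<theta> * (\<Sum>j<Suc n. \<rho> ^ j) + \<kappa> powr \<theta> * (\<Sum>i<J. \<sigma> ^ i)"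
    by (simp only: sum_distrib_left)
  also have "\<dots> \<le> \<kappa> powr \<theta> * (1 / (1 - \<rho>)) + \<kappa> powr \<theta> * (1 / (1 - \<sigma>))"
    by (intro add_mono mult_left_mono geometric_sum_le \<rho> \<sigma>) auto
  finally show ?thesis by (simp add: \<rho>_def \<sigma>_def algebra_simps)
qed

text \<open>The single term at the dyadic level of \<kappa> is enough: there the fraction is at
  least 1/2, and replacing \<kappa> by that power of 2 costs at most another factor 2.\<close>

lemma dyadic_sum_lower:
  assumes \<theta>: "0 < \<theta>" "\<theta> < 1" and \<kappa>: "\<kappa> \<ge> 1" "\<kappa> < 2 ^ J"
  shows "\<kappa> powr \<theta> \<le> 4 * dyadic_sum \<theta> J \<kappa>"
proof -
  obtain n where n: "2 ^ n \<le> \<kappa>" "\<kappa> < 2 ^ Suc n" using dyadic_interval[OF \<kappa>(1)] .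
  have nJ: "n < J"
  proof -
    have "(2::real) ^ n < 2 ^ J" using n \<kappa> by linarith
    then show ?thesis by simp
  qed
  have "\<kappa> powr \<theta> \<le> (2 ^ Suc n) powr \<theta>" using n \<kappa> \<theta> by (intro powr_mono2) auto
  also have "\<dots> = 2 powr \<theta> * (2 ^ n) powr \<theta>" by (simp add: powr_mult)
  also have "\<dots> \<le> 2 powr 1 * (2 ^ n) powr \<theta>" using \<theta> by (intro mult_right_mono powr_mono) auto
  also have "\<dots> = 4 * ((2 ^ n) powr \<theta> * (1 / 2))" by simp
  also have "\<dots> \<le> 4 * ((2 ^ n) powr \<theta> * (\<kappa> / (2 ^ n + \<kappa>)))"
    using n \<kappa> by (intro mult_left_mono) (auto simp: divide_simps add_nonneg_pos)
  also have "\<dots> \<le> 4 * dyadic_sum \<theta> J \<kappa>"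
    unfolding dyadic_sum_def using nJ \<kappa>
    by (intro mult_left_mono member_le_sum) auto
  finally show ?thesis .
qed

text \<open>The left side is the minimum of the right side over all decompositions of x + y, the
  parallel sum of the weights 1 and \<kappa>/r. The defect is controlled by the square of r |x| -
  \<kappa> |y|.\<close>

lemma parallel_sum_le:
  fixes x y :: complex and r \<kappa> :: real
  assumes "r > 0" "\<kappa> > 0"
  shows "\<kappa> / (r + \<kappa>) * (cmod (x + y))\<^sup>2 \<le> (cmod x)\<^sup>2 + \<kappa> / r * (cmod y)\<^sup>2"
proof -
  let ?X = "cmod x" and ?Y = "cmod y"
  have "(cmod (x + y))\<^sup>2 \<le> (?X + ?Y)\<^sup>2" by (intro power_mono norm_triangle_ineq) auto
  then have "\<kappa> * r * (cmod (x + y))\<^sup>2 \<le> \<kappa> * r * (?X + ?Y)\<^sup>2" using assms by (intro mult_left_mono) auto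
  also have "\<dots> \<le> \<kappa> * r * (?X + ?Y)\<^sup>2 + (r * ?X - \<kappa> * ?Y)\<^sup>2" by simp
  also have "\<dots> = (r + \<kappa>) * (r * ?X\<^sup>2 + \<kappa> * ?Y\<^sup>2)" by (simp add: power2_eq_square algebra_simps)
  finally show ?thesis using assms by (simp add: field_simps)
qed

text \<open>This is real interpolation with the \<open>K\<close>-functional sampled at dyadic points: for each
  \<open>r = 2\<^sup>j\<close> the multiplier \<open>r / (r + \<kappa>)\<close>, where \<open>\<kappa> = lam powr (b - a)\<close>, splits the argument
  optimally, and \<open>\<Sum>j. r powr \<theta> * \<kappa> / (r + \<kappa>)\<close> is comparable to \<open>\<kappa> powr \<theta>\<close>.\<close>

theorem Hs_interpolation:
  fixes T :: "(real \<Rightarrow> real) \<Rightarrow> real \<Rightarrow> real"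
  assumes ab: "a < \<sigma>" "\<sigma> < b" and \<sigma>: "\<sigma> > 1/2"
    and add: "\<And>u v. Hs \<sigma> u \<Longrightarrow> Hs \<sigma> v \<Longrightarrow> T (\<lambda>x. u x + v x) = (\<lambda>x. T u x + T v x)"
    and Ta: "\<And>u. Hs \<sigma> u \<Longrightarrow> Hs a (T u) \<and> Hs_norm a (T u) \<le> M * Hs_norm a u"
    and Tb: "\<And>u. Hs (\<sigma> + 2 * (b - a)) u \<Longrightarrow> Hs b (T u) \<and> Hs_norm b (T u) \<le> M * Hs_norm b u"
  obtains C where "C \<ge> 0" "\<And>u. Hs \<sigma> u \<Longrightarrow> Hs \<sigma> (T u) \<and> Hs_norm \<sigma> (T u) \<le> C * Hs_norm \<sigma> u"
proof -
  \<comment> \<open>So \<sigma> = (1 - \<theta>) a + \<theta> b.\<close>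
  define \<theta> where "\<theta> = (\<sigma> - a) / (b - a)"
  have \<theta>: "0 < \<theta>" "\<theta> < 1" using ab by (auto simp: \<theta>_def field_simps)
  define \<kappa> where "\<kappa> k = lam k powr (b - a)" for k
  have \<kappa>: "\<kappa> k \<ge> 1" for k using ab lam_ge_1[of k] by (simp add: \<kappa>_def ge_one_powr_ge_zero)
  have \<kappa>0: "\<kappa> k > 0" for k using \<kappa>[of k] by linarith
  have lam_b: "lam k powr b = lam k powr a * \<kappa> k" for k by (simp add: \<kappa>_def flip: powr_add)
  have lam_\<sigma>: "lam k powr \<sigma> = lam k powr a * \<kappa> k powr \<theta>" for k
    using ab by (simp add: \<kappa>_def powr_powr \<theta>_def flip: powr_add)
  define D where "D = 1 / (1 - 2 powr (- \<theta>)) + 1 / (1 - 2 powr (\<theta> - 1))"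
  have D: "D \<ge> 0" using \<theta> powr_less_one[of 2 "- \<theta>"] powr_less_one[of 2 "\<theta> - 1"] by (simp add: D_def)
  have main: "(\<Sum>k\<in>F. wsq \<sigma> (T u) k) \<le> 4 * M\<^sup>2 * D * (Hs_norm \<sigma> u)\<^sup>2"
    if u: "Hs \<sigma> u" and F: "finite F" for u F
  proof -
    define f where "f k = (cmod (fcoeff u k))\<^sup>2" for k
    define g where "g k = (cmod (fcoeff (T u) k))\<^sup>2" for k
    have uc: "cper u" by (rule Hs_cper[OF u])
    have sa: "(\<lambda>k. lam k powr \<sigma> * f k) summable_on UNIV" using u by (simp add: Hs_iff f_def)
    have f0: "f k \<ge> 0" for k by (simp add: f_def)
    have cmp: "(\<lambda>k. lam k powr a * (w k * f k)) summable_on UNIV" if "\<And>k. w k \<ge> 0" "\<And>k. w k \<le> 1" for w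
    proof (rule summable_on_comparison_test[OF sa])
      fix k
      have "lam k powr a * (w k * f k) \<le> lam k powr \<sigma> * (1 * f k)"
        using that f0 ab lam_ge_1 by (intro mult_mono powr_mono) auto
      then show "lam k powr a * (w k * f k) \<le> lam k powr \<sigma> * f k" by simp
    qed (use that f0 in auto)
    have K: "(\<Sum>k\<in>F. lam k powr a * (\<kappa> k / (r + \<kappa> k) * g k)) \<le> M\<^sup>2 * (\<Sum>\<^sub>\<infinity>k. lam k powr a * (\<kappa> k / (r + \<kappa> k) * f k))"
      if r: "r > 0" for r :: real
    proof -
      have rk: "r + \<kappa> k > 0" for k using r \<kappa>0[of k] by linarith
      define c1 where "c1 k = of_real (r / (r + \<kappa> k)) * fcoeff u k" for k
      have herm: "c1 (- k) = cnj (c1 k)" for k by (simp add: c1_def \<kappa>_def fcoeff_minus_index)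
      have sq1: "(cmod (c1 k))\<^sup>2 = (r / (r + \<kappa> k))\<^sup>2 * f k" for k
        using r rk[of k] by (simp only: c1_def norm_mult power_mult_distrib f_def norm_of_real power2_abs)
      \<comment> \<open>The multiplier r / (r + \<kappa>) is bounded by r / \<kappa> and so gains 2
        (b - a) derivatives. The smooth piece therefore lies in the space on which the bound at
        level \<open>b\<close> is assumed.\<close>
      have big: "(\<lambda>k. lam k powr (\<sigma> + 2 * (b - a)) * (cmod (c1 k))\<^sup>2) summable_on UNIV"
      proof (rule summable_on_comparison_test[OF summable_on_cmult_right[OF sa, of "r\<^sup>2"]])
        fix k
        have "lam k powr (\<sigma> + 2 * (b - a)) = lam k powr \<sigma> * (\<kappa> k)\<^sup>2"
          by (simp add: \<kappa>_def power2_eq_square flip: powr_add)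
        then have "lam k powr (\<sigma> + 2 * (b - a)) * (cmod (c1 k))\<^sup>2 = (r * (\<kappa> k / (r + \<kappa> k)))\<^sup>2 * (lam k powr \<sigma> * f k)"
          unfolding sq1 by (simp add: power_mult_distrib power_divide)
        also have "\<dots> \<le> r\<^sup>2 * (lam k powr \<sigma> * f k)"
        proof (intro mult_right_mono power_mono)
          have "\<kappa> k / (r + \<kappa> k) \<le> 1" using r rk[of k] by simp
          then show "r * (\<kappa> k / (r + \<kappa> k)) \<le> r" 
            using mult_left_mono[of "\<kappa> k / (r + \<kappa> k)" 1 r] r by simp
          show "0 \<le> r * (\<kappa> k / (r + \<kappa> k))" using r rk[of k] \<kappa>0[of k] by simp
        qed (use f0 in auto)
        finally show "lam k powr (\<sigma> + 2 * (b - a)) * (cmod (c1 k))\<^sup>2 \<le> r\<^sup>2 * (lam k powr \<sigma> * f k)" .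
      qed auto
      define u1 where "u1 = fseries c1"
      define u0 where "u0 x = u x - u1 x" for x
      have "\<sigma> + 2 * (b - a) > 1/2" using \<sigma> ab by simp
      note fs = Hs_fseries[OF this big herm]
      have u1: "Hs (\<sigma> + 2 * (b - a)) u1" "fcoeff u1 k = c1 k" for k using fs by (auto simp: u1_def)
      have u1\<sigma>: "Hs \<sigma> u1" using Hs_mono(1)[OF u1(1)] ab by simp
      have u0: "Hs \<sigma> u0" unfolding u0_def[abs_def] by (rule Hs_diff[OF u u1\<sigma>])
      have fu0: "fcoeff u0 k = of_real (\<kappa> k / (r + \<kappa> k)) * fcoeff u k" for k
      proof -
        have "fcoeff u0 k = fcoeff u k - c1 k"
          unfolding u0_def[abs_def] using fcoeff_diff[OF uc Hs_cper[OF u1\<sigma>]] u1(2) by simp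
        also have "\<dots> = of_real (1 - r / (r + \<kappa> k)) * fcoeff u k" by (simp add: c1_def algebra_simps)
        also have "1 - r / (r + \<kappa> k) = \<kappa> k / (r + \<kappa> k)" using rk[of k] by (simp add: field_simps)
        finally show ?thesis .
      qed
      have sq0: "(cmod (fcoeff u0 k))\<^sup>2 = (\<kappa> k / (r + \<kappa> k))\<^sup>2 * f k" for k
        by (simp only: fu0 norm_mult power_mult_distrib f_def norm_of_real power2_abs)
      have T: "T u = (\<lambda>x. T u0 x + T u1 x)" using add[OF u0 u1\<sigma>] by (simp add: u0_def)
      note T0 = Ta[OF u0] and T1 = Tb[OF u1(1)]
      have w: "\<kappa> k / (r + \<kappa> k) \<ge> 0" "\<kappa> k / (r + \<kappa> k) \<le> 1" "r / (r + \<kappa> k) \<ge> 0" "r / (r + \<kappa> k) \<le> 1" for k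
        using r \<kappa>0[of k] by auto
      have n0: "(Hs_norm a u0)\<^sup>2 = (\<Sum>\<^sub>\<infinity>k. lam k powr a * ((\<kappa> k / (r + \<kappa> k))\<^sup>2 * f k))"
        unfolding Hs_norm_square sq0 ..
      have n1: "(Hs_norm b u1)\<^sup>2 / r = (\<Sum>\<^sub>\<infinity>k. lam k powr a * (\<kappa> k * r / (r + \<kappa> k)\<^sup>2 * f k))"
      proof -
        have "(\<Sum>\<^sub>\<infinity>k. lam k powr a * (\<kappa> k * r / (r + \<kappa> k)\<^sup>2 * f k)) = (\<Sum>\<^sub>\<infinity>k. (1 / r) * (lam k powr b * ((r / (r + \<kappa> k))\<^sup>2 * f k)))"
          using r by (intro infsum_cong) (simp add: lam_b power_divide power2_eq_square)
        also have "\<dots> = (1 / r) * (\<Sum>\<^sub>\<infinity>k. lam k powr b * ((r / (r + \<kappa> k))\<^sup>2 * f k))"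
          by (rule infsum_cmult_right')
        finally show ?thesis unfolding Hs_norm_square u1(2) sq1 by simp
      qed
      have s0: "(\<lambda>k. lam k powr a * ((\<kappa> k / (r + \<kappa> k))\<^sup>2 * f k)) summable_on UNIV"
        by (rule cmp) (use w in \<open>auto intro: power_le_one\<close>)
      have s1: "(\<lambda>k. lam k powr a * (\<kappa> k * r / (r + \<kappa> k)\<^sup>2 * f k)) summable_on UNIV"
      proof (rule cmp)
        fix k
        have "\<kappa> k * r / (r + \<kappa> k)\<^sup>2 = (\<kappa> k / (r + \<kappa> k)) * (r / (r + \<kappa> k))" by (simp add: power2_eq_square)
        then show "\<kappa> k * r / (r + \<kappa> k)\<^sup>2 \<ge> 0" "\<kappa> k * r / (r + \<kappa> k)\<^sup>2 \<le> 1"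
          by (simp_all only: mult_nonneg_nonneg[OF w(1) w(3)] mult_le_one[OF w(2) w(3) w(4)])
      qed
      \<comment> \<open>For these multipliers the energies of the two pieces add up exactly to the
        weight \<kappa> / (r + \<kappa>); the splitting attains the minimum of
        \<open>parallel_sum_le\<close> at every frequency.\<close>
      have split: "(Hs_norm a u0)\<^sup>2 + (Hs_norm b u1)\<^sup>2 / r = (\<Sum>\<^sub>\<infinity>k. lam k powr a * (\<kappa> k / (r + \<kappa> k) * f k))"
        unfolding n0 n1 infsum_add[OF s0 s1, symmetric]
      proof (rule infsum_cong)
        fix k
        have "(\<kappa> k / (r + \<kappa> k))\<^sup>2 + \<kappa> k * r / (r + \<kappa> k)\<^sup>2 = \<kappa> k / (r + \<kappa> k)"
          using rk[of k] by (simp add: power2_eq_square divide_simps) (simp add: algebra_simps)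
        then show "lam k powr a * ((\<kappa> k / (r + \<kappa> k))\<^sup>2 * f k) + lam k powr a * (\<kappa> k * r / (r + \<kappa> k)\<^sup>2 * f k) =
            lam k powr a * (\<kappa> k / (r + \<kappa> k) * f k)"
          by (metis distrib_left distrib_right)
      qed
      have "(\<Sum>k\<in>F. lam k powr a * (\<kappa> k / (r + \<kappa> k) * g k)) \<le>
          (\<Sum>k\<in>F. wsq a (T u0) k + (1 / r) * (wsq b (T u1) k))"
      proof (rule sum_mono)
        fix k
        have "fcoeff (T u) k = fcoeff (T u0) k + fcoeff (T u1) k"
          using T0 T1 by (subst T) (intro fcoeff_add Hs_cper; blast)
        then have "\<kappa> k / (r + \<kappa> k) * g k \<le> (cmod (fcoeff (T u0) k))\<^sup>2 + \<kappa> k / r * (cmod (fcoeff (T u1) k))\<^sup>2"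
          using parallel_sum_le[OF r \<kappa>0] by (simp add: g_def)
        then have "lam k powr a * (\<kappa> k / (r + \<kappa> k) * g k) \<le> lam k powr a * ((cmod (fcoeff (T u0) k))\<^sup>2 + \<kappa> k / r * (cmod (fcoeff (T u1) k))\<^sup>2)"
          by (intro mult_left_mono) auto
        then show "lam k powr a * (\<kappa> k / (r + \<kappa> k) * g k) \<le> wsq a (T u0) k + (1 / r) * (wsq b (T u1) k)"
          by (simp add: lam_b distrib_left)
      qed
      also have "\<dots> \<le> (Hs_norm a (T u0))\<^sup>2 + (1 / r) * (Hs_norm b (T u1))\<^sup>2"
        unfolding sum.distrib sum_distrib_left[symmetric]
        using T0 T1 r by (intro add_mono mult_left_mono Hs_sum_le F) auto
      also have "\<dots> \<le> (M * Hs_norm a u0)\<^sup>2 + (1 / r) * (M * Hs_norm b u1)\<^sup>2"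
        using T0 T1 r by (intro add_mono mult_left_mono power_mono) auto
      also have "\<dots> = M\<^sup>2 * ((Hs_norm a u0)\<^sup>2 + (Hs_norm b u1)\<^sup>2 / r)"
        by (simp add: power_mult_distrib algebra_simps)
      finally show ?thesis unfolding split .
    qed
    \<comment> \<open>\<open>F\<close> is finite, so finitely many dyadic levels reach all its
      frequencies. \<open>J\<close> depends on \<open>F\<close>, but the upper bound on
      \<open>dyadic_sum\<close> does not depend on \<open>J\<close>.\<close>
    obtain J where J: "\<And>k. k \<in> F \<Longrightarrow> \<kappa> k < 2 ^ J"
    proof -
      obtain J where "(\<Sum>k\<in>F. \<kappa> k) < 2 ^ J" using real_arch_pow[of 2] by auto
      moreover have "\<kappa> k \<le> (\<Sum>k\<in>F. \<kappa> k)" if "k \<in> F" for k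
        using that F by (intro member_le_sum) (auto intro: less_imp_le \<kappa>0)
      ultimately have "\<And>k. k \<in> F \<Longrightarrow> \<kappa> k < 2 ^ J" by (meson le_less_trans)
      then show thesis by (rule that)
    qed
    have ds: "dyadic_sum \<theta> J (\<kappa> k) * y = (\<Sum>j<J. (2 ^ j) powr \<theta> * (\<kappa> k / (2 ^ j + \<kappa> k) * y))" for k y
      unfolding dyadic_sum_def sum_distrib_right by (intro sum.cong) auto
    have "(\<Sum>k\<in>F. lam k powr \<sigma> * g k) \<le> (\<Sum>k\<in>F. 4 * (\<Sum>j<J. (2 ^ j) powr \<theta> * (lam k powr a * (\<kappa> k / (2 ^ j + \<kappa> k) * g k))))"
    proof (rule sum_mono)
      fix k assume "k \<in> F"
      then have "\<kappa> k powr \<theta> \<le> 4 * dyadic_sum \<theta> J (\<kappa> k)" by (intro dyadic_sum_lower \<theta> \<kappa> J)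
      then have "lam k powr a * g k * (\<kappa> k powr \<theta>) \<le> lam k powr a * g k * (4 * dyadic_sum \<theta> J (\<kappa> k))"
        by (intro mult_left_mono) (auto simp: g_def)
      also have "\<dots> = 4 * (lam k powr a * (dyadic_sum \<theta> J (\<kappa> k) * g k))" by (simp add: mult_ac)
      also have "\<dots> = 4 * (\<Sum>j<J. (2 ^ j) powr \<theta> * (lam k powr a * (\<kappa> k / (2 ^ j + \<kappa> k) * g k)))"
        unfolding ds sum_distrib_left by (simp add: mult_ac)
      finally show "lam k powr \<sigma> * g k \<le> 4 * (\<Sum>j<J. (2 ^ j) powr \<theta> * (lam k powr a * (\<kappa> k / (2 ^ j + \<kappa> k) * g k)))"
        by (simp add: lam_\<sigma> mult_ac)
    qed
    also have "\<dots> = 4 * (\<Sum>j<J. (2 ^ j) powr \<theta> * (\<Sum>k\<in>F. lam k powr a * (\<kappa> k / (2 ^ j + \<kappa> k) * g k)))"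
      unfolding sum_distrib_left[symmetric] by (subst sum.swap) (simp add: sum_distrib_left)
    also have "\<dots> \<le> 4 * (\<Sum>j<J. (2 ^ j) powr \<theta> * (M\<^sup>2 * (\<Sum>\<^sub>\<infinity>k. lam k powr a * (\<kappa> k / (2 ^ j + \<kappa> k) * f k))))"
      by (intro mult_left_mono sum_mono K) auto
    also have "\<dots> = 4 * M\<^sup>2 * (\<Sum>j<J. (2 ^ j) powr \<theta> * (\<Sum>\<^sub>\<infinity>k. lam k powr a * (\<kappa> k / (2 ^ j + \<kappa> k) * f k)))"
      by (simp add: sum_distrib_left mult_ac)
    also have "\<dots> \<le> 4 * M\<^sup>2 * (D * (Hs_norm \<sigma> u)\<^sup>2)"
    proof (rule mult_left_mono)
      have sK: "(\<lambda>k. lam k powr a * (\<kappa> k / (2 ^ j + \<kappa> k) * f k)) summable_on UNIV" for j :: nat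
        by (rule cmp) (use \<kappa>0 in \<open>auto simp: divide_simps add_pos_pos less_imp_le\<close>)
      have "((\<lambda>k. \<Sum>j<J. (2 ^ j) powr \<theta> * (lam k powr a * (\<kappa> k / (2 ^ j + \<kappa> k) * f k))) has_sum
          (\<Sum>j<J. (2 ^ j) powr \<theta> * (\<Sum>\<^sub>\<infinity>k. lam k powr a * (\<kappa> k / (2 ^ j + \<kappa> k) * f k)))) UNIV"
        by (intro has_sum_finite_sum has_sum_cmult_right has_sum_infsum sK) auto
      moreover have "((\<lambda>k. D * (lam k powr \<sigma> * f k)) has_sum (D * (Hs_norm \<sigma> u)\<^sup>2)) UNIV"
        unfolding Hs_norm_square f_def[symmetric] by (intro has_sum_cmult_right has_sum_infsum sa)
      moreover have "(\<Sum>j<J. (2 ^ j) powr \<theta> * (lam k powr a * (\<kappa> k / (2 ^ j + \<kappa> k) * f k))) \<le> D * (lam k powr \<sigma> * f k)" for k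
      proof -
        have "(\<Sum>j<J. (2 ^ j) powr \<theta> * (lam k powr a * (\<kappa> k / (2 ^ j + \<kappa> k) * f k))) = lam k powr a * (dyadic_sum \<theta> J (\<kappa> k) * f k)"
          unfolding ds sum_distrib_left by (simp add: mult_ac)
        also have "\<dots> \<le> lam k powr a * ((D * \<kappa> k powr \<theta>) * f k)"
          unfolding D_def by (intro mult_left_mono mult_right_mono dyadic_sum_upper \<theta> \<kappa> f0) auto
        finally show ?thesis by (simp add: lam_\<sigma> mult_ac)
      qed
      ultimately show "(\<Sum>j<J. (2 ^ j) powr \<theta> * (\<Sum>\<^sub>\<infinity>k. lam k powr a * (\<kappa> k / (2 ^ j + \<kappa> k) * f k))) \<le> D * (Hs_norm \<sigma> u)\<^sup>2"
        by (rule has_sum_mono)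
    qed auto
    finally show ?thesis by (simp add: g_def mult_ac)
  qed
  define C where "C = sqrt (4 * M\<^sup>2 * D)"
  have C2: "4 * M\<^sup>2 * D * y\<^sup>2 = (C * y)\<^sup>2" for y using D by (simp add: C_def power_mult_distrib)
  have C: "C \<ge> 0" using D by (simp add: C_def)
  show thesis
  proof (rule that[OF C])
    fix u assume u: "Hs \<sigma> u"
    have "cper (T u)" using Ta[OF u] Hs_cper by blast
    from HsI[OF this _ main[OF u, unfolded C2]] C
    show "Hs \<sigma> (T u) \<and> Hs_norm \<sigma> (T u) \<le> C * Hs_norm \<sigma> u" by simp
  qed
qed

subsection \<open>Composition with the inverse of a diffeomorphism near the identity\<close>

text \<open>That 1/eta' lies in H^(s-1) is an assumption here because it will be read off from the
  Neumann series. The pointwise bound keeps eta' between 1/2 and 2, which makes the L^2 and H^1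
  constants below explicit.\<close>

locale near_id =
  fixes s :: real and z :: "real \<Rightarrow> real"
  assumes s: "s > 3/2" and z: "Hs s z" and dz: "\<And>x. \<bar>deriv z x\<bar> \<le> 1/2"
    and q: "Hs (s - 1) (\<lambda>x. 1 / (1 + deriv z x))"
begin

definition eta :: "real \<Rightarrow> real" where "eta x = x + z x"
definition xi :: "real \<Rightarrow> real" where "xi = inv eta"
abbreviation eta' :: "real \<Rightarrow> real" where "eta' x \<equiv> 1 + deriv z x"
abbreviation qq :: "real \<Rightarrow> real" where "qq \<equiv> (\<lambda>x. 1 / eta' x)"

lemma eta'_bounds: "eta' x \<ge> 1/2" "eta' x \<le> 2"
  using dz[of x] by (auto simp: abs_le_iff)

lemma eta'_pos: "eta' x > 0" using eta'_bounds(1)[of x] by linarith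

lemma qq_bounds: "qq x \<ge> 0" "qq x \<le> 2"
  using eta'_bounds(1)[of x] by (auto simp: divide_simps)

lemma z_deriv: "(z has_real_derivative deriv z x) (at x)"
  by (rule Hs_deriv(1)[OF s z])

lemma eta_deriv: "(eta has_real_derivative eta' x) (at x)"
  unfolding eta_def[abs_def] by (auto intro!: derivative_eq_intros z_deriv)

lemma cper_z: "cper z" and cper_dz: "cper (deriv z)" and cper_qq: "cper qq"
  using Hs_cper z q Hs_deriv(2)[OF s z] by blast+

lemma cper_eta': "cper eta'"
  by (intro cper_add cper_const cper_dz)

lemma eta_shift: "eta (x + 1) = eta x + 1"
  by (simp add: eta_def cper_periodic[OF cper_z])

lemma eta_strict_mono: "strict_mono eta"
proof (rule strict_monoI)
  fix x y :: real assume "x < y"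
  then show "eta x < eta y"
    by (rule DERIV_pos_imp_increasing) (use eta_deriv eta'_pos in blast)
qed

text \<open>\<open>z\<close> is a 1/2-Lipschitz perturbation of the identity; the inverse is thus
  2-Lipschitz, which gives the continuity needed by the inverse function rule.\<close>

lemma eta_expands: "\<bar>x - y\<bar> \<le> 2 * \<bar>eta x - eta y\<bar>"
proof -
  have "\<bar>z x - z y\<bar> \<le> 1/2 * \<bar>x - y\<bar>"
    using field_differentiable_bound[of UNIV z "deriv z" "1/2" x y] z_deriv dz by simp
  moreover have "x - y = (eta x - eta y) - (z x - z y)" by (simp add: eta_def)
  then have "\<bar>x - y\<bar> \<le> \<bar>eta x - eta y\<bar> + \<bar>z x - z y\<bar>" by (metis abs_triangle_ineq4)
  moreover have "a \<le> b + c \<Longrightarrow> c \<le> 1/2 * a \<Longrightarrow> a \<le> 2 * b" for a b c :: real by linarith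
  ultimately show ?thesis by blast
qed

lemma eta_surj: "surj eta"
proof -
  have "\<exists>x. eta x = y" for y
  proof -
    let ?m = "sobolev_const s * Hs_norm s z"
    have m: "\<bar>z x\<bar> \<le> ?m" for x by (rule Hs_sup_bound) (use s z in auto)
    have "\<exists>x. y - ?m \<le> x \<and> x \<le> y + ?m \<and> eta x = y"
    proof (rule IVT')
      show "eta (y - ?m) \<le> y" "y \<le> eta (y + ?m)" "y - ?m \<le> y + ?m"
        using m[of "y - ?m"] m[of "y + ?m"] by (auto simp: eta_def)
      show "continuous_on {y - ?m..y + ?m} eta"
        using eta_deriv DERIV_isCont continuous_at_imp_continuous_on by blast
    qed
    then show ?thesis by blast
  qed
  then show ?thesis unfolding surj_def by metis
qed

lemma eta_bij: "bij eta"
  using eta_surj eta_strict_mono strict_mono_imp_inj_on by (simp add: bij_def)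

lemma eta_xi [simp]: "eta (xi y) = y"
  unfolding xi_def by (rule surj_f_inv_f[OF eta_surj])

lemma xi_eta [simp]: "xi (eta x) = x"
  unfolding xi_def by (rule inv_f_f[OF bij_is_inj[OF eta_bij]])

lemma xi_shift: "xi (y + 1) = xi y + 1"
  using eta_shift[of "xi y"] xi_eta[of "xi y + 1"] by simp

lemma xi_cont: "isCont xi y"
proof -
  have "2-lipschitz_on UNIV xi"
    by (intro lipschitz_onI) (use eta_expands[of "xi _" "xi _"] in \<open>auto simp: dist_real_def\<close>)
  then show ?thesis
    using lipschitz_on_continuous_on continuous_on_eq_continuous_at by blast
qed

lemma xi_deriv: "(xi has_real_derivative qq (xi y)) (at y)"
proof -
  have "(xi has_real_derivative inverse (eta' (xi y))) (at y)"
    by (rule DERIV_inverse_function[where f = eta and g = xi and a = "y - 1" and b = "y + 1", OF eta_deriv])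
       (use eta'_pos[of "xi y"] xi_cont in auto)
  then show ?thesis by (simp add: inverse_eq_divide)
qed

lemma cper_comp:
  assumes \<phi>: "cper \<phi>"
  shows "cper (\<lambda>y. \<phi> (xi y))"
proof -
  have "continuous_on UNIV xi" by (intro continuous_at_imp_continuous_on ballI xi_cont)
  then have "continuous_on UNIV (\<lambda>y. \<phi> (xi y))"
    by (rule continuous_on_compose2[OF cper_cont[OF \<phi>, of UNIV]]) simp
  moreover have "\<phi> (xi (x + 1)) = \<phi> (xi x)" for x by (simp add: xi_shift cper_periodic[OF \<phi>])
  ultimately show ?thesis by (simp add: cper_def periodic1_def)
qed

text \<open>The map \<open>eta\<close> sends [0,1] to a translate of the unit interval, not to
  itself. A primitive on the whole line absorbs the shift, because its increment over any period is
  the same.\<close>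

lemma change_of_variables:
  assumes "cper \<phi>"
  shows "integral {0..1} (\<lambda>y. \<phi> (xi y)) = integral {0..1} (\<lambda>x. \<phi> x * eta' x)"
proof -
  obtain A where A: "\<And>y. (A has_real_derivative \<phi> (xi y)) (at y)"
    "\<And>y. A (y + 1) = A y + integral {0..1} (\<lambda>y. \<phi> (xi y))"
    using periodic_antiderivative[OF cper_comp[OF assms]] by blast
  have "((\<lambda>x. A (eta x)) has_real_derivative \<phi> x * eta' x) (at x)" for x
    using DERIV_chain2[OF A(1)[of "eta x"] eta_deriv] by simp
  then have "((\<lambda>x. \<phi> x * eta' x) has_integral (A (eta 1) - A (eta 0))) {0..1}"
    by (intro fundamental_theorem_of_calculus)
       (auto simp: has_real_derivative_iff_has_vector_derivative intro: has_vector_derivative_at_within)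
  moreover have "A (eta 1) - A (eta 0) = integral {0..1} (\<lambda>y. \<phi> (xi y))"
    using A(2)[of "eta 0"] eta_shift[of 0] by simp
  ultimately show ?thesis by (simp add: integral_unique)
qed

lemma integral_square_comp_le:
  assumes \<phi>: "cper \<phi>"
  shows "integral {0..1} (\<lambda>y. (\<phi> (xi y))\<^sup>2) \<le> 2 * integral {0..1} (\<lambda>x. (\<phi> x)\<^sup>2)"
proof -
  have c2: "cper (\<lambda>x. (\<phi> x)\<^sup>2)" using cper_mult[OF \<phi> \<phi>] by (simp add: power2_eq_square)
  have "integral {0..1} (\<lambda>y. (\<phi> (xi y))\<^sup>2) = integral {0..1} (\<lambda>x. (\<phi> x)\<^sup>2 * eta' x)"
    by (rule change_of_variables[OF c2])
  also have "\<dots> \<le> integral {0..1} (\<lambda>x. (\<phi> x)\<^sup>2 * 2)"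
    by (intro integral_le cper_integrable cper_mult c2 cper_eta' cper_const mult_left_mono eta'_bounds) auto
  finally show ?thesis by simp
qed

section \<open>Boundedness of the composition operator, from low to high regularity\<close>

lemma comp_deriv:
  assumes "\<And>x. (\<phi> has_real_derivative \<phi>' x) (at x)"
  shows "((\<lambda>y. \<phi> (xi y)) has_real_derivative \<phi>' (xi y) * qq (xi y)) (at y)"
  by (rule DERIV_chain2[OF assms xi_deriv])

text \<open>Parseval is available for \<phi>, while for the composition only Bessel is. The two are
  linked by the change of variables with eta' <= 2, and this 2 is rounded up to its square.\<close>

lemma comp_L2_sum:
  assumes \<sigma>: "\<sigma> > 1/2" and \<phi>: "Hs \<sigma> \<phi>" and F: "finite F"
  shows "(\<Sum>k\<in>F. (cmod (fcoeff (\<lambda>y. \<phi> (xi y)) k))\<^sup>2) \<le> (2 * Hs_norm 0 \<phi>)\<^sup>2"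
proof -
  note c = Hs_cper[OF \<phi>]
  have "((\<lambda>k. (cmod (fcoeff \<phi> k))\<^sup>2) has_sum integral {0..1} (\<lambda>x. (\<phi> x)\<^sup>2)) UNIV"
    by (rule parseval[OF c Hs_abs_summable(1)[OF \<sigma> \<phi>]])
  then have P: "(Hs_norm 0 \<phi>)\<^sup>2 = integral {0..1} (\<lambda>x. (\<phi> x)\<^sup>2)"
    unfolding Hs_norm_square using infsumI by simp
  have "(\<Sum>k\<in>F. (cmod (fcoeff (\<lambda>y. \<phi> (xi y)) k))\<^sup>2) \<le> integral {0..1} (\<lambda>y. (\<phi> (xi y))\<^sup>2)"
    by (rule bessel[OF cper_comp[OF c] F])
  also have "\<dots> \<le> 2 * (Hs_norm 0 \<phi>)\<^sup>2" unfolding P by (rule integral_square_comp_le[OF c])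
  also have "\<dots> \<le> (2 * Hs_norm 0 \<phi>)\<^sup>2" by (simp add: power_mult_distrib)
  finally show ?thesis .
qed

lemma comp_H0:
  assumes "\<sigma> > 1/2" and "Hs \<sigma> \<phi>"
  shows "Hs 0 (\<lambda>y. \<phi> (xi y))" "Hs_norm 0 (\<lambda>y. \<phi> (xi y)) \<le> 2 * Hs_norm 0 \<phi>"
  using HsI[OF cper_comp[OF Hs_cper[OF assms(2)]], of "2 * Hs_norm 0 \<phi>" 0] comp_L2_sum[OF assms] by auto

text \<open>The index r > 3/2 provides a classical derivative, but the estimate involves the H^1
  norm alone, as interpolation requires. The 20 is crude: 4 + (4 pi)^2 <= 20^2.\<close>

lemma comp_H1:
  assumes r: "r > 3/2" and \<phi>: "Hs r \<phi>"
  shows "Hs 1 (\<lambda>y. \<phi> (xi y))" "Hs_norm 1 (\<lambda>y. \<phi> (xi y)) \<le> 20 * Hs_norm 1 \<phi>"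
proof -
  note c = Hs_cper[OF \<phi>] and d = Hs_deriv[OF r \<phi>]
  note dc = Hs_cper[OF d(2)]
  let ?\<psi>' = "\<lambda>y. deriv \<phi> (xi y) * qq (xi y)"
  have \<psi>'c: "cper ?\<psi>'" by (rule cper_comp[OF cper_mult[OF dc cper_qq]])
  have "((\<lambda>k. (cmod (fcoeff (deriv \<phi>) k))\<^sup>2) has_sum integral {0..1} (\<lambda>x. (deriv \<phi> x)\<^sup>2)) UNIV"
    by (rule parseval[OF dc Hs_abs_summable(1)[OF _ d(2)]]) (use r in simp)
  then have P: "(\<Sum>\<^sub>\<infinity>k. (cmod (fcoeff (deriv \<phi>) k))\<^sup>2) = integral {0..1} (\<lambda>x. (deriv \<phi> x)\<^sup>2)"
    and sP: "(\<lambda>k. (cmod (fcoeff (deriv \<phi>) k))\<^sup>2) summable_on UNIV"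
    by (auto simp: infsumI summable_on_def)
  have \<phi>1: "Hs 1 \<phi>" using Hs_mono(1)[OF \<phi>] r by simp
  have D: "integral {0..1} (\<lambda>x. (deriv \<phi> x)\<^sup>2) \<le> (2 * pi * Hs_norm 1 \<phi>)\<^sup>2"
    unfolding P[symmetric]
  proof (rule infsum_le_finite_sums[OF sP])
    fix F :: "int set" assume F: "finite F"
    have "(\<Sum>k\<in>F. (cmod (fcoeff (deriv \<phi>) k))\<^sup>2) \<le> (\<Sum>k\<in>F. (2 * pi)\<^sup>2 * wsq 1 \<phi> k)"
    proof (rule sum_mono)
      fix k
      have "(cmod (fcoeff (deriv \<phi>) k))\<^sup>2 = (2 * pi)\<^sup>2 * ((real_of_int k)\<^sup>2 * (cmod (fcoeff \<phi> k))\<^sup>2)"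
        by (simp add: d(4) norm_mult power_mult_distrib)
      also have "\<dots> \<le> (2 * pi)\<^sup>2 * (lam k * (cmod (fcoeff \<phi> k))\<^sup>2)"
        by (intro mult_left_mono mult_right_mono) (auto simp: lam_def)
      finally show "(cmod (fcoeff (deriv \<phi>) k))\<^sup>2 \<le> (2 * pi)\<^sup>2 * wsq 1 \<phi> k" by simp
    qed
    also have "\<dots> \<le> (2 * pi)\<^sup>2 * (Hs_norm 1 \<phi>)\<^sup>2"
      unfolding sum_distrib_left[symmetric] by (intro mult_left_mono Hs_sum_le[OF \<phi>1 F]) auto
    finally show "(\<Sum>k\<in>F. (cmod (fcoeff (deriv \<phi>) k))\<^sup>2) \<le> (2 * pi * Hs_norm 1 \<phi>)\<^sup>2"
      by (simp add: power_mult_distrib)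
  qed
  have I: "integral {0..1} (\<lambda>y. (?\<psi>' y)\<^sup>2) \<le> (4 * pi * Hs_norm 1 \<phi>)\<^sup>2"
  proof -
    have "integral {0..1} (\<lambda>y. (?\<psi>' y)\<^sup>2) = integral {0..1} (\<lambda>x. (deriv \<phi> x * qq x)\<^sup>2 * eta' x)"
      using cper_mult[OF cper_mult[OF dc cper_qq] cper_mult[OF dc cper_qq]]
      by (intro change_of_variables) (simp add: power2_eq_square)
    \<comment> \<open>One of the two factors 1/eta' cancels against the Jacobian, so a single
      pointwise bound by 2 remains.\<close>
    also have "(\<lambda>x. (deriv \<phi> x * qq x)\<^sup>2 * eta' x) = (\<lambda>x. (deriv \<phi> x * deriv \<phi> x) * qq x)"
    proof
      fix x
      have "eta' x \<noteq> 0" using eta'_pos[of x] by simp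
      then show "(deriv \<phi> x * qq x)\<^sup>2 * eta' x = (deriv \<phi> x * deriv \<phi> x) * qq x"
        by (simp add: power2_eq_square)
    qed
    also have "integral {0..1} \<dots> \<le> integral {0..1} (\<lambda>x. (deriv \<phi> x * deriv \<phi> x) * 2)"
      by (intro integral_le cper_integrable cper_mult dc cper_qq cper_const mult_left_mono qq_bounds) auto
    also have "\<dots> = integral {0..1} (\<lambda>x. (deriv \<phi> x)\<^sup>2) * 2" by (simp add: power2_eq_square)
    also have "\<dots> \<le> (2 * pi * Hs_norm 1 \<phi>)\<^sup>2 * 2" using D by (intro mult_right_mono) auto
    also have "\<dots> \<le> (4 * pi * Hs_norm 1 \<phi>)\<^sup>2" by (simp add: power_mult_distrib)
    finally show ?thesis .
  qed
  \<comment> \<open>The weight has exponent 1 - 1 = 0, so the hypothesis of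
    \<open>Hs_of_deriv\<close> is just Bessel's inequality for the derivative.\<close>
  have B: "(\<Sum>k\<in>F. wsq (1 - 1) ?\<psi>' k) \<le> (4 * pi * Hs_norm 1 \<phi>)\<^sup>2" if "finite F" for F
    using bessel[OF \<psi>'c that] I by simp
  note H = Hs_of_deriv[OF cper_comp[OF c] comp_deriv[OF d(1)] \<psi>'c B]
  show "Hs 1 (\<lambda>y. \<phi> (xi y))" by (rule H(1))
  have "(integral {0..1} (\<lambda>y. \<phi> (xi y)))\<^sup>2 = (\<Sum>k\<in>{0}. (cmod (fcoeff (\<lambda>y. \<phi> (xi y)) k))\<^sup>2)"
    by (simp add: fcoeff_0_index cper_comp c)
  also have "\<dots> \<le> (2 * Hs_norm 0 \<phi>)\<^sup>2"
    by (rule comp_L2_sum[OF _ \<phi>]) (use r in auto)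
  also have "\<dots> \<le> (2 * Hs_norm 1 \<phi>)\<^sup>2"
    using Hs_mono(2)[OF \<phi>1, of 0] by (intro power_mono) auto
  finally have "(Hs_norm 1 (\<lambda>y. \<phi> (xi y)))\<^sup>2 \<le> (2 * Hs_norm 1 \<phi>)\<^sup>2 + (4 * pi * Hs_norm 1 \<phi>)\<^sup>2"
    using H(2) by linarith
  also have "\<dots> = (4 + (4 * pi)\<^sup>2) * (Hs_norm 1 \<phi>)\<^sup>2" by (simp add: power_mult_distrib algebra_simps)
  also have "\<dots> \<le> 20\<^sup>2 * (Hs_norm 1 \<phi>)\<^sup>2"
  proof (rule mult_right_mono)
    have "(4 * pi)\<^sup>2 \<le> (4 * 4)\<^sup>2" using pi_less_4 by (intro power_mono mult_left_mono) auto
    then show "4 + (4 * pi)\<^sup>2 \<le> 20\<^sup>2" by simp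
  qed simp
  finally have "(Hs_norm 1 (\<lambda>y. \<phi> (xi y)))\<^sup>2 \<le> (20 * Hs_norm 1 \<phi>)\<^sup>2" by (simp add: power_mult_distrib)
  then show "Hs_norm 1 (\<lambda>y. \<phi> (xi y)) \<le> 20 * Hs_norm 1 \<phi>" by (rule power2_le_imp_le) simp
qed

definition comp_bounded :: "real \<Rightarrow> bool" where
  "comp_bounded \<sigma> \<longleftrightarrow> (\<exists>C\<ge>0. \<forall>\<phi>. Hs \<sigma> \<phi> \<longrightarrow>
     Hs \<sigma> (\<lambda>y. \<phi> (xi y)) \<and> Hs_norm \<sigma> (\<lambda>y. \<phi> (xi y)) \<le> C * Hs_norm \<sigma> \<phi>)"

text \<open>Interpolation between L^2 and H^1. The endpoint H^1 is only tested on functions of index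
  \<sigma> + 2, which exceeds 3/2, so \<open>comp_H1\<close> applies.\<close>

lemma comp_bounded_low:
  assumes "1/2 < \<sigma>" "\<sigma> < 1"
  shows "comp_bounded \<sigma>"
proof -
  obtain C where "C \<ge> 0" "\<And>u. Hs \<sigma> u \<Longrightarrow> Hs \<sigma> (\<lambda>y. u (xi y)) \<and> Hs_norm \<sigma> (\<lambda>y. u (xi y)) \<le> C * Hs_norm \<sigma> u"
  proof (rule Hs_interpolation[of 0 \<sigma> 1 "\<lambda>u y. u (xi y)" 20])
    fix u assume u: "Hs \<sigma> u"
    have "Hs_norm 0 (\<lambda>y. u (xi y)) \<le> 2 * Hs_norm 0 u" by (rule comp_H0(2)[OF assms(1) u])
    also have "\<dots> \<le> 20 * Hs_norm 0 u" by (intro mult_right_mono) auto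
    finally show "Hs 0 (\<lambda>y. u (xi y)) \<and> Hs_norm 0 (\<lambda>y. u (xi y)) \<le> 20 * Hs_norm 0 u"
      using comp_H0(1)[OF assms(1) u] by simp
  next
    fix u assume "Hs (\<sigma> + 2 * (1 - 0)) u"
    then show "Hs 1 (\<lambda>y. u (xi y)) \<and> Hs_norm 1 (\<lambda>y. u (xi y)) \<le> 20 * Hs_norm 1 u"
      using comp_H1[of "\<sigma> + 2 * (1 - 0)" u] assms by auto
  qed (use assms in auto)
  then show ?thesis unfolding comp_bounded_def by blast
qed

lemma comp_bounded_interpolate:
  assumes "comp_bounded a" "comp_bounded b" "a < \<sigma>" "\<sigma> < b" "1/2 < \<sigma>"
  shows "comp_bounded \<sigma>"
proof -
  obtain A where A: "A \<ge> 0" "\<And>\<phi>. Hs a \<phi> \<Longrightarrow> Hs a (\<lambda>y. \<phi> (xi y)) \<and> Hs_norm a (\<lambda>y. \<phi> (xi y)) \<le> A * Hs_norm a \<phi>"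
    using assms(1) unfolding comp_bounded_def by blast
  obtain B where B: "B \<ge> 0" "\<And>\<phi>. Hs b \<phi> \<Longrightarrow> Hs b (\<lambda>y. \<phi> (xi y)) \<and> Hs_norm b (\<lambda>y. \<phi> (xi y)) \<le> B * Hs_norm b \<phi>"
    using assms(2) unfolding comp_bounded_def by blast
  obtain C where "C \<ge> 0" "\<And>u. Hs \<sigma> u \<Longrightarrow> Hs \<sigma> (\<lambda>y. u (xi y)) \<and> Hs_norm \<sigma> (\<lambda>y. u (xi y)) \<le> C * Hs_norm \<sigma> u"
  proof (rule Hs_interpolation[of a \<sigma> b "\<lambda>u y. u (xi y)" "max A B"])
    fix u assume u: "Hs \<sigma> u"
    have "A * Hs_norm a u \<le> max A B * Hs_norm a u" by (intro mult_right_mono) auto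
    then show "Hs a (\<lambda>y. u (xi y)) \<and> Hs_norm a (\<lambda>y. u (xi y)) \<le> max A B * Hs_norm a u"
      using A(2)[OF Hs_mono(1)[OF u less_imp_le[OF assms(3)]]] by linarith
  next
    fix u assume "Hs (\<sigma> + 2 * (b - a)) u"
    then have "Hs b u" by (rule Hs_mono(1)) (use assms in auto)
    moreover have "B * Hs_norm b u \<le> max A B * Hs_norm b u" by (intro mult_right_mono) auto
    ultimately show "Hs b (\<lambda>y. u (xi y)) \<and> Hs_norm b (\<lambda>y. u (xi y)) \<le> max A B * Hs_norm b u"
      using B(2)[of u] by linarith
  qed (use assms in auto)
  then show ?thesis unfolding comp_bounded_def by blast
qed

text \<open>The derivative of \<phi> o xi is (\<phi>' / eta') o xi. The product stays in the algebra
  H^(\<sigma>-1), where composition is already bounded; \<open>Q\<close> controls this derivative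
  and the Sobolev constant controls the mean.\<close>

lemma comp_bounded_step:
  assumes "comp_bounded (\<sigma> - 1)" "3/2 < \<sigma>" "\<sigma> \<le> s"
  shows "comp_bounded \<sigma>"
proof -
  obtain C where C: "C \<ge> 0" "\<And>\<phi>. Hs (\<sigma> - 1) \<phi> \<Longrightarrow> Hs (\<sigma> - 1) (\<lambda>y. \<phi> (xi y)) \<and> Hs_norm (\<sigma> - 1) (\<lambda>y. \<phi> (xi y)) \<le> C * Hs_norm (\<sigma> - 1) \<phi>"
    using assms(1) unfolding comp_bounded_def by blast
  have q': "Hs (\<sigma> - 1) qq" by (rule Hs_mono(1)[OF q]) (use assms in auto)
  have \<sigma>1: "\<sigma> - 1 > 1/2" "\<sigma> > 1/2" using assms by auto
  define Q where "Q = C * (algebra_const (\<sigma> - 1) * (2 * pi) * Hs_norm (\<sigma> - 1) qq)"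
  have Q: "Q \<ge> 0" using C by (simp add: Q_def algebra_const_nonneg)
  let ?S = "sobolev_const \<sigma>"
  have "Hs \<sigma> (\<lambda>y. \<phi> (xi y)) \<and> Hs_norm \<sigma> (\<lambda>y. \<phi> (xi y)) \<le> (?S + Q) * Hs_norm \<sigma> \<phi>" if \<phi>: "Hs \<sigma> \<phi>" for \<phi>
  proof -
    note c = Hs_cper[OF \<phi>] and d = Hs_deriv[OF assms(2) \<phi>]
    note m = Hs_mult[OF \<sigma>1(1) d(2) q']
    let ?\<psi>' = "\<lambda>y. deriv \<phi> (xi y) * qq (xi y)"
    have H: "Hs (\<sigma> - 1) ?\<psi>'" "Hs_norm (\<sigma> - 1) ?\<psi>' \<le> Q * Hs_norm \<sigma> \<phi>"
    proof -
      show "Hs (\<sigma> - 1) ?\<psi>'" using C(2)[OF m(1)] by simp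
      have "Hs_norm (\<sigma> - 1) ?\<psi>' \<le> C * Hs_norm (\<sigma> - 1) (\<lambda>x. deriv \<phi> x * qq x)"
        using C(2)[OF m(1)] by simp
      also have "\<dots> \<le> C * (algebra_const (\<sigma> - 1) * Hs_norm (\<sigma> - 1) (deriv \<phi>) * Hs_norm (\<sigma> - 1) qq)"
        by (intro mult_left_mono m(2) C(1))
      also have "\<dots> \<le> C * (algebra_const (\<sigma> - 1) * (2 * pi * Hs_norm \<sigma> \<phi>) * Hs_norm (\<sigma> - 1) qq)"
        by (intro mult_left_mono mult_right_mono d(3) C(1) algebra_const_nonneg) auto
      finally show "Hs_norm (\<sigma> - 1) ?\<psi>' \<le> Q * Hs_norm \<sigma> \<phi>" by (simp add: Q_def mult_ac)
    qed
    have B: "(\<Sum>k\<in>F. wsq (\<sigma> - 1) ?\<psi>' k) \<le> (Q * Hs_norm \<sigma> \<phi>)\<^sup>2" if "finite F" for F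
      using Hs_sum_le[OF H(1) that] power_mono[OF H(2) Hs_norm_nonneg, of 2] by linarith
    note K = Hs_of_deriv[OF cper_comp[OF c] comp_deriv[OF d(1)] Hs_cper[OF H(1)] B]
    have "\<bar>integral {0..1} (\<lambda>y. \<phi> (xi y))\<bar> \<le> ?S * Hs_norm \<sigma> \<phi>"
    proof -
      have "norm (integral {0..1} (\<lambda>y. \<phi> (xi y))) \<le> (?S * Hs_norm \<sigma> \<phi>) * (1 - 0)"
        by (rule integral_bound) (auto intro!: cper_cont cper_comp c Hs_sup_bound \<sigma>1 \<phi>)
      then show ?thesis by simp
    qed
    then have "(integral {0..1} (\<lambda>y. \<phi> (xi y)))\<^sup>2 \<le> (?S * Hs_norm \<sigma> \<phi>)\<^sup>2"
      using abs_le_square_iff[of "integral {0..1} (\<lambda>y. \<phi> (xi y))" "?S * Hs_norm \<sigma> \<phi>"] by linarith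
    then have "(Hs_norm \<sigma> (\<lambda>y. \<phi> (xi y)))\<^sup>2 \<le> (?S * Hs_norm \<sigma> \<phi>)\<^sup>2 + (Q * Hs_norm \<sigma> \<phi>)\<^sup>2"
      using K(2) by linarith
    also have "\<dots> \<le> (?S * Hs_norm \<sigma> \<phi> + Q * Hs_norm \<sigma> \<phi>)\<^sup>2"
      unfolding power2_sum using Q sobolev_const_nonneg by simp
    finally have "(Hs_norm \<sigma> (\<lambda>y. \<phi> (xi y)))\<^sup>2 \<le> ((?S + Q) * Hs_norm \<sigma> \<phi>)\<^sup>2" by (simp add: algebra_simps)
    then have "Hs_norm \<sigma> (\<lambda>y. \<phi> (xi y)) \<le> (?S + Q) * Hs_norm \<sigma> \<phi>"
      by (rule power2_le_imp_le) (use Q sobolev_const_nonneg in simp)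
    with K(1) show ?thesis by simp
  qed
  then show ?thesis
    unfolding comp_bounded_def using Q sobolev_const_nonneg by (intro exI[of _ "?S + Q"]) auto
qed

text \<open>One step upwards needs \<sigma> > 3/2, so from indices below 1 it cannot land in
  [1, 3/2]. That gap is filled by interpolating between 3/4 and an index slightly above 3/2;
  afterwards induction on the number of unit steps reaches every index up to
  \<open>s\<close>.\<close>

lemma comp_bounded_all:
  assumes "1/2 < \<sigma>" "\<sigma> \<le> s"
  shows "comp_bounded \<sigma>"
proof -
  have base: "comp_bounded \<sigma>" if "1/2 < \<sigma>" "\<sigma> \<le> 3/2" for \<sigma>
  proof (cases "\<sigma> < 1")
    case True
    then show ?thesis using comp_bounded_low that by simp
  next
    case False
    \<comment> \<open>Any index in (3/2, 2) not exceeding \<open>s\<close> would do: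
      \<open>b - 1\<close> then lies in (1/2, 1), where the low range applies, and one step leads to
      \<open>b\<close>.\<close>
    define b where "b = min s (7/4)"
    have b: "3/2 < b" "b \<le> s" "b < 2" using s by (auto simp: b_def)
    have "comp_bounded (b - 1)" by (rule comp_bounded_low) (use b in auto)
    then have "comp_bounded b" by (rule comp_bounded_step) (use b in auto)
    moreover have "comp_bounded (3/4)" by (rule comp_bounded_low) auto
    ultimately show ?thesis
      using comp_bounded_interpolate[of "3/4" b \<sigma>] b False that by simp
  qed
  have ind: "\<sigma> \<le> 3/2 + real n \<Longrightarrow> 1/2 < \<sigma> \<Longrightarrow> \<sigma> \<le> s \<Longrightarrow> comp_bounded \<sigma>" for n
  proof (induction n arbitrary: \<sigma>)
    case 0
    then show ?case using base by simp
  next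
    case (Suc n)
    show ?case
    proof (cases "\<sigma> \<le> 3/2")
      case True
      then show ?thesis using base Suc.prems by simp
    next
      case False
      have "comp_bounded (\<sigma> - 1)" by (rule Suc.IH) (use Suc.prems False in auto)
      then show ?thesis by (rule comp_bounded_step) (use Suc.prems False in auto)
    qed
  qed
  obtain n :: nat where "\<sigma> - 3/2 \<le> real n" using real_arch_simple by blast
  then show ?thesis using assms by (intro ind[of n]) auto
qed

theorem Hs_comp_xi: "Hs s \<phi> \<Longrightarrow> Hs s (\<lambda>y. \<phi> (xi y))"
  using comp_bounded_all[of s] s unfolding comp_bounded_def by auto

end

subsection \<open>The weak formulation\<close>

lemma periodic1_deriv:
  assumes "periodic1 \<phi>" "\<And>x. (\<phi> has_real_derivative \<phi>' x) (at x)"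
  shows "periodic1 \<phi>'"
proof -
  have "\<phi>' (x + 1) = \<phi>' x" for x
  proof -
    have "((\<lambda>x. \<phi> (x + 1)) has_real_derivative \<phi>' (x + 1)) (at x)"
      using DERIV_shift[of \<phi> "\<phi>' (x + 1)" x 1] assms(2) by simp
    moreover have "(\<lambda>x. \<phi> (x + 1)) = \<phi>" using assms(1) by (auto simp: periodic1_def)
    ultimately show ?thesis using assms(2) DERIV_unique by metis
  qed
  then show ?thesis by (simp add: periodic1_def)
qed

lemma smooth_periodicD:
  assumes "smooth_periodic \<phi>"
  shows "cper \<phi>" "cper (deriv \<phi>)" "cper (deriv (deriv \<phi>))"
    "(\<phi> has_real_derivative deriv \<phi> x) (at x)" "(deriv \<phi> has_real_derivative deriv (deriv \<phi>) x) (at x)"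
proof -
  have d: "((deriv ^^ n) \<phi>) differentiable (at x)" for n x using assms by (simp add: smooth_periodic_def)
  have D: "(((deriv ^^ n) \<phi>) has_real_derivative ((deriv ^^ Suc n) \<phi>) x) (at x)" for n x
    using d[of n x] by (simp add: DERIV_deriv_iff_real_differentiable)
  have P: "periodic1 ((deriv ^^ n) \<phi>)" for n
  proof (induction n)
    case 0
    then show ?case using assms by (simp add: smooth_periodic_def)
  next
    case (Suc n)
    show ?case by (rule periodic1_deriv[OF Suc.IH D])
  qed
  have C: "cper ((deriv ^^ n) \<phi>)" for n by (rule cper_differentiable[OF D P])
  show "cper \<phi>" "cper (deriv \<phi>)" "cper (deriv (deriv \<phi>))"
    using C[of 0] C[of 1] C[of 2] by (auto simp: numeral_2_eq_2)
  show "(\<phi> has_real_derivative deriv \<phi> x) (at x)" "(deriv \<phi> has_real_derivative deriv (deriv \<phi>) x) (at x)"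
    using D[of 0 x] D[of 1 x] by auto
qed

lemma deriv_trig:
  "deriv (\<lambda>x. a * cos (c * x) + b * sin (c * x)) = (\<lambda>x. (b * c) * cos (c * x) + (- a * c) * sin (c * x))"
  by (rule ext, rule DERIV_imp_deriv) (auto intro!: derivative_eq_intros)

lemma smooth_periodic_trig:
  assumes "c = 2 * pi * real_of_int k"
  shows "smooth_periodic (\<lambda>x. a * cos (c * x) + b * sin (c * x))"
proof -
  have ex: "\<exists>a' b'. (deriv ^^ n) (\<lambda>x. a * cos (c * x) + b * sin (c * x)) = (\<lambda>x. a' * cos (c * x) + b' * sin (c * x))" for n
  proof (induction n)
    case (Suc n)
    then obtain a' b' where "(deriv ^^ n) (\<lambda>x. a * cos (c * x) + b * sin (c * x)) = (\<lambda>x. a' * cos (c * x) + b' * sin (c * x))"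
      by blast
    then have "(deriv ^^ Suc n) (\<lambda>x. a * cos (c * x) + b * sin (c * x)) =
        (\<lambda>x. (b' * c) * cos (c * x) + (- a' * c) * sin (c * x))"
      by (simp only: funpow.simps o_apply deriv_trig)
    then show ?case by blast
  qed auto
  have "((deriv ^^ n) (\<lambda>x. a * cos (c * x) + b * sin (c * x))) differentiable (at x)" for n x
  proof -
    obtain a' b' where ab: "(deriv ^^ n) (\<lambda>x. a * cos (c * x) + b * sin (c * x)) = (\<lambda>x. a' * cos (c * x) + b' * sin (c * x))"
      using ex by blast
    have "((\<lambda>x. a' * cos (c * x) + b' * sin (c * x)) has_real_derivative ((b' * c) * cos (c * x) + (- a' * c) * sin (c * x))) (at x)"
      by (auto intro!: derivative_eq_intros)
    then show ?thesis unfolding ab using real_differentiable_def by blast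
  qed
  moreover have "cos (c * x) = Re (ek k x)" "sin (c * x) = Im (ek k x)" for x
    by (simp_all add: ek_def assms)
  then have "periodic1 (\<lambda>x. a * cos (c * x) + b * sin (c * x))"
    unfolding periodic1_def by simp
  ultimately show ?thesis by (simp add: smooth_periodic_def)
qed

definition weak_sol :: "(real \<Rightarrow> real) \<Rightarrow> (real \<Rightarrow> real) \<Rightarrow> bool" where
  "weak_sol h v \<longleftrightarrow> (\<forall>\<phi>. smooth_periodic \<phi> \<longrightarrow>
       mu v * mu \<phi> - integral {0..1} (\<lambda>x. v x * deriv (deriv \<phi>) x)
       = - integral {0..1} (\<lambda>x. h x * deriv \<phi> x))"

text \<open>Cosines and sines are eigenfunctions of the second derivative, so as test functions they
  isolate one frequency of \<open>v\<close>. The right side stays unevaluated since it is only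
  compared between two solutions with the same \<open>h\<close>.\<close>

lemma weak_sol_trig:
  assumes v: "cper v" "weak_sol h v"
  shows "mu v * mu (\<lambda>x. a * cos (2 * pi * of_int k * x) + b * sin (2 * pi * of_int k * x))
      + (2 * pi * of_int k)\<^sup>2 * (a * integral {0..1} (\<lambda>x. v x * cos (2 * pi * of_int k * x))
        + b * integral {0..1} (\<lambda>x. v x * sin (2 * pi * of_int k * x)))
    = - integral {0..1} (\<lambda>x. h x * deriv (\<lambda>x. a * cos (2 * pi * of_int k * x) + b * sin (2 * pi * of_int k * x)) x)"
proof -
  define c where "c = 2 * pi * real_of_int k"
  let ?\<phi> = "\<lambda>x. a * cos (c * x) + b * sin (c * x)"
  note vc = cper_cont[OF v(1)]
  have dd: "deriv (deriv ?\<phi>) = (\<lambda>x. - (c\<^sup>2) * ?\<phi> x)"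
    unfolding deriv_trig by (rule ext) (simp add: algebra_simps power2_eq_square)
  have "integral {0..1} (\<lambda>x. v x * deriv (deriv ?\<phi>) x) =
      integral {0..1} (\<lambda>x. (- (c\<^sup>2) * a) * (v x * cos (c * x)) + (- (c\<^sup>2) * b) * (v x * sin (c * x)))"
    unfolding dd by (simp add: algebra_simps)
  also have "\<dots> = integral {0..1} (\<lambda>x. (- (c\<^sup>2) * a) * (v x * cos (c * x))) + integral {0..1} (\<lambda>x. (- (c\<^sup>2) * b) * (v x * sin (c * x)))"
    by (intro integral_add integrable_continuous_real continuous_intros vc)
  also have "\<dots> = (- (c\<^sup>2) * a) * integral {0..1} (\<lambda>x. v x * cos (c * x)) + (- (c\<^sup>2) * b) * integral {0..1} (\<lambda>x. v x * sin (c * x))"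
    by (simp only: integral_mult_right)
  finally have "mu v * mu ?\<phi> + c\<^sup>2 * (a * integral {0..1} (\<lambda>x. v x * cos (c * x)) + b * integral {0..1} (\<lambda>x. v x * sin (c * x))) =
      mu v * mu ?\<phi> - integral {0..1} (\<lambda>x. v x * deriv (deriv ?\<phi>) x)"
    by (simp add: algebra_simps)
  also have "\<dots> = - integral {0..1} (\<lambda>x. h x * deriv ?\<phi> x)"
    using v(2) smooth_periodic_trig[OF c_def] unfolding weak_sol_def by blast
  finally show ?thesis by (simp add: c_def)
qed

lemma fcoeff_trig:
  assumes "cper v"
  shows "fcoeff v k = of_real (integral {0..1} (\<lambda>x. v x * cos (2 * pi * of_int k * x)))
    - \<i> * of_real (integral {0..1} (\<lambda>x. v x * sin (2 * pi * of_int k * x)))"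
proof -
  note vc = cper_cont[OF assms]
  have e: "ek (- k) x = of_real (cos (2 * pi * of_int k * x)) - \<i> * of_real (sin (2 * pi * of_int k * x))" for x
    by (simp add: ek_def complex_eq_iff)
  have "fcoeff v k = integral {0..1} (\<lambda>x. complex_of_real (v x * cos (2 * pi * of_int k * x)) - \<i> * complex_of_real (v x * sin (2 * pi * of_int k * x)))"
    unfolding fcoeff_eq_cfc cfc_def e by (simp add: right_diff_distrib mult_ac)
  also have "\<dots> = integral {0..1} (\<lambda>x. complex_of_real (v x * cos (2 * pi * of_int k * x))) - integral {0..1} (\<lambda>x. \<i> * complex_of_real (v x * sin (2 * pi * of_int k * x)))"
    by (intro integral_diff integrable_continuous_real continuous_intros vc)
  also have "\<dots> = of_real (integral {0..1} (\<lambda>x. v x * cos (2 * pi * of_int k * x))) - \<i> * of_real (integral {0..1} (\<lambda>x. v x * sin (2 * pi * of_int k * x)))"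
    unfolding integral_mult_right
    by (subst (1 2) integral_of_real) (auto intro!: integrable_continuous_real continuous_intros vc)
  finally show ?thesis .
qed

text \<open>Frequency 0 fixes the mean; for every other frequency the factor (2 pi k)^2 can be
  cancelled. This is what gives the definite description in \<open>Ainv_dx\<close> its
  value.\<close>

lemma weak_sol_unique:
  assumes "cper v1" "weak_sol h v1" "cper v2" "weak_sol h v2"
  shows "v1 = v2"
proof (rule cper_eqI[OF assms(1,3)])
  fix k :: int
  have m: "mu v1 = mu v2"
    using weak_sol_trig[OF assms(1,2), of 1 0 0] weak_sol_trig[OF assms(3,4), of 1 0 0] by (simp add: mu_def)
  show "fcoeff v1 k = fcoeff v2 k"
  proof (cases "k = 0")
    case True
    then show ?thesis using m assms(1,3) by (simp add: fcoeff_0_index mu_def)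
  next
    case False
    then have nz: "(2 * pi * real_of_int k)\<^sup>2 \<noteq> 0" by simp
    let ?I = "\<lambda>v. integral {0..1} (\<lambda>x. v x * cos (2 * pi * of_int k * x))"
    let ?J = "\<lambda>v. integral {0..1} (\<lambda>x. v x * sin (2 * pi * of_int k * x))"
    have cancel: "p = q" if "x + c * p = y" "x + c * q = y" "c \<noteq> 0" for x c p q y :: real
      using that by (metis add_left_cancel mult_left_cancel)
    have "a * ?I v1 + b * ?J v1 = a * ?I v2 + b * ?J v2" for a b
      by (rule cancel[OF weak_sol_trig[OF assms(1,2), of a k b, unfolded m] weak_sol_trig[OF assms(3,4), of a k b] nz])
    from this[of 1 0] this[of 0 1] have "?I v1 = ?I v2" "?J v1 = ?J v2" by simp_all
    then show ?thesis by (simp only: fcoeff_trig assms(1,3))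
  qed
qed

text \<open>The equation integrated once. The constant \<open>c\<close> disappears because the
  derivative of a periodic test function has integral 0, and the mean term vanishes because
  \<open>v\<close> has mean 0.\<close>

lemma weak_solI:
  assumes v: "cper v" "\<And>x. (v has_real_derivative c - h x) (at x)" "mu v = 0" and h: "cper h"
  shows "weak_sol h v"
  unfolding weak_sol_def
proof (intro allI impI)
  fix \<phi> assume "smooth_periodic \<phi>"
  note \<phi> = smooth_periodicD[OF this]
  let ?p = "deriv \<phi>" and ?pp = "deriv (deriv \<phi>)"
  have "((\<lambda>x. v x * ?p x) has_real_derivative (c - h x) * ?p x + v x * ?pp x) (at x)" for x
    using DERIV_mult[OF v(2) \<phi>(5)] by (simp add: algebra_simps)
  moreover have "periodic1 (\<lambda>x. v x * ?p x)" using cper_mult[OF v(1) \<phi>(2)] by (simp add: cper_def)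
  ultimately have "integral {0..1} (\<lambda>x. (c - h x) * ?p x + v x * ?pp x) = 0"
    by (rule integral_deriv_periodic)
  moreover have "integral {0..1} (\<lambda>x. (c - h x) * ?p x + v x * ?pp x) =
      integral {0..1} (\<lambda>x. c * ?p x - h x * ?p x) + integral {0..1} (\<lambda>x. v x * ?pp x)"
    unfolding left_diff_distrib[of c] by (intro integral_add cper_integrable cper_diff cper_mult cper_const \<phi> v h)
  moreover have "integral {0..1} (\<lambda>x. c * ?p x - h x * ?p x) = integral {0..1} (\<lambda>x. c * ?p x) - integral {0..1} (\<lambda>x. h x * ?p x)"
    by (intro integral_diff cper_integrable cper_mult cper_const \<phi> h)
  moreover have "integral {0..1} ?p = 0"
    by (rule integral_deriv_periodic[OF \<phi>(4)]) (use \<phi>(1) in \<open>simp add: cper_def\<close>)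
  ultimately show "mu v * mu \<phi> - integral {0..1} (\<lambda>x. v x * ?pp x) = - integral {0..1} (\<lambda>x. h x * ?p x)"
    using v(3) by simp
qed

lemma Ainv_dx_eq:
  assumes "Hs s v" "weak_sol h v"
  shows "Ainv_dx s h = v"
  unfolding Ainv_dx_def
proof (rule the_equality)
  show "Hs s v \<and> (\<forall>\<phi>. smooth_periodic \<phi> \<longrightarrow>
       mu v * mu \<phi> - integral {0..1} (\<lambda>x. v x * deriv (deriv \<phi>) x)
       = - integral {0..1} (\<lambda>x. h x * deriv \<phi> x))"
    using assms by (simp add: weak_sol_def)
  fix v' assume "Hs s v' \<and> (\<forall>\<phi>. smooth_periodic \<phi> \<longrightarrow>
       mu v' * mu \<phi> - integral {0..1} (\<lambda>x. v' x * deriv (deriv \<phi>) x)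
       = - integral {0..1} (\<lambda>x. h x * deriv \<phi> x))"
  then show "v' = v"
    using weak_sol_unique[of v' h v] assms Hs_cper unfolding weak_sol_def by blast
qed

text \<open>Here \<open>k = (h \<circ> \<eta>) \<eta>'\<close>; composition with the inverse of \<open>\<eta>\<close> is only needed to see that the
  Eulerian solution lies in \<open>H\<^sup>s\<close>.\<close>

theorem (in near_id) Fmu_eq:
  fixes w f :: "real \<Rightarrow> real"
  defines "m \<equiv> integral {0..1} (\<lambda>x. w x * eta' x)"
  defines "k \<equiv> \<lambda>x. 2 * m * (w x * eta' x) + deriv w x * deriv w x * qq x / 2"
  assumes w: "Hs s w" and f: "Hs s f"
    and df: "\<And>x. (f has_real_derivative k x - integral {0..1} k * eta' x) (at x)"
    and mf: "integral {0..1} (\<lambda>x. f x * eta' x) = 0"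
  shows "Fmu s eta w = f"
proof -
  let ?v = "\<lambda>y. w (xi y)"
  note wc = Hs_cper[OF w] and fc = Hs_cper[OF f] and wd = Hs_deriv[OF s w]
  note wdc = Hs_cper[OF wd(2)]
  have v: "w \<circ> inv eta = ?v" by (auto simp: xi_def)
  have muv: "mu ?v = m" unfolding mu_def m_def by (rule change_of_variables[OF wc])
  have dv: "deriv ?v = (\<lambda>y. deriv w (xi y) * qq (xi y))"
    by (rule ext, rule DERIV_imp_deriv, rule comp_deriv[OF wd(1)])
  define h where "h y = 2 * mu ?v * ?v y + (deriv ?v y)\<^sup>2 / 2" for y
  have kc: "cper k"
    unfolding k_def using cper_mult[OF cper_mult[OF cper_mult[OF wdc wdc] cper_qq] cper_const[of "1/2"]]
    by (intro cper_add cper_mult[OF cper_const] cper_mult wc cper_eta') simp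
  have h: "h y = k (xi y) * qq (xi y)" for y
  proof -
    have alg: "(2 * m * (W * e) + d * d * p / 2) * p = 2 * m * W + (d * p)\<^sup>2 / 2" if "e * p = 1" for W e d p :: real
    proof -
      have "(2 * m * (W * e) + d * d * p / 2) * p = 2 * m * W * (e * p) + (d * p)\<^sup>2 / 2"
        by (simp add: power2_eq_square algebra_simps)
      then show ?thesis using that by simp
    qed
    have "eta' (xi y) * qq (xi y) = 1" using eta'_pos[of "xi y"] by simp
    from alg[OF this] show ?thesis unfolding h_def muv dv k_def by simp
  qed
  have hc: "cper h" unfolding h by (rule cper_comp[OF cper_mult[OF kc cper_qq]])
  \<comment> \<open>\<open>Fmu\<close> is minus the Eulerian solution composed with
    \<open>eta\<close>, so the candidate solution is minus f carried back to Eulerian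
    coordinates.\<close>
  define V where "V y = (-1) * f (xi y)" for y
  have V: "Hs s V" unfolding V_def[abs_def] by (intro Hs_cmult Hs_comp_xi f)
  have "weak_sol h V"
  proof (rule weak_solI[OF Hs_cper[OF V] _ _ hc])
    fix y
    have "eta' (xi y) \<noteq> 0" using eta'_pos[of "xi y"] by simp
    then have "(-1) * ((k (xi y) - integral {0..1} k * eta' (xi y)) * qq (xi y)) = integral {0..1} k - h y"
      unfolding h by (simp add: field_simps)
    then show "(V has_real_derivative integral {0..1} k - h y) (at y)"
      unfolding V_def[abs_def] using DERIV_cmult[OF comp_deriv[OF df], of "-1" y] by simp
    have "mu V = (-1) * integral {0..1} (\<lambda>y. f (xi y))" by (simp add: mu_def V_def[abs_def])
    then show "mu V = 0" using change_of_variables[OF fc] mf by simp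
  qed
  then have "Ainv_dx s h = V" by (rule Ainv_dx_eq[OF V])
  then have "Fmu s eta w = (\<lambda>x. - V (eta x))"
    unfolding Fmu_def Let_def v h_def[abs_def, symmetric] by simp
  then show ?thesis by (simp add: V_def)
qed

lemma (in near_id) Ds_eta: "Ds s eta"
proof -
  have "(\<lambda>y. inv eta y - y) = (\<lambda>y. (-1) * z (xi y))"
  proof
    fix y
    have "xi y + z (xi y) = y" using eta_xi[of y] by (simp only: eta_def)
    then show "inv eta y - y = (-1) * z (xi y)" by (simp add: xi_def[symmetric])
  qed
  moreover have "Hs s (\<lambda>y. (-1) * z (xi y))" by (intro Hs_cmult Hs_comp_xi z)
  moreover have "(\<lambda>x. eta x - x) = z" by (auto simp: eta_def)
  ultimately show ?thesis
    unfolding Ds_def using eta_bij eta_strict_mono z by simp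
qed

subsection \<open>Maps with Lipschitz derivative on Banach spaces\<close>

text \<open>The quadratic Taylor estimate is part of the definition instead of being deduced from
  the Lipschitz derivative by a mean value theorem. Closure under sums, products and inverses is
  then pure algebra on an arbitrary set \<open>B\<close>.\<close>

definition C11_with :: "'a::real_normed_vector set \<Rightarrow> ('a \<Rightarrow> 'b::real_normed_vector) \<Rightarrow>
    ('a \<Rightarrow> 'a \<Rightarrow> 'b) \<Rightarrow> real \<Rightarrow> bool" where
  "C11_with B G G' K \<longleftrightarrow> K \<ge> 0 \<and>
     (\<forall>x\<in>B. bounded_linear (G' x) \<and> norm (G x) \<le> K \<and> (\<forall>h. norm (G' x h) \<le> K * norm h)) \<and>
     (\<forall>x\<in>B. \<forall>y\<in>B. norm (G y - G x) \<le> K * norm (y - x) \<and>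
        norm (G y - G x - G' x (y - x)) \<le> K * (norm (y - x))\<^sup>2 \<and>
        (\<forall>h. norm (G' y h - G' x h) \<le> K * norm (y - x) * norm h))"

definition C11_on :: "'a::real_normed_vector set \<Rightarrow> ('a \<Rightarrow> 'b::real_normed_vector) \<Rightarrow> bool" where
  "C11_on B G \<longleftrightarrow> (\<exists>G' K. C11_with B G G' K)"

lemma C11_withD:
  assumes "C11_with B G G' K"
  shows "K \<ge> 0" "x \<in> B \<Longrightarrow> bounded_linear (G' x)" "x \<in> B \<Longrightarrow> norm (G x) \<le> K"
    "x \<in> B \<Longrightarrow> norm (G' x h) \<le> K * norm h"
    "x \<in> B \<Longrightarrow> y \<in> B \<Longrightarrow> norm (G y - G x) \<le> K * norm (y - x)"
    "x \<in> B \<Longrightarrow> y \<in> B \<Longrightarrow> norm (G y - G x - G' x (y - x)) \<le> K * (norm (y - x))\<^sup>2"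
    "x \<in> B \<Longrightarrow> y \<in> B \<Longrightarrow> norm (G' y h - G' x h) \<le> K * norm (y - x) * norm h"
  using assms unfolding C11_with_def by blast+

lemma C11_on_const: "C11_on B (\<lambda>x. c)"
  unfolding C11_on_def
  by (intro exI[of _ "\<lambda>x h. 0"] exI[of _ "norm c"]) (auto simp: C11_with_def bounded_linear_zero)

lemma C11_on_bounded_linear_comp:
  assumes "bounded_linear f" and "C11_on B G"
  shows "C11_on B (\<lambda>x. f (G x))"
proof -
  interpret f: bounded_linear f by fact
  obtain G' K where G: "C11_with B G G' K" using assms(2) by (auto simp: C11_on_def)
  obtain M where M: "M \<ge> 0" "\<And>x. norm (f x) \<le> norm x * M" using f.nonneg_bounded by blast
  have le: "norm (f z) \<le> (K * M) * b" if "norm z \<le> K * b" for z b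
    using M(2)[of z] mult_right_mono[OF that M(1)] by (simp add: mult_ac)
  have "C11_with B (\<lambda>x. f (G x)) (\<lambda>x h. f (G' x h)) (K * M)"
    unfolding C11_with_def f.diff[symmetric]
  proof (intro conjI ballI allI)
    show "0 \<le> K * M" using C11_withD(1)[OF G] M by simp
    fix x assume x: "x \<in> B"
    show "bounded_linear (\<lambda>h. f (G' x h))"
      by (rule bounded_linear_compose[OF f.bounded_linear C11_withD(2)[OF G x]])
    show "norm (f (G x)) \<le> K * M"
      using le[of "G x" 1] C11_withD(3)[OF G x] by simp
    show "norm (f (G' x h)) \<le> K * M * norm h" for h
      by (intro le C11_withD[OF G] x)
    fix y assume y: "y \<in> B"
    show "norm (f (G y - G x)) \<le> K * M * norm (y - x)"
      by (intro le C11_withD[OF G] x y)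
    show "norm (f (G y - G x - G' x (y - x))) \<le> K * M * (norm (y - x))\<^sup>2"
      by (intro le C11_withD[OF G] x y)
    show "norm (f (G' y h - G' x h)) \<le> K * M * norm (y - x) * norm h" for h
      using le[of "G' y h - G' x h" "norm (y - x) * norm h"] C11_withD(7)[OF G x y]
      by (simp add: mult.assoc)
  qed
  then show ?thesis by (auto simp: C11_on_def)
qed

lemma C11_on_bounded_linear:
  assumes "bounded_linear f" "bounded B"
  shows "C11_on B f"
proof -
  obtain r where r: "r \<ge> 0" "\<And>x. x \<in> B \<Longrightarrow> norm x \<le> r"
    using assms(2) unfolding bounded_iff by (meson dual_order.trans linear)
  have *: "norm h \<le> max r 1 * norm h" for h :: 'a
    using mult_right_mono[of 1 "max r 1" "norm h"] by simp
  have "C11_with B (\<lambda>x. x) (\<lambda>x h. h) (max r 1)"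
    unfolding C11_with_def
    by (intro conjI ballI allI *) (use r in \<open>auto simp: bounded_linear_ident intro: max.coboundedI1\<close>)
  then have "C11_on B (\<lambda>x. x)" by (auto simp: C11_on_def)
  from C11_on_bounded_linear_comp[OF assms(1) this] show ?thesis .
qed

text \<open>The product rule. Each error is telescoped into at most four bilinear terms, each
  bounded by K L M times the right power of the distance; this explains the 4 in
  \<open>C\<close>.\<close>

lemma C11_on_bilinear:
  assumes "bounded_bilinear p" and "C11_on B F" and "C11_on B G"
  shows "C11_on B (\<lambda>x. p (F x) (G x))"
proof -
  interpret p: bounded_bilinear p by fact
  obtain F' K where F: "C11_with B F F' K" using assms(2) by (auto simp: C11_on_def)
  obtain G' L where G: "C11_with B G G' L" using assms(3) by (auto simp: C11_on_def)
  obtain M where M: "M \<ge> 0" "\<And>a b. norm (p a b) \<le> norm a * norm b * M" using p.nonneg_bounded by blast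
  have KL: "K \<ge> 0" "L \<ge> 0" using C11_withD(1)[OF F] C11_withD(1)[OF G] by auto
  define C where "C = 4 * (K * L * M)"
  have C: "C \<ge> 0" using KL M by (simp add: C_def)
  have le: "norm (p a b) \<le> (K * L * M) * (s * t)"
    if "norm a \<le> K * s" "norm b \<le> L * t" for a b s t
  proof -
    have "norm a * norm b \<le> (K * s) * (L * t)"
      by (intro mult_mono that) (use norm_ge_zero order_trans that in blast)+
    then show ?thesis
      using M(2)[of a b] mult_right_mono[OF _ M(1), of "norm a * norm b" "(K * s) * (L * t)"]
      by (simp add: mult_ac)
  qed
  note F1 = C11_withD(3)[OF F] and G1 = C11_withD(3)[OF G]
  have "C11_with B (\<lambda>x. p (F x) (G x)) (\<lambda>x h. p (F' x h) (G x) + p (F x) (G' x h)) C"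
    unfolding C11_with_def
  proof (intro conjI ballI allI C)
    fix x assume x: "x \<in> B"
    note Fx = F1[OF x] and Gx = G1[OF x]
    show "bounded_linear (\<lambda>h. p (F' x h) (G x) + p (F x) (G' x h))"
      by (intro bounded_linear_add bounded_linear_compose[OF p.bounded_linear_left]
          bounded_linear_compose[OF p.bounded_linear_right] C11_withD(2)[OF F x] C11_withD(2)[OF G x])
    have "K * L * M \<ge> 0" using KL M by simp
    then show "norm (p (F x) (G x)) \<le> C"
      using le[of "F x" 1 "G x" 1] Fx Gx by (simp add: C_def)
    show "norm (p (F' x h) (G x) + p (F x) (G' x h)) \<le> C * norm h" for h
    proof -
      have "norm (p (F' x h) (G x)) \<le> (K * L * M) * (norm h * 1)"
        using C11_withD(4)[OF F x] Gx by (intro le) auto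
      moreover have "norm (p (F x) (G' x h)) \<le> (K * L * M) * (1 * norm h)"
        using C11_withD(4)[OF G x] Fx by (intro le) auto
      moreover have "(K * L * M) * norm h \<ge> 0" using KL M by simp
      ultimately show ?thesis
        using norm_triangle_ineq[of "p (F' x h) (G x)" "p (F x) (G' x h)"] by (simp add: C_def)
    qed
    fix y assume y: "y \<in> B"
    note Fy = F1[OF y] and Gy = G1[OF y]
    define d where "d = norm (y - x)"
    have d: "d \<ge> 0" by (simp add: d_def)
    have dF: "norm (F y - F x) \<le> K * d" and dG: "norm (G y - G x) \<le> L * d"
      using C11_withD(5)[OF F x y] C11_withD(5)[OF G x y] by (auto simp: d_def)
    have "norm (p (F y - F x) (G y)) \<le> (K * L * M) * (d * 1)"
      using dF Gy by (intro le) auto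
    moreover have "norm (p (F x) (G y - G x)) \<le> (K * L * M) * (1 * d)"
      using dG Fx by (intro le) auto
    moreover have "p (F y) (G y) - p (F x) (G x) = p (F y - F x) (G y) + p (F x) (G y - G x)"
      by (simp add: p.diff_left p.diff_right)
    moreover have "(K * L * M) * d \<ge> 0" using KL M d by simp
    ultimately show "norm (p (F y) (G y) - p (F x) (G x)) \<le> C * norm (y - x)"
      using norm_triangle_ineq[of "p (F y - F x) (G y)" "p (F x) (G y - G x)"]
      by (simp add: C_def d_def)
    have "norm (p (F y - F x - F' x (y - x)) (G x)) \<le> (K * L * M) * (d\<^sup>2 * 1)"
      using C11_withD(6)[OF F x y] Gx by (intro le) (auto simp: d_def)
    moreover have "norm (p (F x) (G y - G x - G' x (y - x))) \<le> (K * L * M) * (1 * d\<^sup>2)"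
      using C11_withD(6)[OF G x y] Fx by (intro le) (auto simp: d_def)
    moreover have "norm (p (F y - F x) (G y - G x)) \<le> (K * L * M) * (d * d)"
      using dF dG by (intro le) auto
    moreover have "p (F y) (G y) - p (F x) (G x) - (p (F' x (y - x)) (G x) + p (F x) (G' x (y - x))) =
        p (F y - F x - F' x (y - x)) (G x) + p (F x) (G y - G x - G' x (y - x)) + p (F y - F x) (G y - G x)"
      by (simp add: p.diff_left p.diff_right)
    moreover have "(K * L * M) * d\<^sup>2 \<ge> 0" using KL M d by simp
    ultimately show "norm (p (F y) (G y) - p (F x) (G x) - (p (F' x (y - x)) (G x) + p (F x) (G' x (y - x))))
        \<le> C * (norm (y - x))\<^sup>2"
      using norm_triangle_ineq[of "p (F y - F x - F' x (y - x)) (G x) + p (F x) (G y - G x - G' x (y - x))" "p (F y - F x) (G y - G x)"]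
        norm_triangle_ineq[of "p (F y - F x - F' x (y - x)) (G x)" "p (F x) (G y - G x - G' x (y - x))"]
      by (simp add: C_def d_def power2_eq_square)
    fix h
    have "norm (p (F' y h - F' x h) (G y)) \<le> (K * L * M) * ((d * norm h) * 1)"
      using C11_withD(7)[OF F x y] Gy by (intro le) (auto simp: d_def mult.assoc)
    moreover have "norm (p (F' x h) (G y - G x)) \<le> (K * L * M) * (norm h * d)"
      using C11_withD(4)[OF F x] dG by (intro le) auto
    moreover have "norm (p (F y - F x) (G' y h)) \<le> (K * L * M) * (d * norm h)"
      using C11_withD(4)[OF G y] dF by (intro le) auto
    moreover have "norm (p (F x) (G' y h - G' x h)) \<le> (K * L * M) * (1 * (d * norm h))"
      using C11_withD(7)[OF G x y] Fx by (intro le) (auto simp: d_def mult.assoc)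
    moreover have "p (F' y h) (G y) + p (F y) (G' y h) - (p (F' x h) (G x) + p (F x) (G' x h)) =
       (p (F' y h - F' x h) (G y) + p (F' x h) (G y - G x)) + (p (F y - F x) (G' y h) + p (F x) (G' y h - G' x h))"
      by (simp add: p.diff_left p.diff_right)
    ultimately show "norm (p (F' y h) (G y) + p (F y) (G' y h) - (p (F' x h) (G x) + p (F x) (G' x h)))
        \<le> C * norm (y - x) * norm h"
      using norm_triangle_ineq[of "p (F' y h - F' x h) (G y) + p (F' x h) (G y - G x)" "p (F y - F x) (G' y h) + p (F x) (G' y h - G' x h)"]
        norm_triangle_ineq[of "p (F' y h - F' x h) (G y)" "p (F' x h) (G y - G x)"]
        norm_triangle_ineq[of "p (F y - F x) (G' y h)" "p (F x) (G' y h - G' x h)"]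
      by (simp add: C_def d_def mult_ac)
  qed
  then show ?thesis by (auto simp: C11_on_def)
qed

lemma C11_on_Pair:
  assumes "C11_on B F" and "C11_on B G"
  shows "C11_on B (\<lambda>x. (F x, G x))"
proof -
  obtain F' K where F: "C11_with B F F' K" using assms(1) by (auto simp: C11_on_def)
  obtain G' L where G: "C11_with B G G' L" using assms(2) by (auto simp: C11_on_def)
  have le: "norm (a, b) \<le> (K + L) * s" if "norm a \<le> K * s" "norm b \<le> L * s" for a b s
    using norm_Pair_le[of a b] that by (simp add: algebra_simps)
  have "C11_with B (\<lambda>x. (F x, G x)) (\<lambda>x h. (F' x h, G' x h)) (K + L)"
    unfolding C11_with_def diff_Pair
  proof (intro conjI ballI allI)
    show "0 \<le> K + L" using C11_withD(1)[OF F] C11_withD(1)[OF G] by simp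
    fix x assume x: "x \<in> B"
    show "bounded_linear (\<lambda>h. (F' x h, G' x h))"
      by (intro bounded_linear_Pair C11_withD(2)[OF F x] C11_withD(2)[OF G x])
    show "norm (F x, G x) \<le> K + L"
      using le[of "F x" 1 "G x"] C11_withD(3)[OF F x] C11_withD(3)[OF G x] by simp
    show "norm (F' x h, G' x h) \<le> (K + L) * norm h" for h
      by (rule le[OF C11_withD(4)[OF F x] C11_withD(4)[OF G x]])
    fix y assume y: "y \<in> B"
    show "norm (F y - F x, G y - G x) \<le> (K + L) * norm (y - x)"
      by (rule le[OF C11_withD(5)[OF F x y] C11_withD(5)[OF G x y]])
    show "norm (F y - F x - F' x (y - x), G y - G x - G' x (y - x)) \<le> (K + L) * (norm (y - x))\<^sup>2"
      by (rule le[OF C11_withD(6)[OF F x y] C11_withD(6)[OF G x y]])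
    show "norm (F' y h - F' x h, G' y h - G' x h) \<le> (K + L) * norm (y - x) * norm h" for h
      using le[of "F' y h - F' x h" "norm (y - x) * norm h" "G' y h - G' x h"]
        C11_withD(7)[OF F x y, of h] C11_withD(7)[OF G x y, of h]
      by (simp add: mult.assoc)
  qed
  then show ?thesis by (auto simp: C11_on_def)
qed

lemma C11_on_add:
  assumes "C11_on B F" and "C11_on B G"
  shows "C11_on B (\<lambda>x. F x + G x)"
proof -
  have "bounded_linear (\<lambda>z. fst z + snd z)"
    by (intro bounded_linear_add bounded_linear_fst bounded_linear_snd)
  from C11_on_bounded_linear_comp[OF this C11_on_Pair[OF assms]] show ?thesis by simp
qed

lemma C11_on_diff:
  assumes "C11_on B F" and "C11_on B G"
  shows "C11_on B (\<lambda>x. F x - G x)"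
proof -
  have "bounded_linear (\<lambda>z. fst z - snd z)"
    by (intro bounded_linear_sub bounded_linear_fst bounded_linear_snd)
  from C11_on_bounded_linear_comp[OF this C11_on_Pair[OF assms]] show ?thesis by simp
qed

lemma C11_on_compose_linear:
  assumes L: "bounded_linear L" "\<And>x. x \<in> B \<Longrightarrow> L x \<in> A" and G: "C11_on A G"
  shows "C11_on B (\<lambda>x. G (L x))"
proof -
  interpret L: bounded_linear L by fact
  obtain G' K where G: "C11_with A G G' K" using G by (auto simp: C11_on_def)
  note K0 = C11_withD(1)[OF G]
  obtain M where M: "M \<ge> 0" "\<And>x. norm (L x) \<le> norm x * M" using L.nonneg_bounded by blast
  define N where "N = K * (1 + M + M\<^sup>2)"
  have N: "N \<ge> 0" "K \<le> N" "K * M \<le> N" "K * M\<^sup>2 \<le> N"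
    using K0 M(1) by (auto simp: N_def algebra_simps)
  have le1: "K * norm (L h) \<le> N * norm h" for h
  proof -
    have "K * norm (L h) \<le> K * (norm h * M)" by (intro mult_left_mono M K0)
    also have "\<dots> = (K * M) * norm h" by simp
    also have "\<dots> \<le> N * norm h" by (intro mult_right_mono N) auto
    finally show ?thesis .
  qed
  have le2: "K * (norm (L h) * norm (L k)) \<le> N * (norm h * norm k)" for h k
  proof -
    have "K * (norm (L h) * norm (L k)) \<le> K * ((norm h * M) * (norm k * M))"
      using M by (intro mult_left_mono mult_mono M K0) auto
    also have "\<dots> = (K * M\<^sup>2) * (norm h * norm k)" by (simp add: power2_eq_square)
    also have "\<dots> \<le> N * (norm h * norm k)" by (intro mult_right_mono N) auto
    finally show ?thesis .
  qed
  have "C11_with B (\<lambda>x. G (L x)) (\<lambda>x h. G' (L x) (L h)) N"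
    unfolding C11_with_def
  proof (intro conjI ballI allI N(1))
    fix x assume "x \<in> B"
    then have x: "L x \<in> A" by (rule L(2))
    show "bounded_linear (\<lambda>h. G' (L x) (L h))"
      by (rule bounded_linear_compose[OF C11_withD(2)[OF G x] L(1)])
    show "norm (G (L x)) \<le> N" using C11_withD(3)[OF G x] N(2) by linarith
    show "norm (G' (L x) (L h)) \<le> N * norm h" for h
      using C11_withD(4)[OF G x] le1 order_trans by blast
    fix y assume "y \<in> B"
    then have y: "L y \<in> A" by (rule L(2))
    show "norm (G (L y) - G (L x)) \<le> N * norm (y - x)"
      using C11_withD(5)[OF G x y] le1[of "y - x"] by (simp add: L.diff)
    show "norm (G (L y) - G (L x) - G' (L x) (L (y - x))) \<le> N * (norm (y - x))\<^sup>2"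
      using C11_withD(6)[OF G x y] le2[of "y - x" "y - x"] by (simp add: L.diff power2_eq_square)
    show "norm (G' (L y) (L h) - G' (L x) (L h)) \<le> N * norm (y - x) * norm h" for h
      using C11_withD(7)[OF G x y, of "L h"] le2[of "y - x" h] by (simp add: L.diff mult.assoc)
  qed
  then show ?thesis by (auto simp: C11_on_def)
qed

text \<open>The hypothesis is the resolvent identity of an inverse, and it bootstraps regularity
  from boundedness: it first gives the Lipschitz constant \<open>K1\<close>, and inserting that into
  itself gives the remainder constant \<open>K2\<close> for the derivative h -> - V(a) V(a)
  h.\<close>

lemma C11_on_resolvent:
  assumes p: "bounded_bilinear p" and M: "M \<ge> 0" "\<And>a. a \<in> B \<Longrightarrow> norm (V a) \<le> M"
    and V: "\<And>a b. a \<in> B \<Longrightarrow> b \<in> B \<Longrightarrow> V b - V a = - p (p (V b) (V a)) (b - a)"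
  shows "C11_on B V"
proof -
  interpret p: bounded_bilinear p by fact
  obtain C where C: "C \<ge> 0" "\<And>a b. norm (p a b) \<le> norm a * norm b * C" using p.nonneg_bounded by blast
  have pp: "norm (p (p a b) c) \<le> (x * y * C\<^sup>2) * norm c" if "norm a \<le> x" "norm b \<le> y" for a b c x y
  proof -
    have xy: "x \<ge> 0" "y \<ge> 0" using that norm_ge_zero order_trans by blast+
    have "norm (p (p a b) c) \<le> norm (p a b) * norm c * C" by (rule C)
    also have "\<dots> \<le> (norm a * norm b * C) * norm c * C" by (intro mult_right_mono C) auto
    also have "\<dots> \<le> (x * y * C) * norm c * C"
      by (intro mult_right_mono mult_mono that C xy) auto
    finally show ?thesis by (simp add: power2_eq_square mult_ac)
  qed
  define K1 where "K1 = M * M * C\<^sup>2"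
  have K1: "K1 \<ge> 0" using M by (simp add: K1_def)
  define K2 where "K2 = K1 * M * C\<^sup>2"
  have K2: "K2 \<ge> 0" using M K1 by (simp add: K2_def)
  have lip: "norm (V b - V a) \<le> K1 * norm (b - a)" if "a \<in> B" "b \<in> B" for a b
    unfolding V[OF that] norm_minus_cancel K1_def by (intro pp M that)
  have "C11_with B V (\<lambda>a h. - p (p (V a) (V a)) h) (M + K1 + 2 * K2)"
    unfolding C11_with_def
  proof (intro conjI ballI allI)
    show "0 \<le> M + K1 + 2 * K2" using M K1 K2 by simp
    fix a assume a: "a \<in> B"
    show "bounded_linear (\<lambda>h. - p (p (V a) (V a)) h)"
      by (intro bounded_linear_minus p.bounded_linear_right)
    show "norm (V a) \<le> M + K1 + 2 * K2" using M(2)[OF a] K1 K2 by linarith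
    have grow: "z \<le> (M + K1 + 2 * K2) * t" if "z \<le> c * t" "c \<le> M + K1 + 2 * K2" "t \<ge> 0" for z c t :: real
      using that(1) mult_right_mono[OF that(2,3)] by linarith
    show "norm (- p (p (V a) (V a)) h) \<le> (M + K1 + 2 * K2) * norm h" for h
      unfolding norm_minus_cancel
      by (rule grow[of _ K1]) (use pp[OF M(2)[OF a] M(2)[OF a], of h] M(1) K1 K2 in \<open>auto simp: K1_def\<close>)
    fix b assume b: "b \<in> B"
    define d where "d = norm (b - a)"
    show "norm (V b - V a) \<le> (M + K1 + 2 * K2) * norm (b - a)"
      by (rule grow[OF lip[OF a b]]) (use M(1) K2 in auto)
    have "V b - V a - - p (p (V a) (V a)) (b - a) = - p (p (V b - V a) (V a)) (b - a)"
      unfolding V[OF a b] by (simp add: p.diff_left V[OF a b, symmetric])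
    then have "norm (V b - V a - - p (p (V a) (V a)) (b - a)) \<le> ((K1 * norm (b - a)) * M * C\<^sup>2) * norm (b - a)"
      using pp[OF lip[OF a b] M(2)[OF a], of "b - a"] by simp
    then show "norm (V b - V a - - p (p (V a) (V a)) (b - a)) \<le> (M + K1 + 2 * K2) * (norm (b - a))\<^sup>2"
      by (intro grow[of _ K2]) (use M(1) K1 K2 in \<open>auto simp: K2_def power2_eq_square mult_ac\<close>)
    fix h
    have "- p (p (V b) (V b)) h - - p (p (V a) (V a)) h = - (p (p (V b - V a) (V b)) h + p (p (V a) (V b - V a)) h)"
      by (simp add: p.diff_left p.diff_right)
    then have "norm (- p (p (V b) (V b)) h - - p (p (V a) (V a)) h)
        \<le> norm (p (p (V b - V a) (V b)) h) + norm (p (p (V a) (V b - V a)) h)"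
      by (metis norm_minus_cancel norm_triangle_ineq)
    also have "\<dots> \<le> ((K1 * d) * M * C\<^sup>2) * norm h + (M * (K1 * d) * C\<^sup>2) * norm h"
      unfolding d_def by (intro add_mono pp lip M a b)
    also have "\<dots> = 2 * K2 * (d * norm h)" by (simp add: K2_def)
    finally have "norm (- p (p (V b) (V b)) h - - p (p (V a) (V a)) h) \<le> (M + K1 + 2 * K2) * (d * norm h)"
      by (rule grow) (use M(1) K1 K2 in \<open>auto simp: d_def\<close>)
    then show "norm (- p (p (V b) (V b)) h - - p (p (V a) (V a)) h) \<le> (M + K1 + 2 * K2) * norm (b - a) * norm h"
      by (simp add: d_def mult.assoc)
  qed
  then show ?thesis by (auto simp: C11_on_def)
qed

lemma C11_on_continuous: "C11_on B F \<Longrightarrow> continuous_on B F"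
proof -
  assume "C11_on B F"
  then obtain F' K where F: "C11_with B F F' K" by (auto simp: C11_on_def)
  have "K-lipschitz_on B F"
    using C11_withD(5)[OF F] C11_withD(1)[OF F] by (intro lipschitz_onI) (auto simp: dist_norm)
  then show ?thesis by (rule lipschitz_on_continuous_on)
qed

subsection \<open>Flows of ordinary differential equations in Banach spaces\<close>

lemma has_derivative_quadratic:
  assumes "bounded_linear f'" "e > 0" and K: "\<And>y. y \<in> ball x e \<Longrightarrow> norm (f y - f x - f' (y - x)) \<le> K * (norm (y - x))\<^sup>2"
  shows "(f has_derivative f') (at x)"
  unfolding has_derivative_at_alt
proof (intro conjI assms(1) allI impI)
  fix r :: real assume "r > 0"
  define d where "d = min e (r / (\<bar>K\<bar> + 1))"
  have "norm (f y - f x - f' (y - x)) \<le> r * norm (y - x)" if y: "norm (y - x) < d" for y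
  proof -
    have "K * (norm (y - x))\<^sup>2 \<le> \<bar>K\<bar> * norm (y - x) * norm (y - x)"
      by (simp add: power2_eq_square mult_right_mono mult.assoc)
    also have "\<dots> \<le> r * norm (y - x)"
    proof (rule mult_right_mono)
      have "\<bar>K\<bar> * norm (y - x) \<le> (\<bar>K\<bar> + 1) * norm (y - x)" by (simp add: algebra_simps)
      also have "\<dots> \<le> (\<bar>K\<bar> + 1) * (r / (\<bar>K\<bar> + 1))"
        using y by (intro mult_left_mono) (auto simp: d_def)
      also have "\<dots> = r" by simp
      finally show "\<bar>K\<bar> * norm (y - x) \<le> r" .
    qed simp
    finally show ?thesis
      using K[of y] y by (simp add: d_def dist_norm norm_minus_commute)
  qed
  moreover have "d > 0" using \<open>r > 0\<close> \<open>e > 0\<close> by (simp add: d_def)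
  ultimately show "\<exists>d>0. \<forall>y. norm (y - x) < d \<longrightarrow> norm (f y - f x - f' (y - x)) \<le> r * norm (y - x)"
    by blast
qed

text \<open>Solving x = y + A x by the contraction principle inverts id - A. The composition stated
  is the one-sided one that the inverse function rule asks for.\<close>

lemma half_contraction_inverse:
  fixes A :: "'a::{real_normed_vector, complete_space} \<Rightarrow> 'a"
  assumes "bounded_linear A" and A: "\<And>x. norm (A x) \<le> norm x / 2"
  obtains B where "bounded_linear B" "B \<circ> (\<lambda>x. x - A x) = id"
proof -
  interpret A: bounded_linear A by fact
  have ex: "\<exists>!x. y + A x = x" for y
    by (rule banach_fix_type[where c = "1/2"]) (use A in \<open>auto simp: dist_norm A.diff[symmetric]\<close>)
  define B where "B y = (THE x. y + A x = x)" for y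
  have B: "y + A (B y) = B y" for y
    unfolding B_def by (rule theI'[OF ex])
  have Bu: "B y = x" if "y + A x = x" for x y
    using ex[of y] B[of y] that by blast
  have bnd: "norm (B y) \<le> norm y * 2" for y
  proof -
    have "norm (B y) \<le> norm y + norm (A (B y))" by (metis B norm_triangle_ineq)
    then show ?thesis using A[of "B y"] by simp
  qed
  have "bounded_linear B"
  proof (rule bounded_linear_intro[where K = 2])
    show "B (x + y) = B x + B y" for x y
      by (rule Bu) (use B[of x] B[of y] in \<open>simp add: A.add algebra_simps\<close>)
    show "B (r *\<^sub>R x) = r *\<^sub>R B x" for r x
      by (rule Bu) (metis A.scaleR B scaleR_right_distrib)
  qed (rule bnd)
  moreover have "B \<circ> (\<lambda>x. x - A x) = id"
    by (rule ext) (auto intro!: Bu)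
  ultimately show ?thesis using that by blast
qed

text \<open>The signed integral from 0 to \<open>t\<close>. It is based at -T because an integral
  over {0..t} would be 0 for negative \<open>t\<close>.\<close>

definition integral_from_0 :: "real \<Rightarrow> (real \<Rightarrow> 'a::banach) \<Rightarrow> real \<Rightarrow> 'a" where
  "integral_from_0 T g t = integral {- T..t} g - integral {- T..0} g"

lemma integral_from_0_has_vector_derivative:
  assumes "continuous_on {- T..T} g" "t \<in> {- T..T}"
  shows "(integral_from_0 T g has_vector_derivative g t) (at t within {- T..T})"
  unfolding integral_from_0_def[abs_def]
  using integral_has_vector_derivative[OF assms] by (auto intro!: derivative_eq_intros)

lemma norm_integral_from_0:
  assumes g: "continuous_on {- T..T} g" and t: "t \<in> {- T..T}" and M: "\<And>s. s \<in> {- T..T} \<Longrightarrow> norm (g s) \<le> M"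
  shows "norm (integral_from_0 T g t) \<le> M * T"
proof -
  have T: "T \<ge> 0" using t by simp
  have M0: "M \<ge> 0" using M[OF t] norm_ge_zero order_trans by blast
  have "norm (integral_from_0 T g t - integral_from_0 T g 0) \<le> M * norm (t - 0)"
  proof (rule differentiable_bound[where S = "{- T..T}" and f' = "\<lambda>x h. h *\<^sub>R g x"])
    show "(integral_from_0 T g has_derivative (\<lambda>h. h *\<^sub>R g x)) (at x within {- T..T})" if "x \<in> {- T..T}" for x
      using integral_from_0_has_vector_derivative[OF g that] by (simp add: has_vector_derivative_def)
    show "onorm (\<lambda>h. h *\<^sub>R g x) \<le> M" if "x \<in> {- T..T}" for x
      by (rule onorm_bound[OF M0]) (use mult_left_mono[OF M[OF that] abs_ge_zero] in \<open>simp add: mult.commute\<close>)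
  qed (use t T in auto)
  also have "\<dots> \<le> M * T" using t T M0 by (intro mult_left_mono) auto
  finally show ?thesis by (simp add: integral_from_0_def)
qed

lemma integral_from_0_diff:
  assumes "continuous_on {- T..T} f" "continuous_on {- T..T} g" "t \<in> {- T..T}"
  shows "integral_from_0 T (\<lambda>s. f s - g s) t = integral_from_0 T f t - integral_from_0 T g t"
proof -
  have T: "T \<ge> 0" using assms(3) by simp
  have "{- T..t} \<subseteq> {- T..T}" "{- T..0} \<subseteq> {- T..T}" using assms(3) T by auto
  then have "f integrable_on {- T..t}" "f integrable_on {- T..0}"
    "g integrable_on {- T..t}" "g integrable_on {- T..0}"
    using assms(1,2) by (meson integrable_continuous_real continuous_on_subset)+
  then show ?thesis by (simp add: integral_from_0_def integral_diff)
qed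


text \<open>The Picard equation is solved as \<gamma> = z + N \<gamma> with a whole curve
  \<open>z\<close> as parameter, on the Banach space of bounded continuous curves. Its solution map
  \<open>g\<close> inverts id - N, whose derivative id - D is invertible, so \<open>g\<close> is
  differentiable; restricting \<open>z\<close> to constant curves and evaluating at time
  \<open>t\<close> gives differentiability in the initial value.\<close>

theorem ode_flow:
  fixes F :: "'a::banach \<Rightarrow> 'a"
  assumes F: "C11_on (ball x0 R) F" and R: "R > 0"
  obtains T r :: real and \<Gamma> :: "'a \<Rightarrow> real \<Rightarrow> 'a" where "T > 0" "r > 0"
    "\<And>u. u \<in> ball x0 r \<Longrightarrow> \<Gamma> u 0 = u"
    "\<And>u t. u \<in> ball x0 r \<Longrightarrow> \<Gamma> u t \<in> ball x0 R"
    "\<And>u t. u \<in> ball x0 r \<Longrightarrow> t \<in> {- T<..<T} \<Longrightarrow> (\<Gamma> u has_vector_derivative F (\<Gamma> u t)) (at t)"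
    "\<And>u t. u \<in> ball x0 r \<Longrightarrow> \<exists>L. ((\<lambda>v. \<Gamma> v t) has_derivative L) (at u)"
proof -
  obtain F' K where F: "C11_with (ball x0 R) F F' K" using F by (auto simp: C11_on_def)
  note K0 = C11_withD(1)[OF F]
  \<comment> \<open>K T <= 1/2 makes the Picard map a contraction, and K T <= R/4 keeps the iterates
    in the ball.\<close>
  define T where "T = min (1/2) (R/4) / (K + 1)"
  have T: "T > 0" using R K0 by (simp add: T_def)
  have KT: "K * T \<le> 1/2" "K * T \<le> R/4"
  proof -
    have "K * T \<le> (K + 1) * T" using T by simp
    also have "\<dots> = min (1/2) (R/4)" using K0 by (simp add: T_def)
    finally show "K * T \<le> 1/2" "K * T \<le> R/4" by auto
  qed
  \<comment> \<open>Clamping time to [-T, T] lets curves live on the whole line, so that the type of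
    bounded continuous functions can be used and the flow stays in the ball for every real
    time.\<close>
  define c where "c t = max (- T) (min T t)" for t
  have c: "c t \<in> {- T..T}" for t using T by (auto simp: c_def)
  have c_id: "c t = t" if "t \<in> {- T..T}" for t using that by (auto simp: c_def)
  have c_cont: "continuous_on UNIV c" unfolding c_def[abs_def] by (intro continuous_intros)
  define I where "I g = Bcontfun (\<lambda>t. integral_from_0 T g (c t))" for g :: "real \<Rightarrow> 'a"
  have I: "(I g) t = integral_from_0 T g (c t)" if g: "continuous_on {- T..T} g" for g t
  proof -
    have "continuous_on {- T..T} (integral_from_0 T g)"
      using integral_from_0_has_vector_derivative[OF g] has_vector_derivative_continuous
      by (fastforce simp: continuous_on_eq_continuous_within)
    then have "continuous_on UNIV (\<lambda>t. integral_from_0 T g (c t))"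
      using continuous_on_compose2[OF _ c_cont] c by blast
    moreover obtain M where "\<And>s. s \<in> {- T..T} \<Longrightarrow> norm (g s) \<le> M"
      using compact_imp_bounded[OF compact_continuous_image[OF g compact_Icc]]
      unfolding bounded_iff by blast
    then have "bounded (range (\<lambda>t. integral_from_0 T g (c t)))"
      using norm_integral_from_0[OF g c] unfolding bounded_iff by blast
    ultimately have "(\<lambda>t. integral_from_0 T g (c t)) \<in> bcontfun" by (simp add: bcontfun_def)
    then show ?thesis by (simp add: I_def Bcontfun_inverse)
  qed
  have norm_I: "norm (I g) \<le> M * T" if g: "continuous_on {- T..T} g" "\<And>s. norm (g s) \<le> M" for g M
    by (rule norm_bound) (simp add: I[OF g(1)] norm_integral_from_0[OF g(1) c g(2)])
  have I_diff: "I (\<lambda>s. f s - g s) = I f - I g"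
    if "continuous_on {- T..T} f" "continuous_on {- T..T} g" for f g
    by (rule bcontfun_eqI) (simp add: I that continuous_on_diff integral_from_0_diff[OF that c])
  let ?S = "ball (const_bcontfun x0) R :: (real \<Rightarrow>\<^sub>C 'a) set"
  have S: "\<gamma> t \<in> ball x0 R" if "\<gamma> \<in> ?S" for \<gamma> t
    using that dist_fun_lt_imp_dist_val_lt[of "const_bcontfun x0" \<gamma> R t]
    by (simp add: const_bcontfun.rep_eq)
  have nrm: "norm (\<gamma> t) \<le> norm \<gamma>" for \<gamma> :: "real \<Rightarrow>\<^sub>C 'a" and t
    by (rule norm_bounded)
  have nrm2: "norm (\<gamma> t - \<delta> t) \<le> norm (\<gamma> - \<delta>)" for \<gamma> \<delta> :: "real \<Rightarrow>\<^sub>C 'a" and t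
    using norm_bounded[of "\<gamma> - \<delta>" t] by simp
  have F_cont: "continuous_on (ball x0 R) F"
    using F by (intro C11_on_continuous) (auto simp: C11_on_def)
  have Fg_cont: "continuous_on X (\<lambda>t. F (\<gamma> t))" if "\<gamma> \<in> ?S" for \<gamma> X
    by (rule continuous_on_compose2[OF F_cont]) (use S[OF that] in auto)
  define N where "N \<gamma> = I (\<lambda>t. F (\<gamma> t))" for \<gamma> :: "real \<Rightarrow>\<^sub>C 'a"
  have N_le: "norm (N \<gamma>) \<le> R / 4" if "\<gamma> \<in> ?S" for \<gamma>
    using norm_I[OF Fg_cont[OF that] C11_withD(3)[OF F S[OF that]]] KT by (simp add: N_def)
  have N_lip: "norm (N \<gamma> - N \<delta>) \<le> norm (\<gamma> - \<delta>) / 2" if "\<gamma> \<in> ?S" "\<delta> \<in> ?S" for \<gamma> \<delta>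
  proof -
    have "norm (I (\<lambda>t. F (\<gamma> t) - F (\<delta> t))) \<le> (K * norm (\<gamma> - \<delta>)) * T"
    proof (rule norm_I)
      show "norm (F (\<gamma> t) - F (\<delta> t)) \<le> K * norm (\<gamma> - \<delta>)" for t
        using C11_withD(5)[OF F S[OF that(2)] S[OF that(1)], of t t] mult_left_mono[OF nrm2[of \<gamma> t \<delta>] K0]
        by linarith
    qed (intro continuous_on_diff Fg_cont[OF that(1)] Fg_cont[OF that(2)])
    also have "\<dots> = (K * T) * norm (\<gamma> - \<delta>)" by simp
    also have "\<dots> \<le> 1/2 * norm (\<gamma> - \<delta>)" by (intro mult_right_mono KT) auto
    finally show ?thesis
      unfolding N_def by (simp add: I_diff[OF Fg_cont[OF that(1)] Fg_cont[OF that(2)]])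
  qed
  define D where "D \<gamma> \<delta> = I (\<lambda>t. F' (\<gamma> t) (\<delta> t))" for \<gamma> \<delta> :: "real \<Rightarrow>\<^sub>C 'a"
  \<comment> \<open>Both the base point and the argument vary with time. The base point is frozen at
    \<open>t\<close>, where the derivative is a bounded linear map, and the error is controlled by
    the Lipschitz bound on the derivative.\<close>
  have Dc: "continuous_on X (\<lambda>t. F' (\<gamma> t) (\<delta> t))" if \<gamma>: "\<gamma> \<in> ?S" for \<gamma> \<delta> :: "real \<Rightarrow>\<^sub>C 'a" and X
  proof (rule continuous_on_subset[OF _ subset_UNIV], rule continuous_at_imp_continuous_on, rule ballI)
    fix t :: real
    have "((\<lambda>s. F' (\<gamma> s) (\<delta> s)) \<longlongrightarrow> F' (\<gamma> t) (\<delta> t)) (at t)"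
    proof (rule Lim_transform)
      have "((\<lambda>s. \<delta> s) \<longlongrightarrow> \<delta> t) (at t)"
        using continuous_on_apply_bcontfun[of UNIV \<delta>] by (simp add: continuous_on_def)
      then show "((\<lambda>s. F' (\<gamma> t) (\<delta> s)) \<longlongrightarrow> F' (\<gamma> t) (\<delta> t)) (at t)"
        by (rule bounded_linear.tendsto[OF C11_withD(2)[OF F S[OF \<gamma>]]])
      have "((\<lambda>s. K * norm (\<gamma> s - \<gamma> t) * norm \<delta>) \<longlongrightarrow> K * 0 * norm \<delta>) (at t)"
        by (intro tendsto_intros tendsto_norm_zero LIM_zero)
           (use continuous_on_apply_bcontfun[of UNIV \<gamma>] in \<open>simp add: continuous_on_def\<close>)
      then have lim: "((\<lambda>s. K * norm (\<gamma> s - \<gamma> t) * norm \<delta>) \<longlongrightarrow> 0) (at t)" by simp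
      show "((\<lambda>s. F' (\<gamma> s) (\<delta> s) - F' (\<gamma> t) (\<delta> s)) \<longlongrightarrow> 0) (at t)"
      proof (rule Lim_null_comparison[OF always_eventually lim], rule allI)
        fix s
        have "K * norm (\<gamma> s - \<gamma> t) * norm (\<delta> s)
            \<le> K * norm (\<gamma> s - \<gamma> t) * norm \<delta>"
          using K0 by (intro mult_left_mono nrm) auto
        then show "norm (F' (\<gamma> s) (\<delta> s) - F' (\<gamma> t) (\<delta> s))
          \<le> K * norm (\<gamma> s - \<gamma> t) * norm \<delta>"
          using C11_withD(7)[OF F S[OF \<gamma>, of t] S[OF \<gamma>, of s], of "\<delta> s"] by linarith
      qed
    qed
    then show "isCont (\<lambda>s. F' (\<gamma> s) (\<delta> s)) t"
      by (simp add: isCont_def)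
  qed
  have D_half: "norm (D \<gamma> \<delta>) \<le> norm \<delta> / 2" if \<gamma>: "\<gamma> \<in> ?S" for \<gamma> \<delta>
  proof -
    have "norm (D \<gamma> \<delta>) \<le> (K * norm \<delta>) * T"
      unfolding D_def
    proof (rule norm_I[OF Dc[OF \<gamma>]])
      show "norm (F' (\<gamma> t) (\<delta> t)) \<le> K * norm \<delta>" for t
        using C11_withD(4)[OF F S[OF \<gamma>]] mult_left_mono[OF nrm[of \<delta> t] K0] order_trans by blast
    qed
    also have "\<dots> = (K * T) * norm \<delta>" by simp
    also have "\<dots> \<le> 1/2 * norm \<delta>" by (intro mult_right_mono KT) auto
    finally show ?thesis by simp
  qed
  have D_lin: "bounded_linear (D \<gamma>)" if \<gamma>: "\<gamma> \<in> ?S" for \<gamma>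
  proof (rule bounded_linear_intro[where K = "1/2"])
    have L: "bounded_linear (F' (\<gamma> t))" for t by (rule C11_withD(2)[OF F S[OF \<gamma>]])
    have diff: "D \<gamma> (\<delta> - \<epsilon>) = D \<gamma> \<delta> - D \<gamma> \<epsilon>" for \<delta> \<epsilon>
      using I_diff[OF Dc[OF \<gamma>] Dc[OF \<gamma>], of \<delta> \<epsilon>]
      by (simp add: D_def linear_diff[OF bounded_linear.linear[OF L]])
    have "D \<gamma> 0 = 0" using diff[of 0 0] by simp
    then have neg: "D \<gamma> (- \<delta>) = - D \<gamma> \<delta>" for \<delta> using diff[of 0 \<delta>] by simp
    show "D \<gamma> (\<delta> + \<epsilon>) = D \<gamma> \<delta> + D \<gamma> \<epsilon>" for \<delta> \<epsilon>
      using diff[of \<delta> "- \<epsilon>"] neg by simp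
    show "D \<gamma> (a *\<^sub>R \<delta>) = a *\<^sub>R D \<gamma> \<delta>" for a \<delta>
    proof (rule bcontfun_eqI)
      fix t
      have "integral_from_0 T (\<lambda>t. a *\<^sub>R F' (\<gamma> t) (\<delta> t)) (c t) =
          a *\<^sub>R integral_from_0 T (\<lambda>t. F' (\<gamma> t) (\<delta> t)) (c t)"
        by (simp add: integral_from_0_def scaleR_right_diff_distrib)
      then show "apply_bcontfun (D \<gamma> (a *\<^sub>R \<delta>)) t = (a *\<^sub>R D \<gamma> \<delta>) t"
        unfolding D_def using I[OF Dc[OF \<gamma>, of "{-T..T}" \<delta>], of t] I[OF Dc[OF \<gamma>, of "{-T..T}" "a *\<^sub>R \<delta>"], of t]
        by (simp add: linear_scale[OF bounded_linear.linear[OF L]])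
    qed
    show "norm (D \<gamma> \<delta>) \<le> norm \<delta> * (1/2)" for \<delta> using D_half[OF \<gamma>, of \<delta>] by simp
  qed
  have N_taylor: "norm (N \<delta> - N \<gamma> - D \<gamma> (\<delta> - \<gamma>)) \<le> (K * T) * (norm (\<delta> - \<gamma>))\<^sup>2"
    if "\<gamma> \<in> ?S" "\<delta> \<in> ?S" for \<gamma> \<delta>
  proof -
    have "norm (I (\<lambda>t. F (\<delta> t) - F (\<gamma> t) - F' (\<gamma> t) ((\<delta> - \<gamma>) t)))
        \<le> (K * (norm (\<delta> - \<gamma>))\<^sup>2) * T"
    proof (rule norm_I)
      show "norm (F (\<delta> t) - F (\<gamma> t) - F' (\<gamma> t) ((\<delta> - \<gamma>) t))
          \<le> K * (norm (\<delta> - \<gamma>))\<^sup>2" for t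
        using C11_withD(6)[OF F S[OF that(1)] S[OF that(2)], of t t]
          mult_left_mono[OF power_mono[OF nrm2[of \<delta> t \<gamma>] norm_ge_zero, of 2] K0]
        by simp
    qed (intro continuous_on_diff Fg_cont[OF that(1)] Fg_cont[OF that(2)] Dc[OF that(1)])
    moreover have "I (\<lambda>t. F (\<delta> t) - F (\<gamma> t) - F' (\<gamma> t) ((\<delta> - \<gamma>) t))
       = N \<delta> - N \<gamma> - D \<gamma> (\<delta> - \<gamma>)"
      unfolding N_def D_def
      using I_diff[OF continuous_on_diff[OF Fg_cont[OF that(2)] Fg_cont[OF that(1)]] Dc[OF that(1), of _ "\<delta> - \<gamma>"]]
        I_diff[OF Fg_cont[OF that(2)] Fg_cont[OF that(1)]] by simp
    ultimately show ?thesis by (simp add: mult_ac)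
  qed
  \<comment> \<open>Parameters within R/4 plus an integral term of size at most R/4 give fixed
    points within R/2, well inside the ball of radius R on which F is controlled.\<close>
  let ?Z = "ball (const_bcontfun x0) (R / 4) :: (real \<Rightarrow>\<^sub>C 'a) set"
  let ?C = "cball (const_bcontfun x0) (R / 2) :: (real \<Rightarrow>\<^sub>C 'a) set"
  have CS: "?C \<subseteq> ?S" using R by (auto simp: mem_ball mem_cball)
  have ex: "\<exists>!\<gamma>. \<gamma> \<in> ?C \<and> z + N \<gamma> = \<gamma>" if z: "z \<in> ?Z" for z
  proof (rule Banach_fix[where c = "1/2"])
    show "complete ?C" by (simp add: complete_eq_closed)
    show "?C \<noteq> {}" using R by auto
    show "(\<lambda>\<gamma>. z + N \<gamma>) ` ?C \<subseteq> ?C"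
    proof (rule image_subsetI)
      fix \<gamma> assume "\<gamma> \<in> ?C"
      then have "norm (N \<gamma>) \<le> R / 4" using N_le CS by blast
      then show "z + N \<gamma> \<in> ?C"
        using z norm_triangle_ineq[of "z - const_bcontfun x0" "N \<gamma>"]
        by (simp add: dist_norm norm_minus_commute algebra_simps)
    qed
    show "dist (z + N \<gamma>) (z + N \<delta>) \<le> 1/2 * dist \<gamma> \<delta>" if "\<gamma> \<in> ?C" "\<delta> \<in> ?C" for \<gamma> \<delta>
      using N_lip[OF subsetD[OF CS that(1)] subsetD[OF CS that(2)]] by (simp add: dist_norm)
  qed auto
  define g where "g z = (THE \<gamma>. \<gamma> \<in> ?C \<and> z + N \<gamma> = \<gamma>)" for z
  have g: "g z \<in> ?C" "z + N (g z) = g z" if "z \<in> ?Z" for z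
    using theI'[OF ex[OF that]] by (auto simp: g_def)
  have g_lip: "norm (g z - g y) \<le> 2 * norm (z - y)" if "z \<in> ?Z" "y \<in> ?Z" for z y
  proof -
    have "g z - g y = (z - y) + (N (g z) - N (g y))"
      using g(2)[OF that(1)] g(2)[OF that(2)] by (metis add_diff_add)
    then have "norm (g z - g y) \<le> norm (z - y) + norm (N (g z) - N (g y))"
      using norm_triangle_ineq by metis
    also have "\<dots> \<le> norm (z - y) + norm (g z - g y) / 2"
      using N_lip[OF subsetD[OF CS g(1)[OF that(1)]] subsetD[OF CS g(1)[OF that(2)]]] by simp
    finally show ?thesis by simp
  qed
  have g_deriv: "\<exists>L. (g has_derivative L) (at z)" if z: "z \<in> ?Z" for z
  proof -
    have gS: "g z \<in> ?S" using g(1)[OF z] CS by blast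
    obtain B where B: "bounded_linear B" "B \<circ> (\<lambda>\<delta>. \<delta> - D (g z) \<delta>) = id"
      using half_contraction_inverse[OF D_lin[OF gS] D_half[OF gS]] by blast
    obtain e where e: "e > 0" "ball (g z) e \<subseteq> ?S"
      using openE[OF open_ball gS] by blast
    have der: "((\<lambda>\<gamma>. \<gamma> - N \<gamma>) has_derivative (\<lambda>\<delta>. \<delta> - D (g z) \<delta>)) (at (g z))"
    proof (rule has_derivative_quadratic[OF _ e(1)])
      show "bounded_linear (\<lambda>\<delta>. \<delta> - D (g z) \<delta>)"
        by (intro bounded_linear_sub bounded_linear_ident D_lin gS)
      fix \<delta> assume "\<delta> \<in> ball (g z) e"
      then have "\<delta> \<in> ?S" using e by blast
      from N_taylor[OF gS this]
      show "norm (\<delta> - N \<delta> - (g z - N (g z)) - (\<delta> - g z - D (g z) (\<delta> - g z))) \<le> (K * T) * (norm (\<delta> - g z))\<^sup>2"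
        by (simp add: algebra_simps norm_minus_commute)
    qed
    have cont: "continuous (at z) g"
    proof -
      have "2-lipschitz_on ?Z g" by (intro lipschitz_onI) (auto simp: dist_norm intro!: g_lip)
      then have "continuous_on ?Z g" by (rule lipschitz_on_continuous_on)
      then show ?thesis using z by (simp add: continuous_on_eq_continuous_at)
    qed
    have eq: "g y - N (g y) = y" if "y \<in> ?Z" for y
      using g(2)[OF that] by (metis add_diff_cancel_right')
    have "(g has_derivative B) (at z)"
      by (rule has_derivative_inverse_basic[OF der B cont open_ball z eq])
    then show ?thesis by blast
  qed
  have cZ: "const_bcontfun u \<in> ?Z" if "u \<in> ball x0 (R / 4)" for u
  proof -
    have "dist (const_bcontfun x0) (const_bcontfun u :: real \<Rightarrow>\<^sub>C 'a) \<le> dist x0 u"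
      by (rule dist_bound) (simp add: const_bcontfun.rep_eq)
    then show ?thesis using that by simp
  qed
  define \<Gamma> where "\<Gamma> u t = apply_bcontfun (g (const_bcontfun u)) t" for u t
  have \<Gamma>_eq: "\<Gamma> u t = u + integral_from_0 T (\<lambda>s. F (\<Gamma> u s)) (c t)" if u: "u \<in> ball x0 (R / 4)" for u t
  proof -
    have gS: "g (const_bcontfun u) \<in> ?S" using g(1)[OF cZ[OF u]] CS by blast
    have "apply_bcontfun (const_bcontfun u + N (g (const_bcontfun u))) t = \<Gamma> u t"
      using g(2)[OF cZ[OF u]] by (simp add: \<Gamma>_def)
    then show ?thesis
      unfolding N_def \<Gamma>_def by (simp add: I[OF Fg_cont[OF gS]] const_bcontfun.rep_eq)
  qed
  show thesis
  proof (rule that[of T "R/4" \<Gamma>])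
    show "T > 0" "R / 4 > 0" using T R by auto
    fix u assume u: "u \<in> ball x0 (R / 4)"
    have gS: "g (const_bcontfun u) \<in> ?S" using g(1)[OF cZ[OF u]] CS by blast
    show "\<Gamma> u 0 = u"
      using \<Gamma>_eq[OF u, of 0] T by (simp add: c_id integral_from_0_def)
    show "\<Gamma> u t \<in> ball x0 R" for t using S[OF gS] by (simp add: \<Gamma>_def)
    have cont: "continuous_on {- T..T} (\<lambda>s. F (\<Gamma> u s))" using Fg_cont[OF gS] by (simp add: \<Gamma>_def)
    show "(\<Gamma> u has_vector_derivative F (\<Gamma> u t)) (at t)" if t: "t \<in> {- T<..<T}" for t
    proof -
      have "(integral_from_0 T (\<lambda>s. F (\<Gamma> u s)) has_vector_derivative F (\<Gamma> u t)) (at t within {- T<..<T})"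
        by (rule has_vector_derivative_within_subset[OF integral_from_0_has_vector_derivative[OF cont]])
           (use t in auto)
      then have "((\<lambda>t. u + integral_from_0 T (\<lambda>s. F (\<Gamma> u s)) t) has_vector_derivative F (\<Gamma> u t)) (at t)"
        using t by (auto intro!: derivative_eq_intros simp: at_within_open[OF t])
      then show ?thesis
      proof (rule has_vector_derivative_transform_within_open[OF _ open_greaterThanLessThan t])
        show "u + integral_from_0 T (\<lambda>s. F (\<Gamma> u s)) s = \<Gamma> u s" if "s \<in> {- T<..<T}" for s
          using \<Gamma>_eq[OF u, of s] c_id[of s] that by auto
      qed
    qed
    show "\<exists>L. ((\<lambda>v. \<Gamma> v t) has_derivative L) (at u)" for t
    proof -
      obtain L where L: "(g has_derivative L) (at (const_bcontfun u))" using g_deriv[OF cZ[OF u]] by blast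
      have lc: "bounded_linear (const_bcontfun :: 'a \<Rightarrow> real \<Rightarrow>\<^sub>C 'a)"
        by (rule bounded_linear_intro[where K = 1])
           (auto intro!: bcontfun_eqI norm_bound simp: const_bcontfun.rep_eq)
      have le: "bounded_linear (\<lambda>\<gamma> :: real \<Rightarrow>\<^sub>C 'a. \<gamma> t)"
        by (rule bounded_linear_intro[where K = 1]) (auto simp: nrm)
      have "((\<lambda>v. g (const_bcontfun v)) has_derivative (\<lambda>h. L (const_bcontfun h))) (at u)"
        by (rule has_derivative_compose[OF bounded_linear_imp_has_derivative[OF lc] L])
      from bounded_linear.has_derivative[OF le this]
      show ?thesis unfolding \<Gamma>_def by blast
    qed
  qed
qed

text \<open>The curve \<open>y\<close> may leave the ball and obeys the equation only while inside
  it, so Gronwall cannot be applied on the whole interval. The set of times where y = z is closed;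
  it is open because continuity keeps \<open>y\<close> in the ball for a short while after agreeing
  with \<open>z\<close>.\<close>

lemma ode_unique:
  fixes F :: "'a::banach \<Rightarrow> 'a"
  assumes F: "C11_on (ball x0 R) F"
    and y: "continuous_on {- T<..<T} y"
      "\<And>t. t \<in> {- T<..<T} \<Longrightarrow> y t \<in> ball x0 R \<Longrightarrow> (y has_vector_derivative F (y t)) (at t)"
    and z: "\<And>t. t \<in> {- T<..<T} \<Longrightarrow> z t \<in> ball x0 R"
      "\<And>t. t \<in> {- T<..<T} \<Longrightarrow> (z has_vector_derivative F (z t)) (at t)"
    and "y 0 = z 0" and t: "t \<in> {- T<..<T}"
  shows "y t = z t"
proof -
  obtain F' K where F: "C11_with (ball x0 R) F F' K" using F by (auto simp: C11_on_def)
  note K0 = C11_withD(1)[OF F]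
  let ?I = "{- T<..<T}"
  have zc: "continuous_on ?I z"
    using z(2) has_vector_derivative_continuous continuous_at_imp_continuous_on by blast
  define A where "A = {t \<in> ?I. y t - z t = 0}"
  have "openin (top_of_set ?I) A"
    unfolding openin_open_eq[OF open_greaterThanLessThan] open_contains_ball
  proof (intro conjI ballI)
    fix t0 assume t0: "t0 \<in> A"
    then have t0I: "t0 \<in> ?I" and yz: "y t0 = z t0" by (auto simp: A_def)
    have "isCont y t0" using y(1) t0I by (simp add: continuous_on_eq_continuous_at)
    then have "\<forall>\<^sub>F s in nhds t0. y s \<in> ball x0 R"
      using z(1)[OF t0I] yz by (intro topological_tendstoD[of y "y t0"]) (auto simp: isCont_def tendsto_nhds_iff)
    moreover have "\<forall>\<^sub>F s in nhds t0. s \<in> ?I"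
      using t0I by (intro eventually_nhds_in_open) auto
    ultimately have "\<forall>\<^sub>F s in nhds t0. y s \<in> ball x0 R \<and> s \<in> ?I" by eventually_elim auto
    then obtain e0 where e0: "e0 > 0" "\<And>s. dist s t0 < e0 \<Longrightarrow> y s \<in> ball x0 R \<and> s \<in> ?I"
      unfolding eventually_nhds_metric by blast
    \<comment> \<open>Halving e0 keeps the closed interval where \<open>y\<close> is controlled; the
      second term makes K e at most 1/2.\<close>
    define e where "e = min (e0 / 2) (1 / (2 * (K + 1)))"
    have e: "e > 0" using e0 K0 by (simp add: e_def)
    let ?J = "cball t0 e"
    have J: "y s \<in> ball x0 R" "s \<in> ?I" if "s \<in> ?J" for s
      using e0(2)[of s] that e0(1) by (auto simp: e_def dist_commute)
    define d where "d s = y s - z s" for s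
    have dd: "(d has_vector_derivative F (y s) - F (z s)) (at s)" if "s \<in> ?J" for s
      unfolding d_def[abs_def] using J[OF that] by (intro has_vector_derivative_diff y z) auto
    have "continuous_on ?J d"
      using dd has_vector_derivative_continuous continuous_at_imp_continuous_on by blast
    \<comment> \<open>At a point where the difference is largest, the mean value bound gives |d| <=
      |d| / 2, which forces it to vanish on the whole interval.\<close>
    then obtain s1 where s1: "s1 \<in> ?J" "\<And>s. s \<in> ?J \<Longrightarrow> norm (d s) \<le> norm (d s1)"
      using continuous_attains_sup[of ?J "\<lambda>s. norm (d s)", OF compact_cball _ continuous_on_norm] e by auto
    have "norm (d s1 - d t0) \<le> (K * norm (d s1)) * norm (s1 - t0)"
    proof (rule differentiable_bound[where S = ?J and f' = "\<lambda>s h. h *\<^sub>R (F (y s) - F (z s))"])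
      show "(d has_derivative (\<lambda>h. h *\<^sub>R (F (y s) - F (z s)))) (at s within ?J)" if "s \<in> ?J" for s
        using dd[OF that] unfolding has_vector_derivative_def by (rule has_derivative_at_withinI)
      show "onorm (\<lambda>h. h *\<^sub>R (F (y s) - F (z s))) \<le> K * norm (d s1)" if "s \<in> ?J" for s
      proof (rule onorm_bound)
        have "norm (F (y s) - F (z s)) \<le> K * norm (d s)"
          unfolding d_def using J[OF that] z(1) by (intro C11_withD(5)[OF F]) auto
        also have "\<dots> \<le> K * norm (d s1)" by (intro mult_left_mono s1 that K0)
        finally show "norm (h *\<^sub>R (F (y s) - F (z s))) \<le> K * norm (d s1) * norm h" for h
          by (simp add: mult.commute mult_left_mono)
      qed (use K0 in simp)
    qed (use s1 e in auto)
    also have "\<dots> \<le> (K * norm (d s1)) * (1 / (2 * (K + 1)))"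
      using s1(1) K0 by (intro mult_left_mono) (auto simp: e_def dist_real_def)
    also have "\<dots> \<le> norm (d s1) / 2"
      using K0 by (simp add: divide_simps) (simp add: algebra_simps)
    finally have "norm (d s1) \<le> norm (d s1) / 2" using yz by (simp add: d_def)
    then have "norm (d s1) = 0" by simp
    then have "y s = z s" if "s \<in> ?J" for s using s1(2)[OF that] by (simp add: d_def)
    then have "ball t0 e \<subseteq> A" using J(2) by (auto simp: A_def)
    then show "\<exists>e>0. ball t0 e \<subseteq> A" using e by blast
  qed (auto simp: A_def)
  moreover have "closedin (top_of_set ?I) A"
  proof -
    have "continuous_on ?I (\<lambda>t. y t - z t)" by (intro continuous_intros y zc)
    from continuous_closedin_preimage_constant[OF this, of 0] show ?thesis by (simp add: A_def)
  qed
  moreover have "0 \<in> A" using assms(6) t by (auto simp: A_def)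
  ultimately have "A = ?I"
    using connected_clopen[THEN iffD1, OF connected_Ioo[of "- T" T]] by blast
  with t have "t \<in> A" by blast
  then show ?thesis by (simp add: A_def)
qed

subsection \<open>A Banach space type isometric to all the spaces \<open>H\<^sup>s\<close>\<close>

text \<open>The weighted sequences \<open>lam k powr (s/2) * fcoeff u k\<close> of real functions \<open>u\<close> are exactly the
  square summable Hermitian sequences, so one type serves for every \<open>s\<close>.\<close>

typedef hell2 = "{c :: int \<Rightarrow> complex. (\<forall>k. c (- k) = cnj (c k)) \<and> (\<lambda>k. (cmod (c k))\<^sup>2) summable_on UNIV}"
  morphisms hcoef Hell2
  by (rule exI[of _ "\<lambda>_. 0"]) auto

lemma hcoef_herm: "hcoef a (- k) = cnj (hcoef a k)"
  and hcoef_summable: "(\<lambda>k. (cmod (hcoef a k))\<^sup>2) summable_on UNIV"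
  using hcoef[of a] by auto

lemma hcoef_Hell2:
  "(\<And>k. c (- k) = cnj (c k)) \<Longrightarrow> (\<lambda>k. (cmod (c k))\<^sup>2) summable_on UNIV \<Longrightarrow> hcoef (Hell2 c) = c"
  by (rule Hell2_inverse) auto

lemma hell2_eqI: "(\<And>k. hcoef a k = hcoef b k) \<Longrightarrow> a = b"
  by (metis ext hcoef_inject)

lemma l2_summable_add:
  fixes c d :: "int \<Rightarrow> complex"
  assumes "(\<lambda>k. (cmod (c k))\<^sup>2) summable_on UNIV" "(\<lambda>k. (cmod (d k))\<^sup>2) summable_on UNIV"
  shows "(\<lambda>k. (cmod (c k + d k))\<^sup>2) summable_on UNIV"
proof (rule summable_on_comparison_test)
  show "(\<lambda>k. 2 * (cmod (c k))\<^sup>2 + 2 * (cmod (d k))\<^sup>2) summable_on UNIV"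
    by (intro summable_on_add summable_on_cmult_right assms)
  fix k
  have "(cmod (c k + d k))\<^sup>2 \<le> (cmod (c k) + cmod (d k))\<^sup>2"
    by (intro power_mono norm_triangle_ineq) auto
  also have "\<dots> \<le> 2 * (cmod (c k))\<^sup>2 + 2 * (cmod (d k))\<^sup>2"
    using sum_squares_bound[of "cmod (c k)" "cmod (d k)"] by (simp add: power2_sum)
  finally show "(cmod (c k + d k))\<^sup>2 \<le> 2 * (cmod (c k))\<^sup>2 + 2 * (cmod (d k))\<^sup>2" .
qed auto

lemma l2_summable_scale:
  fixes c :: "int \<Rightarrow> complex"
  assumes "(\<lambda>k. (cmod (c k))\<^sup>2) summable_on UNIV"
  shows "(\<lambda>k. (cmod (of_real r * c k))\<^sup>2) summable_on UNIV"
  using summable_on_cmult_right[OF assms, of "r\<^sup>2"] by (simp add: norm_mult power_mult_distrib)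

instantiation hell2 :: real_normed_vector
begin

definition zero_hell2 where "0 = Hell2 (\<lambda>_. 0)"
definition plus_hell2 where "a + b = Hell2 (\<lambda>k. hcoef a k + hcoef b k)"
definition scaleR_hell2 where "r *\<^sub>R a = Hell2 (\<lambda>k. of_real r * hcoef a k)"
definition uminus_hell2 where "- a = (-1) *\<^sub>R (a :: hell2)"
definition minus_hell2 where "a - b = a + (- b :: hell2)"
definition norm_hell2 where "norm a = sqrt (\<Sum>\<^sub>\<infinity>k. (cmod (hcoef a k))\<^sup>2)"
definition dist_hell2 where "dist a b = norm (a - b :: hell2)"
definition sgn_hell2 where "sgn a = inverse (norm a) *\<^sub>R (a :: hell2)"
definition uniformity_hell2 where
  "(uniformity :: (hell2 \<times> hell2) filter) = (INF e\<in>{0 <..}. principal {(x, y). dist x y < e})"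
definition open_hell2 where
  "open (U :: hell2 set) \<longleftrightarrow> (\<forall>x\<in>U. \<forall>\<^sub>F (x', y) in uniformity. x' = x \<longrightarrow> y \<in> U)"

lemma hcoef_0 [simp]: "hcoef 0 k = 0"
  unfolding zero_hell2_def by (subst hcoef_Hell2) auto

lemma hcoef_add [simp]: "hcoef (a + b) k = hcoef a k + hcoef b k"
  unfolding plus_hell2_def
  by (subst hcoef_Hell2) (auto intro!: l2_summable_add hcoef_summable simp: hcoef_herm)

lemma hcoef_scaleR [simp]: "hcoef (r *\<^sub>R a) k = of_real r * hcoef a k"
  unfolding scaleR_hell2_def
  by (subst hcoef_Hell2) (auto intro!: l2_summable_scale hcoef_summable simp: hcoef_herm)

lemma hcoef_uminus [simp]: "hcoef (- a) k = - hcoef a k"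
  by (simp add: uminus_hell2_def)

lemma hcoef_diff [simp]: "hcoef (a - b) k = hcoef a k - hcoef b k"
  by (simp add: minus_hell2_def)

lemma norm_hell2_square: "(norm (a :: hell2))\<^sup>2 = (\<Sum>\<^sub>\<infinity>k. (cmod (hcoef a k))\<^sup>2)"
  by (simp add: norm_hell2_def infsum_nonneg)

lemma norm_hell2_nonneg: "norm (a :: hell2) \<ge> 0"
  by (simp add: norm_hell2_def infsum_nonneg)

lemma hell2_sum_le: "finite F \<Longrightarrow> (\<Sum>k\<in>F. (cmod (hcoef a k))\<^sup>2) \<le> (norm a)\<^sup>2"
  unfolding norm_hell2_square by (intro sum_le_infsum hcoef_summable) auto

lemma norm_hell2_le:
  assumes "M \<ge> 0" "\<And>F. finite F \<Longrightarrow> (\<Sum>k\<in>F. (cmod (hcoef a k))\<^sup>2) \<le> M\<^sup>2"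
  shows "norm a \<le> M"
proof -
  have "(norm a)\<^sup>2 \<le> M\<^sup>2"
    unfolding norm_hell2_square by (rule infsum_le_finite_sums[OF hcoef_summable]) (use assms in auto)
  then show ?thesis using assms(1) by (rule power2_le_imp_le)
qed

lemma hcoef_le_norm: "cmod (hcoef a k) \<le> norm a"
proof -
  have "(cmod (hcoef a k))\<^sup>2 \<le> (norm a)\<^sup>2" using hell2_sum_le[of "{k}" a] by simp
  then show ?thesis using norm_hell2_nonneg by (rule power2_le_imp_le)
qed

instance
proof
  fix a b c :: hell2 and r q :: real
  show "a + b + c = a + (b + c)" "a + b = b + a" "0 + a = a" "- a + a = 0" "a - b = a + - b"
    "r *\<^sub>R (a + b) = r *\<^sub>R a + r *\<^sub>R b" "(r + q) *\<^sub>R a = r *\<^sub>R a + q *\<^sub>R a"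
    "r *\<^sub>R q *\<^sub>R a = (r * q) *\<^sub>R a" "1 *\<^sub>R a = a"
    by (auto intro!: hell2_eqI simp: algebra_simps)
  show "dist a b = norm (a - b)" by (rule dist_hell2_def)
  show "sgn a = inverse (norm a) *\<^sub>R a" by (rule sgn_hell2_def)
  show "(uniformity :: (hell2 \<times> hell2) filter) = (INF e\<in>{0 <..}. principal {(x, y). dist x y < e})"
    by (rule uniformity_hell2_def)
  show "open U = (\<forall>x\<in>U. \<forall>\<^sub>F (x', y) in uniformity. x' = x \<longrightarrow> y \<in> U)" for U :: "hell2 set"
    by (rule open_hell2_def)
  show "(norm a = 0) = (a = 0)"
  proof
    assume "norm a = 0"
    then have "hcoef a k = 0" for k using hcoef_le_norm[of a k] by simp
    then show "a = 0" by (intro hell2_eqI) simp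
  qed (simp add: norm_hell2_def)
  show "norm (a + b) \<le> norm a + norm b"
  proof (rule norm_hell2_le)
    show "norm a + norm b \<ge> 0" using norm_hell2_nonneg[of a] norm_hell2_nonneg[of b] by simp
    fix F :: "int set" assume F: "finite F"
    have L: "L2_set (\<lambda>k. cmod (hcoef x k)) F \<le> norm x" for x
      unfolding L2_set_def using real_sqrt_le_mono[OF hell2_sum_le[OF F, of x]] norm_hell2_nonneg[of x] by simp
    have "L2_set (\<lambda>k. cmod (hcoef (a + b) k)) F \<le> L2_set (\<lambda>k. cmod (hcoef a k) + cmod (hcoef b k)) F"
      by (intro L2_set_mono) (auto intro: norm_triangle_ineq)
    also have "\<dots> \<le> L2_set (\<lambda>k. cmod (hcoef a k)) F + L2_set (\<lambda>k. cmod (hcoef b k)) F"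
      by (rule L2_set_triangle_ineq)
    also have "\<dots> \<le> norm a + norm b" by (intro add_mono L)
    finally have "(L2_set (\<lambda>k. cmod (hcoef (a + b) k)) F)\<^sup>2 \<le> (norm a + norm b)\<^sup>2"
      by (intro power_mono) auto
    then show "(\<Sum>k\<in>F. (cmod (hcoef (a + b) k))\<^sup>2) \<le> (norm a + norm b)\<^sup>2"
      by (simp only: L2_set_def real_sqrt_pow2[OF sum_nonneg[of F "\<lambda>k. (cmod (hcoef (a + b) k))\<^sup>2", OF zero_le_power2]])
  qed
  show "norm (r *\<^sub>R a) = \<bar>r\<bar> * norm a"
  proof -
    have "(\<Sum>\<^sub>\<infinity>k. (cmod (hcoef (r *\<^sub>R a) k))\<^sup>2) = (\<Sum>\<^sub>\<infinity>k. r\<^sup>2 * (cmod (hcoef a k))\<^sup>2)"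
      by (intro infsum_cong) (simp add: norm_mult power_mult_distrib)
    also have "\<dots> = r\<^sup>2 * (\<Sum>\<^sub>\<infinity>k. (cmod (hcoef a k))\<^sup>2)" by (rule infsum_cmult_right')
    finally show ?thesis unfolding norm_hell2_def by (simp add: real_sqrt_mult)
  qed
qed

end

instance hell2 :: banach
proof
  fix X :: "nat \<Rightarrow> hell2" assume X: "Cauchy X"
  have "Cauchy (\<lambda>n. hcoef (X n) k)" for k
  proof (rule CauchyI)
    fix e :: real assume "e > 0"
    then obtain M where M: "\<And>m n. m \<ge> M \<Longrightarrow> n \<ge> M \<Longrightarrow> norm (X m - X n) < e"
      using CauchyD[OF X] by blast
    have "norm (hcoef (X m) k - hcoef (X n) k) < e" if "m \<ge> M" "n \<ge> M" for m n
      using hcoef_le_norm[of "X m - X n" k] M[OF that] by simp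
    then show "\<exists>M. \<forall>m\<ge>M. \<forall>n\<ge>M. norm (hcoef (X m) k - hcoef (X n) k) < e" by blast
  qed
  then have "\<exists>l. (\<lambda>n. hcoef (X n) k) \<longlonglongrightarrow> l" for k
    by (simp add: Cauchy_convergent_iff convergent_def)
  then obtain c where c: "\<And>k. (\<lambda>n. hcoef (X n) k) \<longlonglongrightarrow> c k" by metis
  have herm: "c (- k) = cnj (c k)" for k
  proof (rule LIMSEQ_unique[OF c])
    show "(\<lambda>n. hcoef (X n) (- k)) \<longlonglongrightarrow> cnj (c k)"
      unfolding hcoef_herm by (intro tendsto_intros c)
  qed
  \<comment> \<open>Letting m tend to infinity in finite partial sums gives a bound that is uniform
    in \<open>F\<close>. It yields both square summability of the coordinatewise limit
    \<open>c\<close> and convergence in norm.\<close>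
  have key: "\<exists>N. \<forall>n\<ge>N. \<forall>F. finite F \<longrightarrow> (\<Sum>k\<in>F. (cmod (c k - hcoef (X n) k))\<^sup>2) \<le> e\<^sup>2" if e: "e > 0" for e
  proof -
    obtain N where N: "\<And>m n. m \<ge> N \<Longrightarrow> n \<ge> N \<Longrightarrow> norm (X m - X n) < e"
      using CauchyD[OF X e] by blast
    have "(\<Sum>k\<in>F. (cmod (c k - hcoef (X n) k))\<^sup>2) \<le> e\<^sup>2" if n: "n \<ge> N" and F: "finite F" for n F
    proof (rule LIMSEQ_le_const2)
      show "(\<lambda>m. \<Sum>k\<in>F. (cmod (hcoef (X m) k - hcoef (X n) k))\<^sup>2) \<longlonglongrightarrow> (\<Sum>k\<in>F. (cmod (c k - hcoef (X n) k))\<^sup>2)"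
        by (intro tendsto_intros c)
      have "(\<Sum>k\<in>F. (cmod (hcoef (X m) k - hcoef (X n) k))\<^sup>2) \<le> e\<^sup>2" if "m \<ge> N" for m
      proof -
        have "(\<Sum>k\<in>F. (cmod (hcoef (X m - X n) k))\<^sup>2) \<le> (norm (X m - X n))\<^sup>2" by (rule hell2_sum_le[OF F])
        also have "\<dots> \<le> e\<^sup>2" using N[OF that n] by (intro power_mono) auto
        finally show ?thesis by simp
      qed
      then show "\<exists>N. \<forall>m\<ge>N. (\<Sum>k\<in>F. (cmod (hcoef (X m) k - hcoef (X n) k))\<^sup>2) \<le> e\<^sup>2" by blast
    qed
    then show ?thesis by blast
  qed
  obtain N1 where N1: "\<And>F. finite F \<Longrightarrow> (\<Sum>k\<in>F. (cmod (c k - hcoef (X N1) k))\<^sup>2) \<le> 1\<^sup>2"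
    using key[of 1] by auto
  have "(\<lambda>k. (cmod (c k - hcoef (X N1) k))\<^sup>2) summable_on UNIV"
    by (rule nonneg_sums_bounded(1)[of _ "1\<^sup>2"]) (use N1 in auto)
  from l2_summable_add[OF this hcoef_summable[of "X N1"]]
  have "(\<lambda>k. (cmod (c k))\<^sup>2) summable_on UNIV" by simp
  then have Hc: "hcoef (Hell2 c) = c" by (intro hcoef_Hell2 herm)
  have "X \<longlonglongrightarrow> Hell2 c"
  proof (rule LIMSEQ_I)
    fix r :: real assume r: "r > 0"
    obtain N where N: "\<And>n F. n \<ge> N \<Longrightarrow> finite F \<Longrightarrow> (\<Sum>k\<in>F. (cmod (c k - hcoef (X n) k))\<^sup>2) \<le> (r / 2)\<^sup>2"
      using key[of "r / 2"] r by auto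
    have "norm (X n - Hell2 c) < r" if "n \<ge> N" for n
    proof -
      have "norm (Hell2 c - X n) \<le> r / 2"
        by (rule norm_hell2_le) (use r N[OF that] in \<open>auto simp: Hc\<close>)
      then show ?thesis using r by (simp add: norm_minus_commute)
    qed
    then show "\<exists>N. \<forall>n\<ge>N. norm (X n - Hell2 c) < r" by blast
  qed
  then show "convergent X" by (auto simp: convergent_def)
qed

section \<open>The isometry between H^s and \<open>hell2\<close>, and operators transported through
  it\<close>

definition hco :: "real \<Rightarrow> (real \<Rightarrow> real) \<Rightarrow> hell2" where
  "hco s u = Hell2 (\<lambda>k. of_real (lam k powr (s / 2)) * fcoeff u k)"

definition hfn :: "real \<Rightarrow> hell2 \<Rightarrow> real \<Rightarrow> real" where
  "hfn s a = fseries (\<lambda>k. of_real (lam k powr (- s / 2)) * hcoef a k)"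

lemma cmod_weight_square: "(cmod (of_real (lam k powr (t / 2)) * c))\<^sup>2 = lam k powr t * (cmod c)\<^sup>2"
  using powr_half_square[of "lam k" t] by (simp add: norm_mult power_mult_distrib)

lemma hcoef_hco:
  assumes "Hs s u"
  shows "hcoef (hco s u) k = of_real (lam k powr (s / 2)) * fcoeff u k"
  unfolding hco_def
  by (subst hcoef_Hell2) (use assms in \<open>auto simp: fcoeff_minus_index cmod_weight_square Hs_iff\<close>)

lemma norm_hco: "Hs s u \<Longrightarrow> norm (hco s u) = Hs_norm s u"
  unfolding norm_hell2_def Hs_norm_eq by (simp add: hcoef_hco cmod_weight_square)

context
  fixes s :: real
  assumes s: "s > 1/2"
begin

lemma Hs_hfn: "Hs s (hfn s a)"
  and fcoeff_hfn: "fcoeff (hfn s a) k = of_real (lam k powr (- s / 2)) * hcoef a k"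
proof -
  have "(\<lambda>k. lam k powr s * (cmod (of_real (lam k powr (- s / 2)) * hcoef a k))\<^sup>2) = (\<lambda>k. (cmod (hcoef a k))\<^sup>2)"
    by (rule ext) (simp only: cmod_weight_square, simp add: mult.assoc[symmetric] flip: powr_add)
  then have "(\<lambda>k. lam k powr s * (cmod (of_real (lam k powr (- s / 2)) * hcoef a k))\<^sup>2) summable_on UNIV"
    using hcoef_summable[of a] by simp
  from Hs_fseries[OF s this]
  show "Hs s (hfn s a)" "fcoeff (hfn s a) k = of_real (lam k powr (- s / 2)) * hcoef a k"
    unfolding hfn_def by (simp_all add: hcoef_herm)
qed

lemma hco_hfn [simp]: "hco s (hfn s a) = a"
proof (rule hell2_eqI)
  fix k
  have "of_real (lam k powr (s / 2)) * (of_real (lam k powr (- s / 2)) * hcoef a k) = of_real (lam k powr (s / 2) * lam k powr (- s / 2)) * hcoef a k"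
    by simp
  also have "lam k powr (s / 2) * lam k powr (- s / 2) = 1" by (simp flip: powr_add)
  finally show "hcoef (hco s (hfn s a)) k = hcoef a k" by (simp add: hcoef_hco[OF Hs_hfn] fcoeff_hfn)
qed

lemma hfn_hco: "Hs s u \<Longrightarrow> hfn s (hco s u) = u"
proof (rule cper_eqI)
  assume u: "Hs s u"
  fix k
  have "of_real (lam k powr (- s / 2)) * (of_real (lam k powr (s / 2)) * fcoeff u k) = of_real (lam k powr (- s / 2) * lam k powr (s / 2)) * fcoeff u k"
    by simp
  also have "lam k powr (- s / 2) * lam k powr (s / 2) = 1" by (simp flip: powr_add)
  finally show "fcoeff (hfn s (hco s u)) k = fcoeff u k" by (simp add: hcoef_hco[OF u] fcoeff_hfn)
qed (use Hs_cper Hs_hfn in blast)+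

lemma Hs_norm_hfn: "Hs_norm s (hfn s a) = norm a"
  using norm_hco[OF Hs_hfn, of a] by simp

lemma hco_eqI: "Hs s u \<Longrightarrow> hfn s a = u \<Longrightarrow> hco s u = a"
  by auto

lemma cper_hfn: "cper (hfn s a)" by (rule Hs_cper[OF Hs_hfn])

lemma hfn_add: "hfn s (a + b) = (\<lambda>x. hfn s a x + hfn s b x)"
  by (rule cper_eqI) (auto intro!: cper_hfn cper_add simp: fcoeff_add cper_hfn fcoeff_hfn algebra_simps)

lemma hfn_scaleR: "hfn s (r *\<^sub>R a) = (\<lambda>x. r * hfn s a x)"
  by (rule cper_eqI) (auto intro!: cper_hfn cper_mult cper_const simp: fcoeff_cmult fcoeff_hfn algebra_simps)

lemma hfn_diff: "hfn s (a - b) = (\<lambda>x. hfn s a x - hfn s b x)"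
  by (rule cper_eqI) (auto intro!: cper_hfn cper_diff simp: fcoeff_diff cper_hfn fcoeff_hfn algebra_simps)

lemma hfn_zero: "hfn s 0 = (\<lambda>x. 0)"
  using hfn_diff[of 0 0] by simp

lemma hco_add: "Hs s u \<Longrightarrow> Hs s v \<Longrightarrow> hco s (\<lambda>x. u x + v x) = hco s u + hco s v"
  by (intro hco_eqI Hs_add) (auto simp: hfn_add hfn_hco)

lemma hco_diff: "Hs s u \<Longrightarrow> Hs s v \<Longrightarrow> hco s (\<lambda>x. u x - v x) = hco s u - hco s v"
  by (intro hco_eqI Hs_diff) (auto simp: hfn_diff hfn_hco)

lemma hco_cmult: "Hs s u \<Longrightarrow> hco s (\<lambda>x. r * u x) = r *\<^sub>R hco s u"
  by (intro hco_eqI Hs_cmult) (auto simp: hfn_scaleR hfn_hco)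

text \<open>The algebra property of H^s in coordinates.\<close>

lemma hmult_bilinear: "bounded_bilinear (\<lambda>a b. hco s (\<lambda>x. hfn s a x * hfn s b x))"
proof
  have m: "Hs s (\<lambda>x. hfn s a x * hfn s b x)" for a b by (rule Hs_mult(1)[OF s Hs_hfn Hs_hfn])
  fix a a' b b' :: hell2 and r :: real
  show "hco s (\<lambda>x. hfn s (a + a') x * hfn s b x) = hco s (\<lambda>x. hfn s a x * hfn s b x) + hco s (\<lambda>x. hfn s a' x * hfn s b x)"
    using hco_add[OF m[of a b] m[of a' b]] by (simp add: hfn_add algebra_simps)
  show "hco s (\<lambda>x. hfn s a x * hfn s (b + b') x) = hco s (\<lambda>x. hfn s a x * hfn s b x) + hco s (\<lambda>x. hfn s a x * hfn s b' x)"
    using hco_add[OF m[of a b] m[of a b']] by (simp add: hfn_add algebra_simps)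
  show "hco s (\<lambda>x. hfn s (r *\<^sub>R a) x * hfn s b x) = r *\<^sub>R hco s (\<lambda>x. hfn s a x * hfn s b x)"
    using hco_cmult[OF m[of a b]] by (simp add: hfn_scaleR algebra_simps)
  show "hco s (\<lambda>x. hfn s a x * hfn s (r *\<^sub>R b) x) = r *\<^sub>R hco s (\<lambda>x. hfn s a x * hfn s b x)"
    using hco_cmult[OF m[of a b]] by (simp add: hfn_scaleR algebra_simps)
  have "norm (hco s (\<lambda>x. hfn s a x * hfn s b x)) \<le> norm a * norm b * algebra_const s" for a b
    using Hs_mult(2)[OF s Hs_hfn[of a] Hs_hfn[of b]] by (simp add: norm_hco[OF m] Hs_norm_hfn mult_ac)
  then show "\<exists>K. \<forall>a b. norm (hco s (\<lambda>x. hfn s a x * hfn s b x)) \<le> norm a * norm b * K" by blast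
qed

end

lemma hop_bounded_linear:
  assumes s: "s > 1/2" and r: "r > 1/2"
    and op: "\<And>u. Hs s u \<Longrightarrow> Hs r (Op u)" "\<And>u. Hs s u \<Longrightarrow> Hs_norm r (Op u) \<le> C * Hs_norm s u"
    and add: "\<And>u v. Hs s u \<Longrightarrow> Hs s v \<Longrightarrow> Op (\<lambda>x. u x + v x) = (\<lambda>x. Op u x + Op v x)"
    and scale: "\<And>u c. Hs s u \<Longrightarrow> Op (\<lambda>x. c * u x) = (\<lambda>x. c * Op u x)"
  shows "bounded_linear (\<lambda>a. hco r (Op (hfn s a)))"
proof (rule bounded_linear_intro[where K = C])
  note H = Hs_hfn[OF s]
  show "hco r (Op (hfn s (a + b))) = hco r (Op (hfn s a)) + hco r (Op (hfn s b))" for a b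
    by (simp add: hfn_add[OF s] add[OF H H] hco_add[OF r op(1)[OF H] op(1)[OF H]])
  show "hco r (Op (hfn s (c *\<^sub>R a))) = c *\<^sub>R hco r (Op (hfn s a))" for c a
    by (simp add: hfn_scaleR[OF s] scale[OF H] hco_cmult[OF r op(1)[OF H]])
  show "norm (hco r (Op (hfn s a))) \<le> norm a * C" for a
    using op(2)[OF H[of a]] by (simp add: norm_hco[OF op(1)[OF H]] Hs_norm_hfn[OF s] mult.commute)
qed

subsection \<open>The vector field in Lagrangian coordinates\<close>

text \<open>The mean-free primitive of g minus its mean. Dropping frequency 0 does both: it makes
  the division possible and the result periodic.\<close>

definition prim :: "(real \<Rightarrow> real) \<Rightarrow> real \<Rightarrow> real" where
  "prim g = fseries (\<lambda>k. if k = 0 then 0 else fcoeff g k / (2 * pi * \<i> * of_int k))"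

text \<open>The constant 1 in the norm bound is due to \<open>lam_le_frequency\<close>. The
  derivative is identified through its coefficients, which agree with those of \<open>g\<close>
  except at index 0.\<close>

lemma prim:
  assumes \<sigma>: "\<sigma> > 1/2" and g: "Hs \<sigma> g"
  shows "Hs (\<sigma> + 1) (prim g)" "Hs_norm (\<sigma> + 1) (prim g) \<le> Hs_norm \<sigma> g"
    "fcoeff (prim g) k = (if k = 0 then 0 else fcoeff g k / (2 * pi * \<i> * of_int k))"
    "(prim g has_real_derivative g x - integral {0..1} g) (at x)"
proof -
  define c where "c k = (if k = 0 then 0 else fcoeff g k / (2 * pi * \<i> * of_int k))" for k
  have P: "prim g = fseries c" by (simp add: prim_def c_def[abs_def])
  have le: "lam k powr (\<sigma> + 1) * (cmod (c k))\<^sup>2 \<le> wsq \<sigma> g k" for k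
  proof (cases "k = 0")
    case False
    have "lam k * (cmod (c k))\<^sup>2 \<le> ((2 * pi)\<^sup>2 * (real_of_int k)\<^sup>2) * (cmod (c k))\<^sup>2"
      by (intro mult_right_mono lam_le_frequency False) auto
    also have "\<dots> = (cmod (fcoeff g k))\<^sup>2"
      using False by (simp add: c_def norm_divide norm_mult power_divide power_mult_distrib)
    finally have "lam k powr \<sigma> * (lam k * (cmod (c k))\<^sup>2) \<le> wsq \<sigma> g k"
      by (intro mult_left_mono) auto
    moreover have "lam k powr \<sigma> * lam k = lam k powr (\<sigma> + 1)"
      using powr_add[of "lam k" \<sigma> 1] by simp
    ultimately show ?thesis by (simp add: mult.assoc[symmetric])
  qed (simp add: c_def)
  have sm: "(\<lambda>k. lam k powr (\<sigma> + 1) * (cmod (c k))\<^sup>2) summable_on UNIV"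
    by (rule summable_on_comparison_test[of "\<lambda>k. wsq \<sigma> g k"])
       (use g le in \<open>auto simp: Hs_iff\<close>)
  have herm: "c (- k) = cnj (c k)" for k by (simp add: c_def fcoeff_minus_index)
  have \<sigma>': "\<sigma> + 1 > 1/2" using \<sigma> by simp
  note F = Hs_fseries[OF \<sigma>' sm herm, folded P]
  show H: "Hs (\<sigma> + 1) (prim g)" by (rule F(1))
  show "fcoeff (prim g) k = (if k = 0 then 0 else fcoeff g k / (2 * pi * \<i> * of_int k))"
    using F(2)[of k] by (simp add: c_def)
  show "Hs_norm (\<sigma> + 1) (prim g) \<le> Hs_norm \<sigma> g"
  proof (rule HsI(2)[OF Hs_cper[OF H] Hs_norm_nonneg])
    fix F' :: "int set" assume F': "finite F'"
    have "(\<Sum>k\<in>F'. wsq (\<sigma> + 1) (prim g) k) \<le> (\<Sum>k\<in>F'. wsq \<sigma> g k)"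
      unfolding F(2) by (intro sum_mono le)
    also have "\<dots> \<le> (Hs_norm \<sigma> g)\<^sup>2" by (rule Hs_sum_le[OF g F'])
    finally show "(\<Sum>k\<in>F'. wsq (\<sigma> + 1) (prim g) k) \<le> (Hs_norm \<sigma> g)\<^sup>2" .
  qed
  have s: "\<sigma> + 1 > 3/2" using \<sigma> by simp
  note D = Hs_deriv[OF s H]
  note gc = Hs_cper[OF g]
  have "deriv (prim g) = (\<lambda>x. g x - integral {0..1} g)"
  proof (rule cper_eqI[OF Hs_cper[OF D(2)] cper_diff[OF gc cper_const]])
    fix k
    show "fcoeff (deriv (prim g)) k = fcoeff (\<lambda>x. g x - integral {0..1} g) k"
      using fcoeff_0_index[OF gc]
      by (simp add: D(4) F(2) c_def fcoeff_diff[OF gc cper_const] fcoeff_const)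
  qed
  then show "(prim g has_real_derivative g x - integral {0..1} g) (at x)" using D(1) by simp
qed

lemma prim_add:
  assumes "\<sigma> > 1/2" "Hs \<sigma> u" "Hs \<sigma> v"
  shows "prim (\<lambda>x. u x + v x) = (\<lambda>x. prim u x + prim v x)"
proof (rule cper_eqI)
  note P = prim(3)[OF assms(1)] and H = prim(1)[OF assms(1)]
  note c = Hs_cper[OF H[OF assms(2)]] Hs_cper[OF H[OF assms(3)]]
  show "cper (prim (\<lambda>x. u x + v x))" by (rule Hs_cper[OF H[OF Hs_add[OF assms(2,3)]]])
  show "cper (\<lambda>x. prim u x + prim v x)" by (intro cper_add c)
  show "fcoeff (prim (\<lambda>x. u x + v x)) k = fcoeff (\<lambda>x. prim u x + prim v x) k" for k
    by (simp add: P[OF Hs_add[OF assms(2,3)]] fcoeff_add[OF c] P[OF assms(2)] P[OF assms(3)]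
        fcoeff_add[OF Hs_cper[OF assms(2)] Hs_cper[OF assms(3)]] add_divide_distrib)
qed

lemma prim_cmult:
  assumes "\<sigma> > 1/2" "Hs \<sigma> u"
  shows "prim (\<lambda>x. r * u x) = (\<lambda>x. r * prim u x)"
proof (rule cper_eqI)
  note P = prim(3)[OF assms(1)] and H = prim(1)[OF assms(1)]
  show "cper (prim (\<lambda>x. r * u x))" by (rule Hs_cper[OF H[OF Hs_cmult[OF assms(2)]]])
  show "cper (\<lambda>x. r * prim u x)" by (intro cper_mult cper_const Hs_cper[OF H[OF assms(2)]])
  show "fcoeff (prim (\<lambda>x. r * u x)) k = fcoeff (\<lambda>x. r * prim u x) k" for k
    by (simp add: P[OF Hs_cmult[OF assms(2)]] fcoeff_cmult P[OF assms(2)])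
qed

section \<open>Operators between H^s and H^(s-1) in coordinates\<close>

locale sobolev_index =
  fixes s :: real
  assumes s: "s > 3/2"
begin

abbreviation \<sigma> :: real where "\<sigma> \<equiv> s - 1"

lemma s1: "s > 1/2" and \<sigma>1: "\<sigma> > 1/2" using s by auto

text \<open>All spaces share one type, so the Sobolev index is only a convention: \<open>Dop\<close>
  and \<open>Emb\<close> send H^s coordinates to H^(s-1) coordinates and \<open>Prim\<close> goes
  back; \<open>Mul\<close>, \<open>Inv\<close> and \<open>One\<close> live in H^(s-1), and
  \<open>OneX\<close> is the constant 1 in H^s.\<close>

definition Dop :: "hell2 \<Rightarrow> hell2" where "Dop a = hco \<sigma> (deriv (hfn s a))"
definition Emb :: "hell2 \<Rightarrow> hell2" where "Emb a = hco \<sigma> (hfn s a)"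
definition Mul :: "hell2 \<Rightarrow> hell2 \<Rightarrow> hell2" where "Mul a b = hco \<sigma> (\<lambda>x. hfn \<sigma> a x * hfn \<sigma> b x)"
definition Prim :: "hell2 \<Rightarrow> hell2" where "Prim a = hco s (prim (hfn \<sigma> a))"
definition Mean :: "hell2 \<Rightarrow> real" where "Mean a = Re (hcoef a 0)"
definition One :: hell2 where "One = hco \<sigma> (\<lambda>x. 1)"
definition OneX :: hell2 where "OneX = hco s (\<lambda>x. 1)"
definition Inv :: "hell2 \<Rightarrow> hell2" where "Inv a = hco \<sigma> (\<lambda>x. 1 / (1 + hfn \<sigma> a x))"

lemma hfn_Dop: "hfn \<sigma> (Dop a) = deriv (hfn s a)"
  unfolding Dop_def by (rule hfn_hco[OF \<sigma>1 Hs_deriv(2)[OF s Hs_hfn[OF s1]]])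
lemma hfn_Emb: "hfn \<sigma> (Emb a) = hfn s a"
  unfolding Emb_def by (rule hfn_hco[OF \<sigma>1 Hs_mono(1)[OF Hs_hfn[OF s1]]]) simp
lemma hfn_Mul: "hfn \<sigma> (Mul a b) = (\<lambda>x. hfn \<sigma> a x * hfn \<sigma> b x)"
  unfolding Mul_def by (rule hfn_hco[OF \<sigma>1 Hs_mult(1)[OF \<sigma>1 Hs_hfn[OF \<sigma>1] Hs_hfn[OF \<sigma>1]]])
lemma hfn_One: "hfn \<sigma> One = (\<lambda>x. 1)"
  unfolding One_def by (rule hfn_hco[OF \<sigma>1 Hs_const])
lemma hfn_OneX: "hfn s OneX = (\<lambda>x. 1)"
  unfolding OneX_def by (rule hfn_hco[OF s1 Hs_const])
lemma hfn_Prim: "hfn s (Prim a) = prim (hfn \<sigma> a)"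
  unfolding Prim_def using prim(1)[OF \<sigma>1 Hs_hfn[OF \<sigma>1, of a]] by (intro hfn_hco[OF s1]) simp
text \<open>Since \<open>lam 0 = 1\<close>, the coordinate of index 0 carries no weight and is the
  mean itself.\<close>

lemma Mean_eq: "Mean a = integral {0..1} (hfn \<sigma> a)"
  using fcoeff_0_index[OF cper_hfn[OF \<sigma>1], of a] fcoeff_hfn[OF \<sigma>1, of a 0]
  by (simp add: Mean_def lam_def)

lemma Dop_linear: "bounded_linear Dop"
proof -
  have "bounded_linear (\<lambda>a. hco \<sigma> (deriv (hfn s a)))"
  proof (rule hop_bounded_linear[OF s1 \<sigma>1, where C = "2 * pi"])
    fix u v :: "real \<Rightarrow> real" and c :: real assume u: "Hs s u"
    note du = Hs_deriv[OF s u]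
    show "Hs \<sigma> (deriv u)" "Hs_norm \<sigma> (deriv u) \<le> 2 * pi * Hs_norm s u" by (rule du)+
    show "deriv (\<lambda>x. c * u x) = (\<lambda>x. c * deriv u x)"
      by (rule ext, rule DERIV_imp_deriv, rule DERIV_cmult, rule du)
    assume v: "Hs s v"
    show "deriv (\<lambda>x. u x + v x) = (\<lambda>x. deriv u x + deriv v x)"
      by (rule ext, rule DERIV_imp_deriv, intro DERIV_add du(1) Hs_deriv(1)[OF s v])
  qed
  then show ?thesis by (simp add: Dop_def[abs_def])
qed

lemma Emb_linear: "bounded_linear Emb"
proof -
  have "bounded_linear (\<lambda>a. hco \<sigma> ((\<lambda>u. u) (hfn s a)))"
    by (rule hop_bounded_linear[OF s1 \<sigma>1, where C = 1]) (auto intro: Hs_mono)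
  then show ?thesis by (simp add: Emb_def[abs_def])
qed

lemma Prim_linear: "bounded_linear Prim"
  unfolding Prim_def[abs_def]
  by (rule hop_bounded_linear[OF \<sigma>1 s1, where C = 1])
     (use prim(1,2)[OF \<sigma>1] prim_add[OF \<sigma>1] prim_cmult[OF \<sigma>1] in auto)

lemma Mean_linear: "bounded_linear Mean"
proof (rule bounded_linear_intro[where K = 1])
  show "norm (Mean a) \<le> norm a * 1" for a
    using hcoef_le_norm[of a 0] abs_Re_le_cmod[of "hcoef a 0"] by (simp add: Mean_def)
qed (auto simp: Mean_def)

lemma Mul_bilinear: "bounded_bilinear Mul"
  unfolding Mul_def[abs_def] by (rule hmult_bilinear[OF \<sigma>1])

lemma norm_Mul: "norm (Mul a b) \<le> algebra_const \<sigma> * norm a * norm b"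
  unfolding Mul_def
  using Hs_mult[OF \<sigma>1 Hs_hfn[OF \<sigma>1, of a] Hs_hfn[OF \<sigma>1, of b]]
  by (simp add: norm_hco Hs_norm_hfn[OF \<sigma>1])

text \<open>Small enough for two purposes: multiplication by an element of norm at most
  \<open>eps\<close> is a half contraction, and such an element is bounded pointwise by 1/2. The
  added 1 keeps the denominator positive.\<close>

definition eps :: real where "eps = 1 / (2 * (algebra_const \<sigma> + sobolev_const \<sigma> + 1))"

lemma eps: "eps > 0" "algebra_const \<sigma> * eps \<le> 1/2" "sobolev_const \<sigma> * eps \<le> 1/2"
proof -
  have nn: "algebra_const \<sigma> \<ge> 0" "sobolev_const \<sigma> \<ge> 0" by (rule algebra_const_nonneg sobolev_const_nonneg)+
  then have p: "algebra_const \<sigma> + sobolev_const \<sigma> + 1 > 0" by linarith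
  then show "eps > 0" by (simp add: eps_def)
  show "algebra_const \<sigma> * eps \<le> 1/2" "sobolev_const \<sigma> * eps \<le> 1/2"
    unfolding eps_def using nn p by (simp_all add: divide_simps)
qed

lemma hfn_small:
  assumes "norm a \<le> eps"
  shows "\<bar>hfn \<sigma> a x\<bar> \<le> 1/2"
proof -
  have "\<bar>hfn \<sigma> a x\<bar> \<le> sobolev_const \<sigma> * norm a"
    using Hs_sup_bound[OF \<sigma>1 Hs_hfn[OF \<sigma>1, of a]] by (simp add: Hs_norm_hfn[OF \<sigma>1])
  also have "\<dots> \<le> sobolev_const \<sigma> * eps" by (intro mult_left_mono assms sobolev_const_nonneg)
  finally show ?thesis using eps(3) by linarith
qed

text \<open>The Neumann series in fixed point form, b = 1 - a b. Evaluating this identity pointwise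
  identifies \<open>b\<close> with the reciprocal, which thereby is seen to lie in H^(s-1).\<close>

lemma Inv:
  assumes a: "norm a \<le> eps"
  shows "Hs \<sigma> (\<lambda>x. 1 / (1 + hfn \<sigma> a x))" "hfn \<sigma> (Inv a) = (\<lambda>x. 1 / (1 + hfn \<sigma> a x))" "norm (Inv a) \<le> 2 * norm One"
proof -
  interpret M: bounded_bilinear Mul by (rule Mul_bilinear)
  have half: "norm (Mul a b) \<le> norm b / 2" for b
  proof -
    have "norm (Mul a b) \<le> algebra_const \<sigma> * norm a * norm b" by (rule norm_Mul)
    also have "\<dots> \<le> algebra_const \<sigma> * eps * norm b"
      by (intro mult_right_mono mult_left_mono a algebra_const_nonneg) auto
    also have "\<dots> \<le> 1/2 * norm b" by (intro mult_right_mono eps) auto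
    finally show ?thesis by simp
  qed
  have "\<exists>!b. One - Mul a b = b"
  proof (rule banach_fix_type[where c = "1/2"])
    show "\<forall>b c. dist (One - Mul a b) (One - Mul a c) \<le> 1/2 * dist b c"
    proof (intro allI)
      fix b c
      have "norm (Mul a (c - b)) \<le> norm (c - b) / 2" by (rule half)
      then show "dist (One - Mul a b) (One - Mul a c) \<le> 1/2 * dist b c"
        by (simp add: dist_norm M.diff_right norm_minus_commute)
    qed
  qed auto
  then obtain b where b: "One - Mul a b = b" by blast
  have nb: "norm b \<le> 2 * norm One"
  proof -
    have "norm b \<le> norm One + norm (Mul a b)" by (metis b norm_triangle_ineq4)
    then show ?thesis using half[of b] by linarith
  qed
  have "hfn \<sigma> b = (\<lambda>x. 1 / (1 + hfn \<sigma> a x))"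
  proof
    fix x
    have "hfn \<sigma> b x = hfn \<sigma> (One - Mul a b) x" using b by simp
    also have "\<dots> = 1 - hfn \<sigma> a x * hfn \<sigma> b x" by (simp add: hfn_diff[OF \<sigma>1] hfn_One hfn_Mul)
    finally have "(1 + hfn \<sigma> a x) * hfn \<sigma> b x = 1" by (simp add: algebra_simps)
    moreover have "1 + hfn \<sigma> a x \<noteq> 0" using hfn_small[OF a, of x] by (auto simp: abs_le_iff)
    ultimately show "hfn \<sigma> b x = 1 / (1 + hfn \<sigma> a x)" by (simp add: field_simps)
  qed
  then show "Hs \<sigma> (\<lambda>x. 1 / (1 + hfn \<sigma> a x))" "hfn \<sigma> (Inv a) = (\<lambda>x. 1 / (1 + hfn \<sigma> a x))" "norm (Inv a) \<le> 2 * norm One"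
    using Hs_hfn[OF \<sigma>1, of b] hco_hfn[OF \<sigma>1, of b] nb unfolding Inv_def by simp_all
qed

lemma Inv_C11: "C11_on (cball 0 eps) Inv"
proof (rule C11_on_resolvent[OF Mul_bilinear, of "2 * norm One"])
  fix a b :: hell2 assume "a \<in> cball 0 eps" "b \<in> cball 0 eps"
  then have ab: "norm a \<le> eps" "norm b \<le> eps" by auto
  have "hfn \<sigma> (Inv b - Inv a) = hfn \<sigma> (- Mul (Mul (Inv b) (Inv a)) (b - a))"
  proof
    fix x
    have nz: "1 + hfn \<sigma> a x \<noteq> 0" "1 + hfn \<sigma> b x \<noteq> 0"
      using hfn_small[OF ab(1), of x] hfn_small[OF ab(2), of x] by (auto simp: abs_le_iff)
    have "hfn \<sigma> (- Mul (Mul (Inv b) (Inv a)) (b - a)) x = - (hfn \<sigma> (Inv b) x * hfn \<sigma> (Inv a) x * (hfn \<sigma> b x - hfn \<sigma> a x))"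
      using hfn_scaleR[OF \<sigma>1, of "-1" "Mul (Mul (Inv b) (Inv a)) (b - a)"] by (simp add: hfn_Mul hfn_diff[OF \<sigma>1])
    also have "\<dots> = 1 / (1 + hfn \<sigma> b x) - 1 / (1 + hfn \<sigma> a x)"
      using nz by (simp add: Inv(2)[OF ab(1)] Inv(2)[OF ab(2)] divide_simps)
    finally show "hfn \<sigma> (Inv b - Inv a) x = hfn \<sigma> (- Mul (Mul (Inv b) (Inv a)) (b - a)) x"
      by (simp add: hfn_diff[OF \<sigma>1] Inv(2)[OF ab(1)] Inv(2)[OF ab(2)])
  qed
  then show "Inv b - Inv a = - Mul (Mul (Inv b) (Inv a)) (b - a)"
    by (metis hco_hfn[OF \<sigma>1])
qed (use Inv(3) in auto)

text \<open>A state is the pair (z, w) with eta = id + z. Here \<open>jac\<close> is eta',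
  \<open>mom\<close> is w eta' and \<open>src\<close> is the k of the overview. As
  \<open>Prim\<close> produces the derivative k minus its mean, subtracting the mean times z turns
  it into k minus the mean times eta'; \<open>force\<close> then adds the constant that makes the
  integral of f eta' vanish.\<close>

definition jac :: "hell2 \<times> hell2 \<Rightarrow> hell2" where "jac x = One + Dop (fst x)"
definition mom :: "hell2 \<times> hell2 \<Rightarrow> hell2" where "mom x = Mul (Emb (snd x)) (jac x)"
definition src :: "hell2 \<times> hell2 \<Rightarrow> hell2" where
  "src x = (2 * Mean (mom x)) *\<^sub>R mom x + (1/2) *\<^sub>R Mul (Mul (Dop (snd x)) (Dop (snd x))) (Inv (Dop (fst x)))"
definition pre :: "hell2 \<times> hell2 \<Rightarrow> hell2" where "pre x = Prim (src x) - Mean (src x) *\<^sub>R fst x"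
definition force :: "hell2 \<times> hell2 \<Rightarrow> hell2" where "force x = pre x - Mean (Mul (Emb (pre x)) (jac x)) *\<^sub>R OneX"
definition field :: "hell2 \<times> hell2 \<Rightarrow> hell2 \<times> hell2" where "field x = (snd x, force x)"

text \<open>The field is assembled from bounded linear maps, bounded bilinear maps and
  \<open>Inv\<close>, so the closure lemmas suffice. Boundedness of \<open>B\<close> enters because
  \<open>C11_with\<close> also bounds the values of the linear pieces.\<close>

lemma field_C11:
  assumes B: "bounded B" and small: "\<And>x. x \<in> B \<Longrightarrow> norm (Dop (fst x)) \<le> eps"
  shows "C11_on B field"
proof -
  note lin = bounded_linear_compose[OF _ bounded_linear_fst] bounded_linear_compose[OF _ bounded_linear_snd]
  note cl = C11_on_bounded_linear[OF _ B] and comp = C11_on_bounded_linear_comp and bil = C11_on_bilinear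
  have fst: "C11_on B fst" and snd: "C11_on B snd"
    by (rule cl[OF bounded_linear_fst] cl[OF bounded_linear_snd])+
  have Dfst: "C11_on B (\<lambda>x. Dop (fst x))" and Dsnd: "C11_on B (\<lambda>x. Dop (snd x))"
    by (rule cl[OF lin(1)[OF Dop_linear]] cl[OF lin(2)[OF Dop_linear]])+
  have jac: "C11_on B jac"
    unfolding jac_def[abs_def] by (intro C11_on_add C11_on_const Dfst)
  have mom: "C11_on B mom"
    unfolding mom_def[abs_def] by (intro bil[OF Mul_bilinear] jac cl[OF lin(2)[OF Emb_linear]])
  have inv: "C11_on B (\<lambda>x. Inv (Dop (fst x)))"
    by (rule C11_on_compose_linear[OF lin(1)[OF Dop_linear] _ Inv_C11]) (use small in auto)
  have "C11_on B (\<lambda>x. 2 * Mean (mom x))"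
    by (rule comp[OF bounded_linear_const_mult[OF Mean_linear] mom])
  then have src: "C11_on B src"
    unfolding src_def[abs_def]
    by (intro C11_on_add bil[OF bounded_bilinear_scaleR] bil[OF Mul_bilinear] C11_on_const Dsnd inv mom)
  have pre: "C11_on B pre"
    unfolding pre_def[abs_def]
    by (intro C11_on_diff bil[OF bounded_bilinear_scaleR] fst comp[OF Prim_linear src] comp[OF Mean_linear src])
  have force: "C11_on B force"
    unfolding force_def[abs_def]
    by (intro C11_on_diff bil[OF bounded_bilinear_scaleR] C11_on_const pre comp[OF Mean_linear]
        bil[OF Mul_bilinear] comp[OF Emb_linear pre] jac)
  show ?thesis
    unfolding field_def[abs_def] by (intro C11_on_Pair snd force)
qed

lemma near_id_hfn:
  assumes "norm (Dop a) \<le> eps"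
  shows "near_id s (hfn s a)"
proof
  show "s > 3/2" by (rule s)
  show "Hs s (hfn s a)" by (rule Hs_hfn[OF s1])
  show "\<bar>deriv (hfn s a) x\<bar> \<le> 1/2" for x using hfn_small[OF assms, of x] by (simp add: hfn_Dop)
  show "Hs (s - 1) (\<lambda>x. 1 / (1 + deriv (hfn s a) x))" using Inv(1)[OF assms] by (simp add: hfn_Dop)
qed

theorem Fmu_force:
  assumes a: "norm (Dop a) \<le> eps"
  shows "Fmu s (\<lambda>x. x + hfn s a x) (hfn s w) = hfn s (force (a, w))"
proof -
  interpret near_id s "hfn s a" by (rule near_id_hfn[OF a])
  let ?x = "(a, w)"
  note hs = hfn_add[OF \<sigma>1] hfn_diff[OF \<sigma>1] hfn_scaleR[OF \<sigma>1] hfn_add[OF s1] hfn_diff[OF s1] hfn_scaleR[OF s1]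
  have jac: "hfn \<sigma> (jac ?x) = eta'" by (simp add: jac_def hs hfn_One hfn_Dop)
  have mom: "hfn \<sigma> (mom ?x) = (\<lambda>x. hfn s w x * eta' x)" by (simp add: mom_def hfn_Mul hfn_Emb jac)
  have src: "hfn \<sigma> (src ?x) = (\<lambda>x. 2 * integral {0..1} (\<lambda>x. hfn s w x * eta' x) * (hfn s w x * eta' x)
      + deriv (hfn s w) x * deriv (hfn s w) x * qq x / 2)"
    unfolding src_def by (rule ext) (simp add: hs mom Mean_eq hfn_Mul hfn_Dop Inv(2)[OF a] algebra_simps)
  define k where "k = hfn \<sigma> (src ?x)"
  have pre: "hfn s (pre ?x) = (\<lambda>x. prim k x - integral {0..1} k * hfn s a x)"
    by (simp add: pre_def hs hfn_Prim Mean_eq k_def)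
  define c where "c = Mean (Mul (Emb (pre ?x)) (jac ?x))"
  have c: "c = integral {0..1} (\<lambda>x. hfn s (pre ?x) x * eta' x)"
    by (simp add: c_def Mean_eq hfn_Mul hfn_Emb jac)
  have force: "hfn s (force ?x) = (\<lambda>x. hfn s (pre ?x) x - c)"
    by (simp add: force_def hs hfn_OneX c_def)
  \<comment> \<open>Since eta' has mean 1, subtracting the constant \<open>c\<close> changes the
    integral of f eta' by exactly \<open>c\<close>.\<close>
  have int1: "integral {0..1} eta' = 1"
  proof -
    have "integral {0..1} (deriv (hfn s a)) = 0"
      by (rule integral_deriv_periodic[OF z_deriv]) (use cper_z in \<open>simp add: cper_def\<close>)
    moreover have "integral {0..1} eta' = integral {0..1} (\<lambda>x::real. 1) + integral {0..1} (deriv (hfn s a))"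
      by (intro integral_add cper_integrable cper_const cper_dz)
    ultimately show ?thesis by simp
  qed
  have df: "(hfn s (force ?x) has_real_derivative k x - integral {0..1} k * eta' x) (at x)" for x
  proof -
    have "(prim k has_real_derivative k x - integral {0..1} k) (at x)"
      unfolding k_def by (rule prim(4)[OF \<sigma>1 Hs_hfn[OF \<sigma>1]])
    then show ?thesis
      unfolding force pre by (auto intro!: derivative_eq_intros z_deriv simp: algebra_simps)
  qed
  have pc: "cper (hfn s (pre ?x))" by (rule cper_hfn[OF s1])
  have "integral {0..1} (\<lambda>x. hfn s (force ?x) x * eta' x) =
      integral {0..1} (\<lambda>x. hfn s (pre ?x) x * eta' x - c * eta' x)"
    unfolding force by (simp add: algebra_simps)
  also have "\<dots> = integral {0..1} (\<lambda>x. hfn s (pre ?x) x * eta' x) - integral {0..1} (\<lambda>x. c * eta' x)"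
    by (intro integral_diff cper_integrable cper_mult cper_const cper_eta' pc)
  also have "\<dots> = 0" using int1 c by simp
  finally have mf: "integral {0..1} (\<lambda>x. hfn s (force ?x) x * eta' x) = 0" .
  have "Fmu s eta (hfn s w) = hfn s (force ?x)"
    by (rule Fmu_eq[OF Hs_hfn[OF s1] Hs_hfn[OF s1] df[unfolded k_def src] mf])
  then show ?thesis by (simp add: eta_def[abs_def])
qed

end

subsection \<open>Translation between curves of functions and curves in the Banach space\<close>

text \<open>The fixed function \<open>c\<close> cancels in difference quotients. It is the identity
  for curves of diffeomorphisms, which are not periodic themselves, and 0 for velocities.\<close>

lemma has_Hs_deriv_iff:
  assumes s: "s > 1/2" and I: "open I" "t \<in> I"
    and \<gamma>: "\<And>\<tau>. \<tau> \<in> I \<Longrightarrow> Hs s (\<lambda>x. \<gamma> \<tau> x - c x)" and d: "Hs s d"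
  shows "has_Hs_deriv s \<gamma> d t \<longleftrightarrow>
    ((\<lambda>\<tau>. hco s (\<lambda>x. \<gamma> \<tau> x - c x)) has_vector_derivative hco s d) (at t)"
proof -
  let ?y = "\<lambda>\<tau>. hco s (\<lambda>x. \<gamma> \<tau> x - c x)"
  have "((\<lambda>h. t + h) \<longlongrightarrow> t + 0) (at 0)" by (intro tendsto_intros)
  then have "\<forall>\<^sub>F h in at 0. t + h \<in> I" using I by (intro topological_tendstoD[of _ t]) auto
  moreover have "\<forall>\<^sub>F h in at (0::real). h \<noteq> 0" by (simp add: eventually_at_filter)
  ultimately have "\<forall>\<^sub>F h in at 0. Hs_norm s (\<lambda>x. (\<gamma> (t + h) x - \<gamma> t x) / h - d x) =
      norm (?y (t + h) - ?y t - h *\<^sub>R hco s d) / norm h"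
  proof eventually_elim
    case (elim h)
    note a = \<gamma>[OF elim(1)] and b = \<gamma>[OF I(2)]
    have eq: "(\<lambda>x. (\<gamma> (t + h) x - \<gamma> t x) / h - d x) = (\<lambda>x. inverse h * ((\<gamma> (t + h) x - c x) - (\<gamma> t x - c x)) - d x)"
      by (simp add: field_simps)
    have H: "Hs s (\<lambda>x. inverse h * ((\<gamma> (t + h) x - c x) - (\<gamma> t x - c x)))"
      by (intro Hs_cmult Hs_diff a b)
    have "Hs_norm s (\<lambda>x. (\<gamma> (t + h) x - \<gamma> t x) / h - d x) =
        norm (hco s (\<lambda>x. inverse h * ((\<gamma> (t + h) x - c x) - (\<gamma> t x - c x)) - d x))"
      by (simp only: eq norm_hco[OF Hs_diff[OF H d]])
    also have "hco s (\<lambda>x. inverse h * ((\<gamma> (t + h) x - c x) - (\<gamma> t x - c x)) - d x) = inverse h *\<^sub>R (?y (t + h) - ?y t) - hco s d"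
      by (simp only: hco_diff[OF s H d] hco_cmult[OF s Hs_diff[OF a b]] hco_diff[OF s a b])
    also have "\<dots> = inverse h *\<^sub>R (?y (t + h) - ?y t - h *\<^sub>R hco s d)"
      using elim(2) by (simp add: scaleR_right_diff_distrib)
    finally show ?case by (simp add: divide_inverse mult.commute)
  qed
  then have "has_Hs_deriv s \<gamma> d t \<longleftrightarrow> ((\<lambda>h. norm (?y (t + h) - ?y t - h *\<^sub>R hco s d) / norm h) \<longlongrightarrow> 0) (at 0)"
    unfolding has_Hs_deriv_def by (rule tendsto_cong)
  then show ?thesis
    unfolding has_vector_derivative_def has_derivative_at using bounded_linear_scaleR_left by blast
qed

lemma Hs_continuous_at_iff:
  assumes s: "s > 1/2" and I: "open I" "t \<in> I" and \<gamma>: "\<And>\<tau>. \<tau> \<in> I \<Longrightarrow> Hs s (\<gamma> \<tau>)"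
  shows "Hs_continuous_at s \<gamma> t \<longleftrightarrow> isCont (\<lambda>\<tau>. hco s (\<gamma> \<tau>)) t"
proof -
  have "\<forall>\<^sub>F \<tau> in at t. \<tau> \<in> I" using I by (rule eventually_at_in_open')
  then have "\<forall>\<^sub>F \<tau> in at t. Hs_norm s (\<lambda>x. \<gamma> \<tau> x - \<gamma> t x) = norm (hco s (\<gamma> \<tau>) - hco s (\<gamma> t))"
  proof eventually_elim
    case (elim \<tau>)
    note a = \<gamma>[OF elim] and b = \<gamma>[OF I(2)]
    show ?case using norm_hco[OF Hs_diff[OF a b]] hco_diff[OF s a b] by simp
  qed
  then have "Hs_continuous_at s \<gamma> t \<longleftrightarrow> ((\<lambda>\<tau>. norm (hco s (\<gamma> \<tau>) - hco s (\<gamma> t))) \<longlongrightarrow> 0) (at t)"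
    unfolding Hs_continuous_at_def by (rule tendsto_cong)
  then show ?thesis
    by (simp add: isCont_def tendsto_norm_zero_iff LIM_zero_iff)
qed

context sobolev_index
begin

definition eta_of :: "hell2 \<times> hell2 \<Rightarrow> real \<Rightarrow> real" where "eta_of x = (\<lambda>y. y + hfn s (fst x) y)"
definition vel_of :: "hell2 \<times> hell2 \<Rightarrow> real \<Rightarrow> real" where "vel_of x = hfn s (snd x)"

lemma Fmu_of:
  assumes "norm (Dop (fst x)) \<le> eps"
  shows "Fmu s (eta_of x) (vel_of x) = hfn s (force x)"
  using Fmu_force[OF assms, of "snd x"] by (simp add: eta_of_def vel_of_def)

text \<open>Smallness is asked at every real time because the last continuity claim rewrites the
  force along the entire curve; the clamped flow satisfies this.\<close>

lemma is_sol_of_flow: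
  assumes sm: "\<And>t. norm (Dop (fst (y t))) \<le> eps"
    and y0: "y 0 = (0, hco s u)" and u: "Hs s u"
    and vd: "\<And>t. t \<in> {- T<..<T} \<Longrightarrow> (y has_vector_derivative field (y t)) (at t)"
    and cf: "\<And>t. t \<in> {- T<..<T} \<Longrightarrow> isCont (\<lambda>t. force (y t)) t"
  shows "is_sol s T u (\<lambda>t. eta_of (y t)) (\<lambda>t. vel_of (y t))"
  unfolding is_sol_def
proof (intro conjI ballI)
  show "eta_of (y 0) = (\<lambda>x. x)" by (simp add: y0 eta_of_def hfn_zero[OF s1])
  show "vel_of (y 0) = u" by (simp add: y0 vel_of_def hfn_hco[OF s1 u])
  fix t assume t: "t \<in> {- T<..<T}"
  interpret near_id s "hfn s (fst (y t))" by (rule near_id_hfn[OF sm])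
  have "eta = eta_of (y t)" by (simp add: eta_def[abs_def] eta_of_def)
  then show "Ds s (eta_of (y t))" using Ds_eta by simp
  show "Hs s (vel_of (y t))" unfolding vel_of_def by (rule Hs_hfn[OF s1])
  note H = Hs_hfn[OF s1]
  have d1: "((\<lambda>t. fst (y t)) has_vector_derivative snd (y t)) (at t)"
    using bounded_linear.has_vector_derivative[OF bounded_linear_fst vd[OF t]] by (simp add: field_def)
  have d2: "((\<lambda>t. snd (y t)) has_vector_derivative force (y t)) (at t)"
    using bounded_linear.has_vector_derivative[OF bounded_linear_snd vd[OF t]] by (simp add: field_def)
  show "has_Hs_deriv s (\<lambda>t. eta_of (y t)) (vel_of (y t)) t"
    by (subst has_Hs_deriv_iff[OF s1 open_UNIV, where c = "\<lambda>x. x"])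
       (use d1 H in \<open>simp_all add: eta_of_def vel_of_def hco_hfn[OF s1]\<close>)
  show "has_Hs_deriv s (\<lambda>t. vel_of (y t)) (Fmu s (eta_of (y t)) (vel_of (y t))) t"
    unfolding Fmu_of[OF sm]
    by (subst has_Hs_deriv_iff[OF s1 open_UNIV, where c = "\<lambda>x. 0"])
       (use d2 H in \<open>simp_all add: vel_of_def hco_hfn[OF s1]\<close>)
  show "Hs_continuous_at s (\<lambda>t. vel_of (y t)) t"
    by (subst Hs_continuous_at_iff[OF s1 open_UNIV])
       (use has_vector_derivative_continuous[OF d2] H in \<open>simp_all add: vel_of_def hco_hfn[OF s1]\<close>)
  show "Hs_continuous_at s (\<lambda>t. Fmu s (eta_of (y t)) (vel_of (y t))) t"
    unfolding Fmu_of[OF sm]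
    by (subst Hs_continuous_at_iff[OF s1 open_UNIV]) (use cf[OF t] H in \<open>simp_all add: hco_hfn[OF s1]\<close>)
qed

text \<open>For an arbitrary solution the Lagrangian formula for the force is known only while eta
  is close to the identity, so the equation is conditional whereas continuity is not. These are
  exactly the hypotheses on \<open>y\<close> in \<open>ode_unique\<close>.\<close>

lemma flow_of_is_sol:
  assumes sol: "is_sol s T u \<eta> w" and t: "t \<in> {- T<..<T}"
  defines "y \<equiv> \<lambda>t. (hco s (\<lambda>x. \<eta> t x - x), hco s (w t))"
  shows "eta_of (y t) = \<eta> t" "vel_of (y t) = w t" "isCont y t"
    "norm (Dop (fst (y t))) \<le> eps \<Longrightarrow> (y has_vector_derivative field (y t)) (at t)"
proof -
  let ?I = "{- T<..<T}"
  have D: "Hs s (\<lambda>x. \<eta> t x - x)" and W: "Hs s (w t)" and d1: "has_Hs_deriv s \<eta> (w t) t"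
    and d2: "has_Hs_deriv s w (Fmu s (\<eta> t) (w t)) t" and c: "Hs_continuous_at s w t" if "t \<in> ?I" for t
    using sol that unfolding is_sol_def Ds_def by blast+
  have e: "eta_of (y t) = \<eta> t" "vel_of (y t) = w t" if "t \<in> ?I" for t
    by (auto simp: y_def eta_of_def vel_of_def hfn_hco[OF s1 D[OF that]] hfn_hco[OF s1 W[OF that]])
  show "eta_of (y t) = \<eta> t" "vel_of (y t) = w t" by (rule e[OF t])+
  have v1: "((\<lambda>t. hco s (\<lambda>x. \<eta> t x - x)) has_vector_derivative hco s (w t)) (at t)"
    by (rule has_Hs_deriv_iff[OF s1 open_greaterThanLessThan t, where c = "\<lambda>x. x", THEN iffD1])
       (use D W[OF t] d1[OF t] in auto)
  have "isCont (\<lambda>t. hco s (w t)) t"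
    by (rule Hs_continuous_at_iff[OF s1 open_greaterThanLessThan t, THEN iffD1]) (use W c[OF t] in auto)
  then show "isCont y t"
    unfolding y_def using has_vector_derivative_continuous[OF v1] by (intro continuous_intros)
  assume sm: "norm (Dop (fst (y t))) \<le> eps"
  have F: "Fmu s (\<eta> t) (w t) = hfn s (force (y t))" using Fmu_of[OF sm] e[OF t] by simp
  have "((\<lambda>t. hco s (\<lambda>x. w t x - 0)) has_vector_derivative hco s (hfn s (force (y t)))) (at t)"
    by (rule has_Hs_deriv_iff[OF s1 open_greaterThanLessThan t, where c = "\<lambda>x. 0", THEN iffD1])
       (use W Hs_hfn[OF s1] d2[OF t] F in auto)
  then have v2: "((\<lambda>t. hco s (w t)) has_vector_derivative force (y t)) (at t)"
    by (simp add: hco_hfn[OF s1])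
  have "field (y t) = (hco s (w t), force (y t))" by (simp add: field_def y_def)
  then show "(y has_vector_derivative field (y t)) (at t)"
    using has_vector_derivative_Pair[OF v1 v2] by (simp add: y_def)
qed

text \<open>Initial states are (0, u), so the derivative is \<open>L\<close> restricted to the
  second slot; the identity in \<open>eta_of\<close> cancels in differences. Replacing the product
  norm by the sum of the two norms costs a factor 2, which is why the estimate is taken with half of
  \<epsilon>.\<close>

lemma Hs_frechet_of_derivative:
  fixes \<Gamma> :: "hell2 \<times> hell2 \<Rightarrow> hell2 \<times> hell2"
  assumes L: "(\<Gamma> has_derivative L) (at (0, hco s u))" and u: "Hs s u"
  shows "Hs_frechet s (\<lambda>v. (eta_of (\<Gamma> (0, hco s v)), vel_of (\<Gamma> (0, hco s v)))) u"
proof -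
  note H = Hs_hfn[OF s1]
  interpret L: bounded_linear L by (rule has_derivative_bounded_linear[OF L])
  define l where "l h = L (0, hco s h)" for h
  have l_add: "l (\<lambda>x. h x + g x) = l h + l g" if "Hs s h" "Hs s g" for h g
    by (simp add: l_def hco_add[OF s1 that] flip: L.add)
  have l_scale: "l (\<lambda>x. a * h x) = a *\<^sub>R l h" if "Hs s h" for h a
    by (simp add: l_def hco_cmult[OF s1 that] flip: L.scaleR)
  have n0: "norm (0 :: hell2, hco s h) = Hs_norm s h" if "Hs s h" for h
    by (simp add: norm_Pair norm_hco[OF that])
  obtain K where K: "K \<ge> 0" "\<And>x. norm (L x) \<le> norm x * K" using L.nonneg_bounded by blast
  have two: "norm (fst p) + norm (snd p) \<le> 2 * norm p" for p :: "hell2 \<times> hell2"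
    using norm_fst_le[of "fst p" "snd p"] norm_snd_le[of "snd p" "fst p"] by simp
  define M where "M h = (hfn s (fst (l h)), hfn s (snd (l h)))" for h
  show ?thesis
    unfolding Hs_frechet_def fst_conv snd_conv
  proof (intro exI[of _ M] conjI)
    show "\<forall>h g a. Hs s h \<longrightarrow> Hs s g \<longrightarrow>
        M (\<lambda>x. h x + g x) = (\<lambda>x. fst (M h) x + fst (M g) x, \<lambda>x. snd (M h) x + snd (M g) x) \<and>
        M (\<lambda>x. a * h x) = (\<lambda>x. a * fst (M h) x, \<lambda>x. a * snd (M h) x)"
      by (simp add: M_def l_add l_scale hfn_add[OF s1] hfn_scaleR[OF s1])
    have "Hs_norm s (fst (M h)) + Hs_norm s (snd (M h)) \<le> (2 * K) * Hs_norm s h" if "Hs s h" for h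
      using two[of "l h"] K(2)[of "(0, hco s h)"] n0[OF that]
      by (simp add: M_def Hs_norm_hfn[OF s1] l_def mult_ac)
    then show "\<exists>C. \<forall>h. Hs s h \<longrightarrow> Hs s (fst (M h)) \<and> Hs s (snd (M h)) \<and>
        Hs_norm s (fst (M h)) + Hs_norm s (snd (M h)) \<le> C * Hs_norm s h"
      using H by (intro exI[of _ "2 * K"]) (auto simp: M_def)
    show "\<forall>\<epsilon>>0. \<exists>\<delta>>0. \<forall>h. Hs s h \<and> Hs_norm s h < \<delta> \<longrightarrow>
        Hs_norm s (\<lambda>x. eta_of (\<Gamma> (0, hco s (\<lambda>y. u y + h y))) x - eta_of (\<Gamma> (0, hco s u)) x - fst (M h) x)
      + Hs_norm s (\<lambda>x. vel_of (\<Gamma> (0, hco s (\<lambda>y. u y + h y))) x - vel_of (\<Gamma> (0, hco s u)) x - snd (M h) x)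
        \<le> \<epsilon> * Hs_norm s h"
    proof (intro allI impI)
      fix \<epsilon> :: real assume "\<epsilon> > 0"
      then have e2: "\<epsilon> / 2 > 0" by simp
      obtain \<delta> where \<delta>: "\<delta> > 0" "\<And>x. norm (x - (0, hco s u)) < \<delta> \<Longrightarrow>
          norm (\<Gamma> x - \<Gamma> (0, hco s u) - L (x - (0, hco s u))) \<le> \<epsilon> / 2 * norm (x - (0, hco s u))"
        using L[unfolded has_derivative_at_alt] e2 by blast
      have "Hs_norm s (\<lambda>x. eta_of (\<Gamma> (0, hco s (\<lambda>y. u y + h y))) x - eta_of (\<Gamma> (0, hco s u)) x - fst (M h) x)
        + Hs_norm s (\<lambda>x. vel_of (\<Gamma> (0, hco s (\<lambda>y. u y + h y))) x - vel_of (\<Gamma> (0, hco s u)) x - snd (M h) x)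
        \<le> \<epsilon> * Hs_norm s h" if h: "Hs s h" "Hs_norm s h < \<delta>" for h
      proof -
        let ?x = "(0 :: hell2, hco s (\<lambda>y. u y + h y))"
        define p where "p = \<Gamma> ?x - \<Gamma> (0, hco s u) - l h"
        have dx: "?x - (0, hco s u) = (0, hco s h)" by (simp add: hco_add[OF s1 u h(1)])
        have np: "norm p \<le> \<epsilon> / 2 * Hs_norm s h"
          using \<delta>(2)[of ?x] h n0[OF h(1)] unfolding dx by (simp add: p_def l_def)
        have "(\<lambda>x. eta_of (\<Gamma> ?x) x - eta_of (\<Gamma> (0, hco s u)) x - fst (M h) x) = hfn s (fst p)"
          by (simp add: eta_of_def M_def p_def hfn_diff[OF s1])
        moreover have "(\<lambda>x. vel_of (\<Gamma> ?x) x - vel_of (\<Gamma> (0, hco s u)) x - snd (M h) x) = hfn s (snd p)"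
          by (simp add: vel_of_def M_def p_def hfn_diff[OF s1])
        ultimately show ?thesis using two[of p] np by (simp add: Hs_norm_hfn[OF s1])
      qed
      then show "\<exists>\<delta>>0. \<forall>h. Hs s h \<and> Hs_norm s h < \<delta> \<longrightarrow>
          Hs_norm s (\<lambda>x. eta_of (\<Gamma> (0, hco s (\<lambda>y. u y + h y))) x - eta_of (\<Gamma> (0, hco s u)) x - fst (M h) x)
        + Hs_norm s (\<lambda>x. vel_of (\<Gamma> (0, hco s (\<lambda>y. u y + h y))) x - vel_of (\<Gamma> (0, hco s u)) x - snd (M h) x)
          \<le> \<epsilon> * Hs_norm s h"
        using \<delta>(1) by blast
    qed
  qed
qed

end

theorem theorem5p2:
  fixes s :: real and uo :: "real \<Rightarrow> real"
  assumes "s > 3/2" and "Hs s uo"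
  shows "\<exists>T>0. \<exists>r>0. \<exists>\<Phi> :: (real \<Rightarrow> real) \<Rightarrow> real \<Rightarrow> (real \<Rightarrow> real) \<times> (real \<Rightarrow> real).
    (\<forall>u. Hs s u \<and> Hs_norm s (\<lambda>x. u x - uo x) < r \<longrightarrow>
        is_sol s T u (\<lambda>t. fst (\<Phi> u t)) (\<lambda>t. snd (\<Phi> u t)) \<and>
        (\<forall>\<eta> w. is_sol s T u \<eta> w \<longrightarrow>
           (\<forall>t\<in>{-T<..<T}. \<eta> t = fst (\<Phi> u t) \<and> w t = snd (\<Phi> u t)))) \<and>
    (\<forall>t\<in>{-T<..<T}. \<forall>u. Hs s u \<and> Hs_norm s (\<lambda>x. u x - uo x) < r \<longrightarrow>
        Hs_frechet s (\<lambda>v. \<Phi> v t) u)"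
proof -
  interpret sobolev_index s by standard (rule assms(1))
  define x0 where "x0 = (0 :: hell2, hco s uo)"
  obtain K where K: "K > 0" "\<And>a. norm (Dop a) \<le> norm a * K"
    using bounded_linear.pos_bounded[OF Dop_linear] by blast
  \<comment> \<open>The base point has first component 0, so within distance R the first component
    is small enough for \<open>Inv\<close>. The velocity may be large, as the smallness condition
    does not involve it.\<close>
  define R where "R = eps / K"
  have R: "R > 0" using K eps(1) by (simp add: R_def)
  have small: "norm (Dop (fst x)) \<le> eps" if "x \<in> ball x0 R" for x
  proof -
    have "norm (fst x) \<le> dist x x0"
      using dist_fst_le[of x x0] by (simp only: x0_def fst_conv norm_conv_dist)
    then have "norm (fst x) \<le> R" using that by (simp add: dist_commute)
    then have "norm (fst x) * K \<le> eps" using K(1) by (simp add: R_def field_simps)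
    then show ?thesis using K(2)[of "fst x"] by linarith
  qed
  have C11: "C11_on (ball x0 R) field" by (rule field_C11[OF bounded_ball small])
  have "continuous_on (ball x0 R) (\<lambda>x. snd (field x))"
    by (intro continuous_intros C11_on_continuous[OF C11])
  then have force_cont: "isCont force x" if "x \<in> ball x0 R" for x
    using that by (simp add: field_def continuous_on_eq_continuous_at[OF open_ball])
  obtain T r \<Gamma> where T: "T > 0" and r: "r > 0"
    and \<Gamma>0: "\<And>x. x \<in> ball x0 r \<Longrightarrow> \<Gamma> x 0 = x"
    and \<Gamma>R: "\<And>x t. x \<in> ball x0 r \<Longrightarrow> \<Gamma> x t \<in> ball x0 R"
    and \<Gamma>d: "\<And>x t. x \<in> ball x0 r \<Longrightarrow> t \<in> {- T<..<T} \<Longrightarrow> (\<Gamma> x has_vector_derivative field (\<Gamma> x t)) (at t)"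
    and \<Gamma>f: "\<And>x t. x \<in> ball x0 r \<Longrightarrow> \<exists>L. ((\<lambda>v. \<Gamma> v t) has_derivative L) (at x)"
    using ode_flow[OF C11 R] by metis
  define \<Phi> where "\<Phi> u t = (eta_of (\<Gamma> (0, hco s u) t), vel_of (\<Gamma> (0, hco s u) t))" for u t
  \<comment> \<open>The H^s ball of data around \<open>uo\<close> embeds isometrically into the ball
    of initial states, so one \<open>T\<close> and one \<open>r\<close> serve all nearby
    data.\<close>
  have ball: "(0, hco s u) \<in> ball x0 r" if "Hs s u" "Hs_norm s (\<lambda>x. u x - uo x) < r" for u
  proof -
    have "dist (0, hco s u) x0 = norm (hco s u - hco s uo)" by (simp add: x0_def dist_norm norm_Pair)
    also have "\<dots> = Hs_norm s (\<lambda>x. u x - uo x)"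
      using norm_hco[OF Hs_diff[OF that(1) assms(2)]] by (simp add: hco_diff[OF s1 that(1) assms(2)])
    finally show ?thesis using that(2) by (simp add: dist_commute)
  qed
  have sol: "is_sol s T u (\<lambda>t. fst (\<Phi> u t)) (\<lambda>t. snd (\<Phi> u t))"
    and uniq: "\<And>\<eta> w t. is_sol s T u \<eta> w \<Longrightarrow> t \<in> {-T<..<T} \<Longrightarrow> \<eta> t = fst (\<Phi> u t) \<and> w t = snd (\<Phi> u t)"
    if u: "Hs s u" "Hs_norm s (\<lambda>x. u x - uo x) < r" for u
  proof -
    let ?y = "\<Gamma> (0, hco s u)"
    note b = ball[OF u]
    have vd: "(?y has_vector_derivative field (?y t)) (at t)" if "t \<in> {- T<..<T}" for t
      by (rule \<Gamma>d[OF b that])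
    have "isCont (\<lambda>t. force (?y t)) t" if "t \<in> {- T<..<T}" for t
      by (rule isCont_o2[OF has_vector_derivative_continuous[OF vd[OF that]]]) (rule force_cont[OF \<Gamma>R[OF b]])
    then show "is_sol s T u (\<lambda>t. fst (\<Phi> u t)) (\<lambda>t. snd (\<Phi> u t))"
      unfolding \<Phi>_def fst_conv snd_conv
      by (intro is_sol_of_flow[OF small[OF \<Gamma>R[OF b]] \<Gamma>0[OF b] u(1) vd])
    fix \<eta> w t assume sol: "is_sol s T u \<eta> w" and t: "t \<in> {- T<..<T}"
    define y where "y t = (hco s (\<lambda>x. \<eta> t x - x), hco s (w t))" for t
    note F = flow_of_is_sol[OF sol, folded y_def]
    \<comment> \<open>The competing solution is compared in coordinates with the constructed flow;
      it is the latter that is known to stay in the ball.\<close>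
    have "y t = ?y t"
    proof (rule ode_unique[OF C11 _ _ _ vd _ t])
      show "continuous_on {- T<..<T} y"
        using F(3) by (intro continuous_at_imp_continuous_on) blast
      show "(y has_vector_derivative field (y t)) (at t)" if "t \<in> {- T<..<T}" "y t \<in> ball x0 R" for t
        by (rule F(4)[OF that(1) small[OF that(2)]])
      show "?y t \<in> ball x0 R" for t by (rule \<Gamma>R[OF b])
      have "\<eta> 0 = (\<lambda>x. x)" "w 0 = u" using sol by (auto simp: is_sol_def)
      moreover have "hco s (\<lambda>x. 0) = 0" using hco_hfn[OF s1, of 0] by (simp add: hfn_zero[OF s1])
      ultimately show "y 0 = ?y 0" using \<Gamma>0[OF b] by (simp add: y_def)
    qed
    with F(1,2)[OF t] show "\<eta> t = fst (\<Phi> u t) \<and> w t = snd (\<Phi> u t)" by (simp add: \<Phi>_def)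
  qed
  have frechet: "Hs_frechet s (\<lambda>v. \<Phi> v t) u" if u: "Hs s u" "Hs_norm s (\<lambda>x. u x - uo x) < r" for t u
  proof -
    obtain L where L: "((\<lambda>v. \<Gamma> v t) has_derivative L) (at (0, hco s u))" using \<Gamma>f[OF ball[OF u]] by blast
    show ?thesis
      unfolding \<Phi>_def by (rule Hs_frechet_of_derivative[OF L u(1)])
  qed
  show ?thesis
    by (rule exI[of _ T], rule conjI[OF T], rule exI[of _ r], rule conjI[OF r], rule exI[of _ \<Phi>])
       (use sol uniq frechet in blast)
qed

end
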